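(* Let $u\in\mathfrak{B}^{s}(\Omega)$ with $s\ge 3$, and let $B=\left(1+\frac{2d}{\pi s}\right)\|u\|_{\mathfrak{B}^{s}(\Omega)}$. Then for every positive integer $m$, with $\tau=9\sqrt m$, there exists $v_m\in\mathcal{F}_{\mathrm{SP}_\tau,m}(B)$ such that $$\|u-\varphi v_m\|_{H^1(\Omega)}\le\frac{64B}{\sqrt m}.$$
   Context: $\Omega=(0,1)^d$, $d\ge 1$. For $k\in\mathbb{N}_+^d$ (positive integer vectors) let $\Phi_k(x)=\prod_{i=1}^d\sin(\pi k_i x_i)$, and for $u\in L^1(\Omega)$ let $\hat u(k)=2^d\int_\Omega u\,\Phi_k\,dx$ be its sine coefficients. With $|k|_1$ the $\ell^1$-norm, $\|u\|_{\mathfrak{B}^s(\Omega)}=\sum_{k\in\mathbb{N}_+^d}(1+\pi^s|k|_1^s)|\hat u(k)|$, and $\mathfrak{B}^s(\Omega)=\{u\in L^1(\Omega):\|u\|_{\mathfrak{B}^s(\Omega)}<\infty\}$ (sine spectral Barron space). The cut-off function is $\varphi(x)=\left[\sum_{i=1}^d\frac{1}{\sin(\pi x_i)}\right]^{-1}$ for $x\in\Omega$ (extended by $0$ to $\partial\Omega$). For an activation function $\phi:\mathbb{R}\to\mathbb{R}$, a positive integer $m$ and $B\geq 0$, $$\mathcal{F}_{\phi,m}(B)=\Big\{x\mapsto c+\sum_{i=1}^m\gamma_i\phi(w_i\cdot x-t_i):\ |c|\le B,\ w_i\in\mathbb{R}^d,\ |w_i|_1=1,\ |t_i|\le1,\ \sum_{i=1}^m|\gamma_i|\le4B\Big\}.$$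 For $\tau>0$ the rescaled Softplus activation is $\mathrm{SP}_\tau(z)=\tau^{-1}\ln(1+e^{\tau z})$. $\|f\|_{H^1(\Omega)}^2=\|f\|_{L^2(\Omega)}^2+\|\nabla f\|_{L^2(\Omega)}^2$. *)

theory Defs
  imports "HOL-Analysis.Analysis"
begin

text \<open>
  Here \<open>1\<close> is the vector all of whose components are 1, so this is the open unit cube.  The
  dimension is \<open>CARD('n)\<close>.
\<close>

definition unit_cube :: "(real ^ 'n) set" where
  "unit_cube = box 0 1"

definition l1_norm :: "real ^ 'n \<Rightarrow> real" where
  "l1_norm x = (\<Sum>i\<in>UNIV. \<bar>x $ i\<bar>)"


subsection \<open>Sine spectral Barron spaces\<close>

definition sine_basis :: "nat ^ 'n \<Rightarrow> real ^ 'n \<Rightarrow> real" where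
  "sine_basis k x = (\<Prod>i\<in>UNIV. sin (pi * real (k $ i) * x $ i))"

definition sine_coeff :: "(real ^ 'n \<Rightarrow> real) \<Rightarrow> nat ^ 'n \<Rightarrow> real" where
  "sine_coeff u k = 2 ^ CARD('n) * (LINT x:unit_cube|lebesgue. u x * sine_basis k x)"

definition barron_norm :: "real \<Rightarrow> (real ^ 'n \<Rightarrow> real) \<Rightarrow> ennreal" where
  "barron_norm s u = (\<Sum>\<^sub>\<infinity>k\<in>{k :: nat ^ 'n. \<forall>i. k $ i > 0}.
     ennreal ((1 + pi powr s * l1_norm (\<chi> i. real (k $ i)) powr s) * \<bar>sine_coeff u k\<bar>))"

text \<open>Functions are representatives; their values outside the cube are irrelevant.\<close>

definition barron_space :: "real \<Rightarrow> (real ^ 'n \<Rightarrow> real) set" where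
  "barron_space s = {u. set_integrable lebesgue unit_cube u \<and> barron_norm s u < \<infinity>}"


subsection \<open>The Sobolev space of order one\<close>

definition partial_deriv :: "'n \<Rightarrow> (real ^ 'n \<Rightarrow> real) \<Rightarrow> real ^ 'n \<Rightarrow> real" where
  "partial_deriv i f x = frechet_derivative f (at x) (axis i 1)"

primrec C_k :: "nat \<Rightarrow> (real ^ 'n \<Rightarrow> real) \<Rightarrow> bool" where
  "C_k 0 f \<longleftrightarrow> continuous_on UNIV f"
| "C_k (Suc k) f \<longleftrightarrow> (\<forall>x. f differentiable at x) \<and> (\<forall>i. C_k k (partial_deriv i f))"

definition test_function :: "(real ^ 'n) set \<Rightarrow> (real ^ 'n \<Rightarrow> real) \<Rightarrow> bool" where
  "test_function S \<psi> \<longleftrightarrow> (\<forall>k. C_k k \<psi>) \<and>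
     compact (closure {x. \<psi> x \<noteq> 0}) \<and> closure {x. \<psi> x \<noteq> 0} \<subseteq> S"

definition locally_integrable ::
    "(real ^ 'n) set \<Rightarrow> (real ^ 'n \<Rightarrow> 'b::euclidean_space) \<Rightarrow> bool" where
  "locally_integrable S f \<longleftrightarrow> (\<forall>K. compact K \<and> K \<subseteq> S \<longrightarrow> set_integrable lebesgue K f)"

definition weak_gradient ::
    "(real ^ 'n) set \<Rightarrow> (real ^ 'n \<Rightarrow> real) \<Rightarrow> (real ^ 'n \<Rightarrow> real ^ 'n) \<Rightarrow> bool" where
  "weak_gradient S f g \<longleftrightarrow> locally_integrable S f \<and> locally_integrable S g \<and>
     (\<forall>\<psi> i. test_function S \<psi> \<longrightarrow>
        (LINT x:S|lebesgue. f x * partial_deriv i \<psi> x) = - (LINT x:S|lebesgue. g x $ i * \<psi> x))"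

definition square_integrable ::
    "(real ^ 'n) set \<Rightarrow> (real ^ 'n \<Rightarrow> 'b::euclidean_space) \<Rightarrow> bool" where
  "square_integrable S f \<longleftrightarrow> set_borel_measurable lebesgue S f \<and>
     set_integrable lebesgue S (\<lambda>x. (norm (f x))\<^sup>2)"

definition L2_norm :: "(real ^ 'n) set \<Rightarrow> (real ^ 'n \<Rightarrow> 'b::euclidean_space) \<Rightarrow> real" where
  "L2_norm S f = sqrt (LINT x:S|lebesgue. (norm (f x))\<^sup>2)"

definition H1_space :: "(real ^ 'n) set \<Rightarrow> (real ^ 'n \<Rightarrow> real) set" where
  "H1_space S = {f. square_integrable S f \<and> (\<exists>g. weak_gradient S f g \<and> square_integrable S g)}"

text \<open>
  On an open set the weak gradient is unique up to null sets, so for \<open>f \<in> H1_space S\<close> the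
  infimum below is taken over a single value; it avoids choosing a representative of the gradient.
\<close>

definition H1_norm :: "(real ^ 'n) set \<Rightarrow> (real ^ 'n \<Rightarrow> real) \<Rightarrow> real" where
  "H1_norm S f = (INF g \<in> {g. weak_gradient S f g \<and> square_integrable S g}.
     sqrt ((L2_norm S f)\<^sup>2 + (L2_norm S g)\<^sup>2))"


subsection \<open>Cut-off function and two-layer networks\<close>

definition cutoff :: "real ^ 'n \<Rightarrow> real" where
  "cutoff x = (if x \<in> unit_cube then inverse (\<Sum>i\<in>UNIV. 1 / sin (pi * x $ i)) else 0)"

definition softplus :: "real \<Rightarrow> real \<Rightarrow> real" where
  "softplus \<tau> z = ln (1 + exp (\<tau> * z)) / \<tau>"

definition network_class :: "(real \<Rightarrow> real) \<Rightarrow> nat \<Rightarrow> real \<Rightarrow> (real ^ 'n \<Rightarrow> real) set" where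
  "network_class \<phi> m B =
     {(\<lambda>x. c + (\<Sum>i=1..m. \<gamma> i * \<phi> (w i \<bullet> x - t i))) | c \<gamma> w t.
        \<bar>c\<bar> \<le> B \<and> (\<forall>i\<in>{1..m}. l1_norm (w i) = 1 \<and> \<bar>t i\<bar> \<le> 1) \<and>
        (\<Sum>i=1..m. \<bar>\<gamma> i\<bar>) \<le> 4 * B}"

end

theory Submission
  imports Defs
begin

text \<open>
  Why a division by the cut-off function helps: \<open>1 / cutoff x\<close> is the sum of the
  \<open>1 / sin (\<pi> x\<^sub>i)\<close>, and \<open>sin (\<pi> k z) / sin (\<pi> z)\<close> is a sum of \<open>k\<close> cosines.  Hence the quotient of a
  sine basis function by the cut-off is a trigonometric polynomial (\<open>cutoff_sine_quotient\<close>): a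
  combination of waves \<open>cos (\<pi> n \<bullet> x + b)\<close> of total weight \<open>|k|\<^sub>1\<close> and frequencies
  \<open>|n|\<^sub>1 \<le> |k|\<^sub>1\<close> (\<open>trig_comb_sine_quotient\<close>).  So \<open>u / cutoff\<close> is, up to a small tail, a finite combination of
  such waves, without any boundary condition.

  A wave depends only on \<open>z = w \<bullet> x\<close> with \<open>w = n / |n|\<^sub>1\<close>, and \<open>z\<close> stays in \<open>[-1, 1]\<close>.  In this one
  variable, a function \<open>h\<close> is the superposition of the ReLU functions \<open>ReLU (z - t)\<close> with density
  \<open>h''(t)\<close>, plus an affine function.  Replacing ReLU by softplus costs \<open>O(1/\<tau>)\<close> in the derivative,
  uniformly in \<open>z\<close>, because the sigmoid and the Heaviside function differ by an exponentially decaying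
  function of \<open>\<tau> (z - t)\<close>, which has integral \<open>O(1/\<tau>)\<close>.  This error is integrated over \<open>t\<close> and never
  concentrated at one \<open>t\<close>, which is why no logarithm of \<open>m\<close> appears; the linear part is reproduced exactly by
  \<open>softplus z - softplus (-z) = z\<close>.  Both the mass of the network and the error are of order
  \<open>h'' = O(|n|\<^sub>1\<^sup>2)\<close>; with the weight \<open>|k|\<^sub>1\<close> from above this amounts to \<open>|k|\<^sub>1\<^sup>3\<close>, and this is where
  \<open>s \<ge> 3\<close> enters (\<open>softplus_approx_1d\<close>, \<open>net_approx_sine_quotient\<close>).

  The result is a network of uncontrolled size, but of mass at most twice the Barron norm, whose product with
  the cut-off is within \<open>O(1 / \<surd>m)\<close> of \<open>u\<close> together with first derivatives, since \<open>\<tau> = 9 \<surd>m\<close>, \<open>|cutoff| \<le> 1\<close> and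
  \<open>|\<nabla> cutoff| \<le> \<pi>\<close> on the cube.  Maurey's sampling argument in the Hilbert space of the fields
  \<open>(cutoff f, \<nabla> (cutoff f))\<close> reduces it to \<open>m\<close> neurons with an additional error
  \<open>O(mass / \<surd>m)\<close> (\<open>maurey_sampling\<close>, \<open>cutoff_net_sampling\<close>).

  Two analytic facts relate this to the definitions.  An integrable function on the cube is determined by its sine
  coefficients, so \<open>u\<close> is almost everywhere the sum of its sine series (\<open>sine_series_unique\<close>,
  \<open>barron_sine_expansion\<close>).  A differentiable function on the cube that is bounded together with its
  gradient has that gradient as weak gradient (\<open>H1_classical\<close>).
\<close>

section \<open>The softplus function and one-dimensional approximation\<close>

definition sigmoid :: "real \<Rightarrow> real" where
  "sigmoid z = 1 / (1 + exp (- z))"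

lemma has_real_derivative_softplus:
  assumes "\<tau> > 0"
  shows "(softplus \<tau> has_real_derivative sigmoid (\<tau> * z)) (at z)"
proof -
  have pos: "1 + exp (\<tau> * y) > 0" for y :: real
    by (simp add: add_pos_pos)
  have "((\<lambda>z. ln (1 + exp (\<tau> * z)) / \<tau>) has_real_derivative
      (exp (\<tau> * z) * \<tau> / (1 + exp (\<tau> * z))) / \<tau>) (at z)"
    using pos[of z] assms by (auto intro!: derivative_eq_intros)
  moreover have "(exp (\<tau> * z) * \<tau> / (1 + exp (\<tau> * z))) / \<tau> = sigmoid (\<tau> * z)"
  proof -
    define e where "e = exp (\<tau> * z)"
    have e: "e > 0" by (simp add: e_def)
    have "sigmoid (\<tau> * z) = 1 / (1 + 1 / e)"
      by (simp add: sigmoid_def e_def exp_minus inverse_eq_divide)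
    also have "1 + 1 / e = (1 + e) / e" using e by (simp add: add_divide_distrib)
    finally show ?thesis using assms by (simp add: e_def)
  qed
  ultimately show ?thesis
    unfolding softplus_def[abs_def] by simp
qed

lemma sigmoid_bounds: "0 \<le> sigmoid z" "sigmoid z \<le> 1"
  by (auto simp: sigmoid_def add_pos_pos)

text \<open>
  Two neurons of weight \<open>\<plusminus>1\<close> thus reproduce a linear function without error.
\<close>

lemma softplus_diff_reflect:
  assumes "\<tau> > 0"
  shows "softplus \<tau> z - softplus \<tau> (- z) = z"
proof -
  have "1 + exp (\<tau> * z) = exp (\<tau> * z) * (1 + exp (\<tau> * - z))"
    by (simp add: algebra_simps flip: exp_add)
  then have "ln (1 + exp (\<tau> * z)) = \<tau> * z + ln (1 + exp (\<tau> * - z))"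
    by (simp add: ln_mult add_pos_pos order_less_imp_not_eq2)
  then show ?thesis
    using assms by (simp add: softplus_def field_simps)
qed

lemma softplus_bounds:
  assumes "\<tau> > 0" "\<bar>z\<bar> \<le> r"
  shows "0 \<le> softplus \<tau> z" "softplus \<tau> z \<le> r + 1 / \<tau>"
proof -
  show "0 \<le> softplus \<tau> z"
    using assms by (simp add: softplus_def)
  have "0 \<le> r" "\<tau> * z \<le> \<tau> * r"
    using assms by auto
  then have "1 + exp (\<tau> * z) \<le> 2 * exp (\<tau> * r)"
    using assms by (smt (verit) exp_le_cancel_iff one_le_exp_iff mult_nonneg_nonneg)
  then have "ln (1 + exp (\<tau> * z)) \<le> ln (2 * exp (\<tau> * r))"
    by (subst ln_le_cancel_iff) (auto simp: add_pos_pos)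
  also have "\<dots> = ln 2 + \<tau> * r"
    by (simp add: ln_mult)
  also have "\<dots> \<le> 1 + \<tau> * r"
    using ln_2_less_1 by simp
  finally show "softplus \<tau> z \<le> r + 1 / \<tau>"
    using assms by (simp add: softplus_def field_simps)
qed

text \<open>
  The error of a smoothed step, which makes the total error of a grid of steps a geometric sum.
\<close>

lemma sigmoid_Heaviside:
  "\<bar>sigmoid z - (if 0 \<le> z then 1 else 0)\<bar> \<le> exp (- \<bar>z\<bar>)"
proof -
  define e where "e = exp (- z)"
  have e: "e > 0" by (simp add: e_def)
  have s: "sigmoid z = 1 / (1 + e)" by (simp add: sigmoid_def e_def)
  show ?thesis
  proof (cases "0 \<le> z")
    case True
    have "1 - sigmoid z = e / (1 + e)" using e by (simp add: s diff_divide_eq_iff)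
    also have "\<dots> \<le> e / 1" using e by (intro divide_left_mono) auto
    finally show ?thesis using True sigmoid_bounds(2)[of z] by (simp add: e_def)
  next
    case False
    have "sigmoid z \<le> 1 / e" unfolding s using e by (intro divide_left_mono) auto
    also have "1 / e = exp z" by (simp add: e_def exp_minus inverse_eq_divide)
    finally show ?thesis using False sigmoid_bounds(1)[of z] by simp
  qed
qed

text \<open>
  With \<open>q = exp (- \<tau> \<delta>)\<close> the sum is at most \<open>1 / (1 - q)\<close>, and \<open>1 - q \<ge> \<tau> \<delta> / (1 + \<tau> \<delta>)\<close>.  After
  multiplication by the mesh size \<open>\<delta>\<close> the bound stays finite as the grid is refined.
\<close>

lemma sum_exp_grid:
  assumes "\<tau> > 0" "\<delta> > 0"
  shows "\<delta> * (\<Sum>i<n. exp (- (\<tau> * (\<delta> * real i)))) \<le> \<delta> + 1 / \<tau>"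
proof -
  define q where "q = exp (- (\<tau> * \<delta>))"
  have x: "\<tau> * \<delta> > 0" using assms by simp
  have q: "0 < q" "q < 1" using x by (auto simp: q_def)
  have "(\<Sum>i<n. exp (- (\<tau> * (\<delta> * real i)))) = (\<Sum>i<n. q ^ i)"
    by (intro sum.cong) (auto simp: q_def mult_ac simp flip: exp_of_nat_mult)
  also have "\<dots> = (1 - q ^ n) / (1 - q)"
    using q by (simp add: sum_gp_strict)
  also have "\<dots> \<le> 1 / (1 - q)"
    using q by (intro divide_right_mono) auto
  also have "\<dots> \<le> 1 + 1 / (\<tau> * \<delta>)"
  proof -
    have "1 + \<tau> * \<delta> \<le> exp (\<tau> * \<delta>)" by (rule exp_ge_add_one_self)
    then have "q * (1 + \<tau> * \<delta>) \<le> q * exp (\<tau> * \<delta>)"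
      using q by simp
    also have "\<dots> = 1" by (simp add: q_def flip: exp_add)
    finally show ?thesis
      using q x assms by (simp add: field_simps)
  qed
  finally have "(\<Sum>i<n. exp (- (\<tau> * (\<delta> * real i)))) \<le> 1 + 1 / (\<tau> * \<delta>)" .
  then have "\<delta> * (\<Sum>i<n. exp (- (\<tau> * (\<delta> * real i)))) \<le> \<delta> * (1 + 1 / (\<tau> * \<delta>))"
    using assms by (intro mult_left_mono) auto
  also have "\<dots> = \<delta> + 1 / \<tau>"
    using assms by (simp add: field_simps)
  finally show ?thesis .
qed

text \<open>
  A discrete form of \<open>h1 z - h1 (-1) = \<integral> h1'(t) Heaviside (z - t) dt\<close>: the increments of \<open>h1\<close> over a grid
  are the weights of the steps, so that with exact steps the sum telescopes.  Each weight is at most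
  \<open>L \<delta>\<close>, hence by \<open>sum_exp_grid\<close> the smoothing of the steps costs at most \<open>L (\<delta> + 1/\<tau>)\<close> on either
  side of \<open>z\<close>, independently of the number of steps.
\<close>

lemma sigmoid_grid_approx:
  fixes h1 :: "real \<Rightarrow> real"
  assumes \<tau>: "\<tau> > 0" and \<delta>: "\<delta> = 2 / real N" "N > 0" "\<delta> \<le> 1 / \<tau>"
    and lip: "\<And>y z. \<bar>h1 y - h1 z\<bar> \<le> L * \<bar>y - z\<bar>"
    and z: "\<bar>z\<bar> \<le> 1"
  defines "t \<equiv> \<lambda>j. - 1 + \<delta> * real j"
  shows "\<bar>h1 z - h1 (- 1) - (\<Sum>j<N. (h1 (t (Suc j)) - h1 (t j)) * sigmoid (\<tau> * (z - t j)))\<bar>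
    \<le> 5 * L / \<tau>"
proof -
  have \<delta>0: "\<delta> > 0" using \<delta> by simp
  have L0: "0 \<le> L" using lip[of 0 1] by simp
  define \<gamma> where "\<gamma> j = h1 (t (Suc j)) - h1 (t j)" for j
  have \<gamma>: "\<bar>\<gamma> j\<bar> \<le> L * \<delta>" for j
  proof -
    have "\<bar>\<gamma> j\<bar> \<le> L * \<bar>t (Suc j) - t j\<bar>" unfolding \<gamma>_def by (rule lip)
    also have "t (Suc j) - t j = \<delta>" by (simp add: t_def algebra_simps)
    finally show ?thesis using \<delta>0 by simp
  qed
  have tN: "t N = 1" using \<delta> by (simp add: t_def)
  \<comment> \<open>\<open>J\<close> is the number of breakpoints \<open>t j\<close>, \<open>j < N\<close>, not to the right of \<open>z\<close>.\<close>
  obtain J where J: "J \<le> N" "\<And>j. j < J \<Longrightarrow> t j \<le> z - \<delta> * real (J - 1 - j)"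
      "\<And>j. j \<ge> J \<Longrightarrow> j < N \<Longrightarrow> z + \<delta> * real (j - J) < t j" "\<bar>z - t J\<bar> \<le> \<delta>"
  proof -
    define J0 where "J0 = nat \<lfloor>(z + 1) / \<delta>\<rfloor>"
    have f: "real J0 \<le> (z + 1) / \<delta>" "(z + 1) / \<delta> < real J0 + 1"
      using z \<delta>0 unfolding J0_def by (auto simp: of_nat_nat)
    have f: "\<delta> * real J0 \<le> z + 1" "z + 1 < \<delta> * real J0 + \<delta>"
      using f \<delta>0 by (auto simp: field_simps)
    show ?thesis
    proof (cases "J0 < N")
      case True
      show ?thesis
      proof (rule that[of "Suc J0"])
        fix j assume "j < Suc J0"
        then show "t j \<le> z - \<delta> * real (Suc J0 - 1 - j)"
          using f by (simp add: t_def of_nat_diff algebra_simps)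
      next
        fix j assume "j \<ge> Suc J0"
        then show "z + \<delta> * real (j - Suc J0) < t j"
          using f by (simp add: t_def of_nat_diff algebra_simps)
      qed (use True f \<delta>0 in \<open>auto simp: t_def algebra_simps\<close>)
    next
      case False
      then have "\<delta> * real N \<le> \<delta> * real J0" using \<delta>0 by simp
      moreover have "\<delta> * real N = 2" using tN by (simp add: t_def)
      ultimately have z1: "z = 1" using f z by linarith
      show ?thesis
      proof (rule that[of N])
        fix j assume "j < N"
        then show "t j \<le> z - \<delta> * real (N - 1 - j)"
          using z1 tN \<delta>0 by (simp add: t_def of_nat_diff algebra_simps)
      qed (use z1 tN \<delta>0 in auto)
    qed
  qed
  have tele: "(\<Sum>j<J. \<gamma> j) = h1 (t J) - h1 (- 1)"
    unfolding \<gamma>_def by (subst sum_lessThan_telescope) (simp add: t_def)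
  have split: "{..<N} = {..<J} \<union> {J..<N}" using J(1) by auto
  have s0: "(\<Sum>j<N. \<gamma> j * sigmoid (\<tau> * (z - t j))) =
      (\<Sum>j<J. \<gamma> j * sigmoid (\<tau> * (z - t j))) + (\<Sum>j=J..<N. \<gamma> j * sigmoid (\<tau> * (z - t j)))"
    unfolding split by (rule sum.union_disjoint) auto
  have lower: "\<bar>(\<Sum>j<J. \<gamma> j) - (\<Sum>j<J. \<gamma> j * sigmoid (\<tau> * (z - t j)))\<bar> \<le> L * (\<delta> + 1 / \<tau>)"
  proof -
    have "\<bar>(\<Sum>j<J. \<gamma> j) - (\<Sum>j<J. \<gamma> j * sigmoid (\<tau> * (z - t j)))\<bar>
        = \<bar>\<Sum>j<J. \<gamma> j * (1 - sigmoid (\<tau> * (z - t j)))\<bar>"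
      by (simp add: sum_subtractf algebra_simps)
    also have "\<dots> \<le> (\<Sum>j<J. \<bar>\<gamma> j * (1 - sigmoid (\<tau> * (z - t j)))\<bar>)" by (rule sum_abs)
    also have "\<dots> \<le> (\<Sum>j<J. (L * \<delta>) * exp (- (\<tau> * (\<delta> * real (J - 1 - j)))))"
    proof (intro sum_mono)
      fix j assume "j \<in> {..<J}"
      then have a: "\<delta> * real (J - 1 - j) \<le> z - t j" using J(2)[of j] by simp
      have b: "0 \<le> z - t j" using a \<delta>0 by (smt (verit) mult_nonneg_nonneg of_nat_0_le_iff)
      have "\<bar>sigmoid (\<tau> * (z - t j)) - 1\<bar> \<le> exp (- \<bar>\<tau> * (z - t j)\<bar>)"
        using sigmoid_Heaviside[of "\<tau> * (z - t j)"] b \<tau> by simp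
      also have "\<dots> \<le> exp (- (\<tau> * (\<delta> * real (J - 1 - j))))"
        using a b \<tau> by simp
      finally have "\<bar>1 - sigmoid (\<tau> * (z - t j))\<bar> \<le> exp (- (\<tau> * (\<delta> * real (J - 1 - j))))"
        by (simp add: abs_minus_commute)
      then show "\<bar>\<gamma> j * (1 - sigmoid (\<tau> * (z - t j)))\<bar>
          \<le> (L * \<delta>) * exp (- (\<tau> * (\<delta> * real (J - 1 - j))))"
        unfolding abs_mult using \<gamma>[of j] L0 \<delta>0 by (intro mult_mono) auto
    qed
    also have "\<dots> = (L * \<delta>) * (\<Sum>j<J. exp (- (\<tau> * (\<delta> * real (J - Suc j)))))"
      by (simp add: sum_distrib_left)
    also have "(\<Sum>j<J. exp (- (\<tau> * (\<delta> * real (J - Suc j))))) =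
        (\<Sum>j<J. exp (- (\<tau> * (\<delta> * real j))))"
      by (rule sum.nat_diff_reindex)
    also have "(L * \<delta>) * \<dots> = L * (\<delta> * \<dots>)" by simp
    also have "\<dots> \<le> L * (\<delta> + 1 / \<tau>)"
      using sum_exp_grid[OF \<tau> \<delta>0] L0 by (intro mult_left_mono) auto
    finally show ?thesis .
  qed
  have upper: "\<bar>\<Sum>j=J..<N. \<gamma> j * sigmoid (\<tau> * (z - t j))\<bar> \<le> L * (\<delta> + 1 / \<tau>)"
  proof -
    have "\<bar>\<Sum>j=J..<N. \<gamma> j * sigmoid (\<tau> * (z - t j))\<bar>
       \<le> (\<Sum>j=J..<N. \<bar>\<gamma> j * sigmoid (\<tau> * (z - t j))\<bar>)" by (rule sum_abs)
    also have "\<dots> \<le> (\<Sum>j=J..<N. (L * \<delta>) * exp (- (\<tau> * (\<delta> * real (j - J)))))"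
    proof (intro sum_mono)
      fix j assume "j \<in> {J..<N}"
      then have "z + \<delta> * real (j - J) < t j" using J(3)[of j] by simp
      moreover have "0 \<le> \<delta> * real (j - J)" using \<delta>0 by simp
      ultimately have a: "\<delta> * real (j - J) \<le> t j - z" "\<not> 0 \<le> z - t j"
        by linarith+
      have "\<bar>sigmoid (\<tau> * (z - t j))\<bar> \<le> exp (- \<bar>\<tau> * (z - t j)\<bar>)"
        using sigmoid_Heaviside[of "\<tau> * (z - t j)"] a \<tau> by (simp add: zero_le_mult_iff)
      also have "\<dots> \<le> exp (- (\<tau> * (\<delta> * real (j - J))))"
        using a \<tau> by (simp add: abs_mult)
      finally show "\<bar>\<gamma> j * sigmoid (\<tau> * (z - t j))\<bar>
          \<le> (L * \<delta>) * exp (- (\<tau> * (\<delta> * real (j - J))))"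
        unfolding abs_mult using \<gamma>[of j] L0 \<delta>0 by (intro mult_mono) auto
    qed
    also have "\<dots> = (L * \<delta>) * (\<Sum>j=J..<N. exp (- (\<tau> * (\<delta> * real (j - J)))))"
      by (simp add: sum_distrib_left)
    also have "(\<Sum>j=J..<N. exp (- (\<tau> * (\<delta> * real (j - J))))) =
        (\<Sum>j<N-J. exp (- (\<tau> * (\<delta> * real j))))"
      by (rule sum.reindex_bij_witness[of _ "\<lambda>j. j + J" "\<lambda>j. j - J"]) auto
    also have "(L * \<delta>) * \<dots> = L * (\<delta> * \<dots>)" by simp
    also have "\<dots> \<le> L * (\<delta> + 1 / \<tau>)"
      using sum_exp_grid[OF \<tau> \<delta>0] L0 by (intro mult_left_mono) auto
    finally show ?thesis .
  qed
  have "\<bar>h1 z - h1 (t J)\<bar> \<le> L * \<delta>"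
    using lip[of z "t J"] J(4) L0 by (meson mult_left_mono order_trans)
  then have "\<bar>h1 z - h1 (- 1) - (\<Sum>j<N. \<gamma> j * sigmoid (\<tau> * (z - t j)))\<bar>
      \<le> L * \<delta> + L * (\<delta> + 1 / \<tau>) + L * (\<delta> + 1 / \<tau>)"
    using lower upper tele s0 by linarith
  also have "\<dots> = L * (3 * \<delta> + 2 * (1 / \<tau>))" by (simp add: algebra_simps)
  also have "\<dots> \<le> L * (5 * (1 / \<tau>))"
    using L0 \<delta>(3) by (intro mult_left_mono) auto
  finally show ?thesis by (simp add: \<gamma>_def mult.commute)
qed

text \<open>
  The approximation is chosen so that its derivative is the one of \<open>sigmoid_grid_approx\<close>, and its constant term so
  that the error vanishes at \<open>0\<close>; the mean value theorem then turns the bound on the derivative of the error into a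
  bound on the error itself.  A triple \<open>(\<gamma>, \<sigma>, t)\<close> stands for the neuron
  \<open>\<gamma> softplus (\<sigma> z - t)\<close>.
\<close>

lemma softplus_approx_1d:
  fixes h h1 :: "real \<Rightarrow> real"
  assumes \<tau>: "\<tau> > 0"
    and h: "\<And>z. (h has_real_derivative h1 z) (at z)"
    and lip: "\<And>y z. \<bar>h1 y - h1 z\<bar> \<le> L * \<bar>y - z\<bar>"
    and a: "\<bar>h1 (- 1)\<bar> \<le> a"
  obtains c :: real and ns :: "(real \<times> real \<times> real) list"
  where "\<bar>c\<bar> \<le> \<bar>h 0\<bar> + 2 * L * (1 + 1 / \<tau>)"
    and "\<And>\<gamma> \<sigma> t. (\<gamma>, \<sigma>, t) \<in> set ns \<Longrightarrow> \<bar>\<sigma>\<bar> = 1 \<and> \<bar>t\<bar> \<le> 1"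
    and "(\<Sum>(\<gamma>, \<sigma>, t)\<leftarrow>ns. \<bar>\<gamma>\<bar>) \<le> 2 * a + 2 * L"
    and "\<And>z. \<bar>z\<bar> \<le> 1 \<Longrightarrow> \<bar>h z - c - (\<Sum>(\<gamma>, \<sigma>, t)\<leftarrow>ns. \<gamma> * softplus \<tau> (\<sigma> * z - t))\<bar> \<le> 5 * L / \<tau>"
    and "\<And>z. \<bar>z\<bar> \<le> 1 \<Longrightarrow> \<exists>D. \<bar>D\<bar> \<le> 5 * L / \<tau> \<and>
      ((\<lambda>z. h z - c - (\<Sum>(\<gamma>, \<sigma>, t)\<leftarrow>ns. \<gamma> * softplus \<tau> (\<sigma> * z - t))) has_real_derivative D) (at z)"
proof -
  \<comment> \<open>The grid on \<open>[-1, 1]\<close> must have mesh size at most \<open>1 / \<tau>\<close>.\<close>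
  define N where "N = nat \<lceil>2 * \<tau>\<rceil>"
  have N: "N > 0" "real N \<ge> 2 * \<tau>" using \<tau> by (auto simp: N_def)
  define \<delta> where "\<delta> = 2 / real N"
  have \<delta>: "\<delta> = 2 / real N" "\<delta> > 0" "\<delta> \<le> 1 / \<tau>"
    using N \<tau> by (auto simp: \<delta>_def field_simps)
  have L0: "0 \<le> L" using lip[of 0 1] by simp
  define t where "t j = - 1 + \<delta> * real j" for j
  define \<gamma> where "\<gamma> j = h1 (t (Suc j)) - h1 (t j)" for j
  have \<gamma>: "\<bar>\<gamma> j\<bar> \<le> L * \<delta>" for j
  proof -
    have "\<bar>\<gamma> j\<bar> \<le> L * \<bar>t (Suc j) - t j\<bar>" unfolding \<gamma>_def by (rule lip)
    also have "t (Suc j) - t j = \<delta>" by (simp add: t_def algebra_simps)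
    finally show ?thesis using \<delta> by simp
  qed
  have N\<delta>: "real N * \<delta> = 2" using N by (simp add: \<delta>_def)
  have \<gamma>sum: "(\<Sum>j<N. \<bar>\<gamma> j\<bar>) \<le> 2 * L"
  proof -
    have "(\<Sum>j<N. \<bar>\<gamma> j\<bar>) \<le> (\<Sum>j<N. L * \<delta>)" by (intro sum_mono \<gamma>)
    also have "\<dots> = L * (real N * \<delta>)" by simp
    finally show ?thesis by (simp add: N\<delta>)
  qed
  have t: "\<bar>t j\<bar> \<le> 1" if "j < N" for j
  proof -
    have "\<delta> * real j \<le> \<delta> * real N" using that \<delta> by (intro mult_left_mono) auto
    moreover have "0 \<le> \<delta> * real j" using \<delta> by simp
    moreover have "\<delta> * real N = 2" using N\<delta> by (simp add: mult.commute)
    ultimately show ?thesis unfolding t_def by linarith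
  qed
  define s where "s z = (\<Sum>j<N. \<gamma> j * softplus \<tau> (z - t j))" for z
  define c where "c = h 0 - s 0"
  define ns :: "(real \<times> real \<times> real) list" where
    "ns = (h1 (- 1), 1, 0) # (- h1 (- 1), - 1, 0) # map (\<lambda>j. (\<gamma> j, 1, t j)) [0..<N]"
  have net: "(\<Sum>(\<gamma>, \<sigma>, t)\<leftarrow>ns. \<gamma> * softplus \<tau> (\<sigma> * z - t)) = h1 (- 1) * z + s z" for z
    using softplus_diff_reflect[OF \<tau>, of z]
    by (simp add: ns_def s_def comp_def interv_sum_list_conv_sum_set_nat atLeast0LessThan
        flip: right_diff_distrib)
  define e where "e z = h z - c - (h1 (- 1) * z + s z)" for z
  define e1 where "e1 z = h1 z - h1 (- 1) - (\<Sum>j<N. \<gamma> j * sigmoid (\<tau> * (z - t j)))" for z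
  have e': "(e has_real_derivative e1 z) (at z)" for z
    unfolding e_def[abs_def] e1_def s_def
    by (auto intro!: derivative_eq_intros h
        DERIV_chain2[OF has_real_derivative_softplus[OF \<tau>]] sum.cong)
  have e1: "\<bar>e1 z\<bar> \<le> 5 * L / \<tau>" if "\<bar>z\<bar> \<le> 1" for z
    using sigmoid_grid_approx[OF \<tau> \<delta>(1) N(1) \<delta>(3) lip that]
    by (simp add: e1_def \<gamma>_def t_def)
  have e0: "e 0 = 0" by (simp add: e_def c_def)
  have e: "\<bar>e z\<bar> \<le> 5 * L / \<tau>" if z: "\<bar>z\<bar> \<le> 1" for z
  proof -
    have "norm (e z - e 0) \<le> (5 * L / \<tau>) * norm (z - 0)"
      by (rule field_differentiable_bound[of "{-1..1}" e e1])
        (use e' e1 z in \<open>auto intro: has_field_derivative_at_within\<close>)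
    also have "\<dots> \<le> (5 * L / \<tau>) * 1"
      using z L0 \<tau> by (intro mult_left_mono) auto
    finally show ?thesis using e0 by simp
  qed
  have s0: "\<bar>s 0\<bar> \<le> 2 * L * (1 + 1 / \<tau>)"
  proof -
    have "\<bar>s 0\<bar> \<le> (\<Sum>j<N. \<bar>\<gamma> j\<bar> * (1 + 1 / \<tau>))"
      unfolding s_def
    proof (rule order_trans[OF sum_abs], intro sum_mono)
      fix j assume "j \<in> {..<N}"
      then show "\<bar>\<gamma> j * softplus \<tau> (0 - t j)\<bar> \<le> \<bar>\<gamma> j\<bar> * (1 + 1 / \<tau>)"
        unfolding abs_mult using softplus_bounds[OF \<tau>, of "0 - t j" 1] t[of j]
        by (intro mult_left_mono) auto
    qed
    also have "\<dots> = (\<Sum>j<N. \<bar>\<gamma> j\<bar>) * (1 + 1 / \<tau>)" by (simp add: sum_distrib_right)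
    also have "\<dots> \<le> 2 * L * (1 + 1 / \<tau>)" using \<gamma>sum \<tau> by (intro mult_right_mono) auto
    finally show ?thesis .
  qed
  show ?thesis
  proof (rule that[of c ns])
    show "\<bar>c\<bar> \<le> \<bar>h 0\<bar> + 2 * L * (1 + 1 / \<tau>)" using s0 by (simp add: c_def)
    show "\<bar>\<sigma>\<bar> = 1 \<and> \<bar>t'\<bar> \<le> 1" if "(\<gamma>', \<sigma>, t') \<in> set ns" for \<gamma>' \<sigma> t'
      using that t by (auto simp: ns_def)
    show "(\<Sum>(\<gamma>, \<sigma>, t)\<leftarrow>ns. \<bar>\<gamma>\<bar>) \<le> 2 * a + 2 * L"
      using a \<gamma>sum
      by (simp add: ns_def comp_def interv_sum_list_conv_sum_set_nat atLeast0LessThan)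
    show "\<bar>h z - c - (\<Sum>(\<gamma>, \<sigma>, t)\<leftarrow>ns. \<gamma> * softplus \<tau> (\<sigma> * z - t))\<bar> \<le> 5 * L / \<tau>"
      if "\<bar>z\<bar> \<le> 1" for z
      using e[OF that] by (simp add: net e_def)
    show "\<exists>D. \<bar>D\<bar> \<le> 5 * L / \<tau> \<and>
      ((\<lambda>z. h z - c - (\<Sum>(\<gamma>, \<sigma>, t)\<leftarrow>ns. \<gamma> * softplus \<tau> (\<sigma> * z - t))) has_real_derivative D) (at z)"
      if "\<bar>z\<bar> \<le> 1" for z
      using e1[OF that] e'[of z] unfolding net e_def[abs_def] by blast
  qed
qed

section \<open>Combinations of cosine ridge functions\<close>

text \<open>
  \<open>trig_comb K M f\<close>: the function \<open>f\<close> is a combination of cosine ridge functions with frequencies of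
  \<open>l1\<close>-norm at most \<open>K\<close> and with total weight \<open>M\<close>.  The rules follow the way in which such functions are built and
  approximated, so that no list of frequencies has to be carried along.
\<close>

inductive trig_comb :: "real \<Rightarrow> real \<Rightarrow> (real ^ 'n \<Rightarrow> real) \<Rightarrow> bool" for K where
  wave: "l1_norm n \<le> K \<Longrightarrow> trig_comb K \<bar>c\<bar> (\<lambda>x. c * cos (pi * (n \<bullet> x) + b))"
| add: "trig_comb K M f \<Longrightarrow> trig_comb K M' g \<Longrightarrow> trig_comb K (M + M') (\<lambda>x. f x + g x)"

lemma l1_norm_triangle: "l1_norm (x + y) \<le> l1_norm x + l1_norm y"
  by (simp add: l1_norm_def sum.distrib[symmetric] sum_mono abs_triangle_ineq)

lemma l1_norm_scaleR: "l1_norm (r *\<^sub>R x) = \<bar>r\<bar> * l1_norm x"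
  by (simp add: l1_norm_def abs_mult sum_distrib_left)

lemma l1_norm_axis: "l1_norm (axis i r) = \<bar>r\<bar>"
  unfolding l1_norm_def axis_def by (simp add: if_distrib[of abs] cong: if_cong)

lemma l1_norm_nonneg: "0 \<le> l1_norm x"
  by (simp add: l1_norm_def sum_nonneg)

lemma l1_norm_eq_0: "l1_norm x = 0 \<longleftrightarrow> x = 0"
  by (auto simp: l1_norm_def sum_nonneg_eq_0_iff vec_eq_iff)

lemma trig_comb_zero: "0 \<le> K \<Longrightarrow> trig_comb K 0 (\<lambda>_. 0)"
  using trig_comb.wave[of 0 K 0 0] by (simp add: l1_norm_def)

lemma trig_comb_one: "0 \<le> K \<Longrightarrow> trig_comb K 1 (\<lambda>_. 1)"
  using trig_comb.wave[of 0 K 1 0] by (simp add: l1_norm_def)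

lemma trig_comb_sum:
  assumes "finite A" "0 \<le> K" "\<And>i. i \<in> A \<Longrightarrow> trig_comb K (M i) (f i)"
  shows "trig_comb K (\<Sum>i\<in>A. M i) (\<lambda>x. \<Sum>i\<in>A. f i x)"
  using assms(1,3)
proof (induction A)
  case empty
  then show ?case using trig_comb_zero[OF assms(2)] by simp
next
  case (insert i A)
  then show ?case
    using trig_comb.add[of K "M i" "f i" "\<Sum>i\<in>A. M i" "\<lambda>x. \<Sum>i\<in>A. f i x"] by simp
qed

lemma trig_comb_scale:
  assumes "trig_comb K M f"
  shows "trig_comb K (\<bar>r\<bar> * M) (\<lambda>x. r * f x)"
  using assms
proof (induction rule: trig_comb.induct)
  case (wave n c b)
  then show ?case using trig_comb.wave[of n K "r * c" b] by (simp add: abs_mult mult.assoc)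
next
  case (add M f M' g)
  then show ?case by (simp add: trig_comb.add distrib_left)
qed

text \<open>
  \<open>cos \<alpha> cos \<beta>\<close> is the mean of \<open>cos (\<alpha> + \<beta>)\<close> and \<open>cos (\<alpha> - \<beta>)\<close>: the total weight is preserved.
\<close>

lemma trig_comb_mult_cos:
  assumes "trig_comb K M f" "\<bar>l\<bar> \<le> \<kappa>"
  shows "trig_comb (K + \<kappa>) M (\<lambda>x. f x * cos (pi * l * x $ i + b'))"
  using assms(1)
proof (induction rule: trig_comb.induct)
  case (wave n c b)
  have "l1_norm (n + axis i l) \<le> K + \<kappa>"
    using l1_norm_triangle[of n "axis i l"] wave assms(2) by (simp add: l1_norm_axis)
  moreover have "l1_norm (n + axis i (- l)) \<le> K + \<kappa>"
    using l1_norm_triangle[of n "axis i (- l)"] wave assms(2) by (simp add: l1_norm_axis)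
  ultimately have "trig_comb (K + \<kappa>) (\<bar>c / 2\<bar> + \<bar>c / 2\<bar>)
      (\<lambda>x. (c / 2) * cos (pi * ((n + axis i l) \<bullet> x) + (b + b'))
         + (c / 2) * cos (pi * ((n + axis i (- l)) \<bullet> x) + (b - b')))"
    by (intro trig_comb.add trig_comb.wave)
  also have "(\<lambda>x. (c / 2) * cos (pi * ((n + axis i l) \<bullet> x) + (b + b'))
         + (c / 2) * cos (pi * ((n + axis i (- l)) \<bullet> x) + (b - b')))
      = (\<lambda>x. c * cos (pi * (n \<bullet> x) + b) * cos (pi * l * x $ i + b'))"
  proof
    fix x
    have 1: "pi * ((n + axis i l) \<bullet> x) + (b + b') = (pi * (n \<bullet> x) + b) + (pi * l * x $ i + b')"
      by (simp add: inner_add_left inner_axis' algebra_simps)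
    have 2: "pi * ((n + axis i (- l)) \<bullet> x) + (b - b') = (pi * (n \<bullet> x) + b) - (pi * l * x $ i + b')"
      by (simp add: inner_add_left inner_axis' algebra_simps)
    show "(c / 2) * cos (pi * ((n + axis i l) \<bullet> x) + (b + b'))
         + (c / 2) * cos (pi * ((n + axis i (- l)) \<bullet> x) + (b - b'))
        = c * cos (pi * (n \<bullet> x) + b) * cos (pi * l * x $ i + b')"
      unfolding 1 2 cos_add[of "pi * (n \<bullet> x) + b" "pi * l * x $ i + b'"]
        cos_diff[of "pi * (n \<bullet> x) + b" "pi * l * x $ i + b'"]
      by (simp add: algebra_simps)
  qed
  finally show ?case by simp
next
  case (add M f M' g)
  then show ?case by (simp add: trig_comb.add distrib_right)
qed

lemma trig_comb_prod_sin:
  fixes k :: "nat ^ 'n"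
  shows "trig_comb (\<Sum>j\<in>S. real (k $ j)) 1 (\<lambda>x. \<Prod>j\<in>S. sin (pi * real (k $ j) * x $ j))"
proof -
  have "finite S" by simp
  then show ?thesis
  proof (induction S)
    case empty
    show ?case by (simp add: trig_comb_one)
  next
    case (insert j S)
    have "trig_comb ((\<Sum>j\<in>S. real (k $ j)) + real (k $ j)) 1
      (\<lambda>x. (\<Prod>j\<in>S. sin (pi * real (k $ j) * x $ j)) * cos (pi * real (k $ j) * x $ j + (- pi / 2)))"
      using insert.IH by (intro trig_comb_mult_cos) auto
    moreover have "cos (y + (- pi / 2)) = sin y" for y :: real
      by (simp add: cos_diff)
    ultimately show ?case
      using insert.hyps by (simp add: add.commute mult.commute)
  qed
qed

text \<open>
  The product of \<open>sin \<theta>\<close> and one of the cosines is half the difference of two consecutive sines, and the sum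
  telescopes from \<open>sin (k \<theta>)\<close> to \<open>- sin (k \<theta>)\<close>.
\<close>

lemma sin_multiple_div_sin:
  "sin (real k * \<theta>) = sin \<theta> * (\<Sum>l<k. cos ((real k - 1 - 2 * real l) * \<theta>))"
proof -
  define F where "F l = sin ((real k - 2 * real l) * \<theta>) / 2" for l
  have step: "sin \<theta> * cos ((real k - 1 - 2 * real l) * \<theta>) = F l - F (Suc l)" for l
  proof -
    define A where "A = (real k - 1 - 2 * real l) * \<theta>"
    have "(real k - 2 * real l) * \<theta> = A + \<theta>" "(real k - 2 * real (Suc l)) * \<theta> = A - \<theta>"
      by (simp_all add: A_def left_diff_distrib distrib_right distrib_left)
    then have "F l - F (Suc l) = sin (A + \<theta>) / 2 - sin (A - \<theta>) / 2"
      unfolding F_def by (simp only:)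
    also have "\<dots> = sin \<theta> * cos A"
      by (simp add: sin_add sin_diff add_divide_distrib diff_divide_distrib)
    finally show ?thesis by (simp only: A_def)
  qed
  have "sin \<theta> * (\<Sum>l<k. cos ((real k - 1 - 2 * real l) * \<theta>)) = (\<Sum>l<k. F l - F (Suc l))"
    unfolding sum_distrib_left by (rule sum.cong[OF refl step])
  also have "\<dots> = F 0 - F k" by (rule sum_lessThan_telescope')
  also have "F 0 = sin (real k * \<theta>) / 2" by (simp add: F_def)
  also have "F k = sin (- (real k * \<theta>)) / 2" unfolding F_def by (simp add: left_diff_distrib)
  finally show ?thesis unfolding sin_minus by linarith
qed

text \<open>
  The quotient of the sine basis function by the cut-off function, written in a form that makes sense everywhere:
  the summand for \<open>i\<close> is the basis function divided by \<open>sin (\<pi> x\<^sub>i)\<close>.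
\<close>

definition sine_quotient :: "nat ^ 'n \<Rightarrow> real ^ 'n \<Rightarrow> real" where
  "sine_quotient k x = (\<Sum>i\<in>UNIV. (\<Prod>j\<in>UNIV - {i}. sin (pi * real (k $ j) * x $ j)) *
     (\<Sum>l<k $ i. cos (pi * (real (k $ i) - 1 - 2 * real l) * x $ i)))"

definition sine_freq :: "nat ^ 'n \<Rightarrow> real" where
  "sine_freq k = l1_norm (\<chi> i. real (k $ i))"

lemma sine_freq_eq: "sine_freq k = (\<Sum>i\<in>UNIV. real (k $ i))"
  by (simp add: sine_freq_def l1_norm_def)

lemma sine_freq_nonneg: "0 \<le> sine_freq k"
  by (simp add: sine_freq_eq sum_nonneg)

lemma sine_freq_ge_1:
  assumes "\<And>i. k $ i > 0"
  shows "1 \<le> sine_freq k"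
proof -
  have "real (k $ undefined) \<le> sine_freq k"
    unfolding sine_freq_eq by (rule member_le_sum) auto
  then show ?thesis using assms[of undefined] by linarith
qed

lemma one_le_pi_sine_freq:
  assumes "\<And>i. k $ i > 0"
  shows "1 \<le> pi * sine_freq k"
proof -
  have "1 * 1 \<le> pi * sine_freq k"
    using sine_freq_ge_1[OF assms] pi_gt3 by (intro mult_mono) auto
  then show ?thesis by simp
qed

text \<open>
  In the summand for \<open>i\<close> the product of sines contributes weight 1 and each of the \<open>k $ i\<close> cosines weight 1;
  the frequencies add up to at most \<open>|k|\<^sub>1\<close>.
\<close>

lemma trig_comb_sine_quotient:
  fixes k :: "nat ^ 'n"
  defines "K \<equiv> sine_freq k"
  shows "trig_comb K K (sine_quotient k)"
proof -
  have K: "K = (\<Sum>i\<in>UNIV. real (k $ i))" by (simp add: K_def sine_freq_eq)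
  have K0: "0 \<le> K" by (simp add: K_def sine_freq_nonneg)
  have "trig_comb K (\<Sum>l<k $ i. 1) (\<lambda>x. \<Sum>l<k $ i. (\<Prod>j\<in>UNIV - {i}. sin (pi * real (k $ j) * x $ j)) *
      cos (pi * (real (k $ i) - 1 - 2 * real l) * x $ i + 0))" for i
  proof (rule trig_comb_sum[OF _ K0])
    fix l assume "l \<in> {..<k $ i}"
    then have l: "\<bar>real (k $ i) - 1 - 2 * real l\<bar> \<le> real (k $ i)" by auto
    have Ki: "K = (\<Sum>j\<in>UNIV - {i}. real (k $ j)) + real (k $ i)"
      unfolding K by (subst sum.remove[of UNIV i]) auto
    show "trig_comb K 1 (\<lambda>x. (\<Prod>j\<in>UNIV - {i}. sin (pi * real (k $ j) * x $ j)) *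
      cos (pi * (real (k $ i) - 1 - 2 * real l) * x $ i + 0))"
      unfolding Ki by (rule trig_comb_mult_cos[OF trig_comb_prod_sin l])
  qed simp
  then have "trig_comb K (real (k $ i)) (\<lambda>x. (\<Prod>j\<in>UNIV - {i}. sin (pi * real (k $ j) * x $ j)) *
      (\<Sum>l<k $ i. cos (pi * (real (k $ i) - 1 - 2 * real l) * x $ i)))" for i
    by (simp add: sum_distrib_left)
  then have "trig_comb K (\<Sum>i\<in>UNIV. real (k $ i)) (\<lambda>x. sine_quotient k x)"
    unfolding sine_quotient_def using K0 by (intro trig_comb_sum) auto
  then show ?thesis by (simp add: K)
qed

section \<open>Approximation by softplus networks\<close>

text \<open>
  A pointwise bound on a function and on its total derivative.  The bound on the derivative is on its operator
  norm, that is, on the Euclidean norm of the gradient.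
\<close>

definition C1_le :: "real \<Rightarrow> (real ^ 'n \<Rightarrow> real) \<Rightarrow> real ^ 'n \<Rightarrow> bool" where
  "C1_le \<eta> f x \<longleftrightarrow> \<bar>f x\<bar> \<le> \<eta> \<and>
     (\<exists>f'. (f has_derivative f') (at x) \<and> (\<forall>v. \<bar>f' v\<bar> \<le> \<eta> * norm v))"

lemma C1_le_add:
  assumes "C1_le \<eta> f x" "C1_le \<eta>' g x"
  shows "C1_le (\<eta> + \<eta>') (\<lambda>y. f y + g y) x"
proof -
  obtain f' g' where f': "(f has_derivative f') (at x)" "\<And>v. \<bar>f' v\<bar> \<le> \<eta> * norm v"
    and g': "(g has_derivative g') (at x)" "\<And>v. \<bar>g' v\<bar> \<le> \<eta>' * norm v"
    using assms unfolding C1_le_def by blast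
  have "((\<lambda>y. f y + g y) has_derivative (\<lambda>v. f' v + g' v)) (at x)"
    by (intro has_derivative_add f' g')
  moreover have "\<bar>f' v + g' v\<bar> \<le> (\<eta> + \<eta>') * norm v" for v
    using f'(2)[of v] g'(2)[of v] by (simp add: distrib_right)
  ultimately show ?thesis
    using assms unfolding C1_le_def by (smt (verit))
qed

lemma C1_le_mono:
  assumes "C1_le \<eta> f x" "\<eta> \<le> \<eta>'"
  shows "C1_le \<eta>' f x"
  using assms unfolding C1_le_def by (meson mult_right_mono norm_ge_zero order_trans)

lemma unit_cube_iff: "x \<in> unit_cube \<longleftrightarrow> (\<forall>i. 0 < x $ i \<and> x $ i < 1)"
  by (simp add: unit_cube_def mem_box_cart)

lemma inner_le_l1_norm:
  assumes "x \<in> unit_cube"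
  shows "\<bar>w \<bullet> x\<bar> \<le> l1_norm w"
  unfolding inner_vec_def l1_norm_def
proof (rule order_trans[OF sum_abs], rule sum_mono)
  fix i
  have "0 < x $ i" "x $ i < 1" using assms by (auto simp: unit_cube_iff)
  then have "\<bar>x $ i\<bar> \<le> 1" by linarith
  then show "\<bar>inner (w $ i) (x $ i)\<bar> \<le> \<bar>w $ i\<bar>"
    by (simp add: abs_mult mult_left_le)
qed

lemma norm_le_l1_norm: "norm w \<le> l1_norm w"
  unfolding l1_norm_def by (rule norm_le_l1_cart)

type_synonym 'n neuron = "real \<times> (real ^ 'n) \<times> real"

definition net :: "real \<Rightarrow> 'n::finite neuron list \<Rightarrow> real ^ 'n \<Rightarrow> real" where
  "net \<tau> ns x = (\<Sum>(\<gamma>, w, t)\<leftarrow>ns. \<gamma> * softplus \<tau> (w \<bullet> x - t))"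

definition admissible :: "'n::finite neuron list \<Rightarrow> bool" where
  "admissible ns \<longleftrightarrow> (\<forall>(\<gamma>, w, t)\<in>set ns. l1_norm w = 1 \<and> \<bar>t\<bar> \<le> 1)"

definition mass :: "'n::finite neuron list \<Rightarrow> real" where
  "mass ns = (\<Sum>(\<gamma>, w, t)\<leftarrow>ns. \<bar>\<gamma>\<bar>)"

text \<open>
  Approximation in the \<open>C1\<close> norm on the cube, with error \<open>\<eta>\<close>, by a constant of modulus at most \<open>C\<close> and a
  network of mass at most \<open>M\<close>, of any size.
\<close>

definition net_approx :: "real \<Rightarrow> real \<Rightarrow> real \<Rightarrow> real \<Rightarrow> (real ^ 'n \<Rightarrow> real) \<Rightarrow> bool" where
  "net_approx \<tau> C M \<eta> f \<longleftrightarrow> (\<exists>c ns. \<bar>c\<bar> \<le> C \<and> admissible ns \<and> mass ns \<le> M \<and>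
     (\<forall>x\<in>unit_cube. C1_le \<eta> (\<lambda>y. f y - c - net \<tau> ns y) x))"

lemma net_approx_add:
  assumes "net_approx \<tau> C M \<eta> f" "net_approx \<tau> C' M' \<eta>' g"
  shows "net_approx \<tau> (C + C') (M + M') (\<eta> + \<eta>') (\<lambda>x. f x + g x)"
proof -
  obtain c ns where 1: "\<bar>c\<bar> \<le> C" "admissible ns" "mass ns \<le> M"
      "\<And>x. x\<in>unit_cube \<Longrightarrow> C1_le \<eta> (\<lambda>y. f y - c - net \<tau> ns y) x"
    using assms(1) unfolding net_approx_def by blast
  obtain c' ns' where 2: "\<bar>c'\<bar> \<le> C'" "admissible ns'" "mass ns' \<le> M'"
      "\<And>x. x\<in>unit_cube \<Longrightarrow> C1_le \<eta>' (\<lambda>y. g y - c' - net \<tau> ns' y) x"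
    using assms(2) unfolding net_approx_def by blast
  show ?thesis unfolding net_approx_def
  proof (intro exI conjI ballI)
    show "\<bar>c + c'\<bar> \<le> C + C'" using 1 2 by simp
    show "admissible (ns @ ns')" using 1 2 by (auto simp: admissible_def)
    show "mass (ns @ ns') \<le> M + M'" using 1 2 by (simp add: mass_def)
    show "C1_le (\<eta> + \<eta>') (\<lambda>y. f y + g y - (c + c') - net \<tau> (ns @ ns') y) x" if "x \<in> unit_cube" for x
      using C1_le_add[OF 1(4)[OF that] 2(4)[OF that]] by (simp add: net_def algebra_simps)
  qed
qed

text \<open>
  A wave is a function of \<open>w \<bullet> x\<close>, where \<open>w\<close> is the normalised frequency.  On the cube
  \<open>\<bar>w \<bullet> x\<bar> \<le> 1\<close>, and \<open>norm w \<le> 1\<close> carries the one-dimensional bound on the derivative over to the gradient.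
\<close>

lemma net_approx_wave:
  fixes n :: "real ^ 'n"
  assumes \<tau>: "\<tau> > 0" and n: "l1_norm n \<le> K"
  defines "a \<equiv> pi * K"
  shows "net_approx \<tau> (\<bar>c\<bar> * (1 + 2 * a\<^sup>2 * (1 + 1 / \<tau>))) (\<bar>c\<bar> * (2 * a + 2 * a\<^sup>2)) (\<bar>c\<bar> * (5 * a\<^sup>2 / \<tau>))
    (\<lambda>x. c * cos (pi * (n \<bullet> x) + b))"
proof -
  define \<kappa> where "\<kappa> = l1_norm n"
  have K0: "0 \<le> \<kappa>" "0 \<le> K" using n l1_norm_nonneg[of n] by (auto simp: \<kappa>_def)
  then have a0: "0 \<le> pi * \<kappa>" "pi * \<kappa> \<le> a" using n by (auto simp: a_def \<kappa>_def)
  then have a2: "(pi * \<kappa>)\<^sup>2 \<le> a\<^sup>2" by (rule power_mono[rotated])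
  obtain w where w: "l1_norm w = 1" "n = \<kappa> *\<^sub>R w"
  proof (cases "n = 0")
    case True
    have "l1_norm (axis undefined 1 :: real ^ 'n) = 1" by (simp add: l1_norm_axis)
    moreover have "n = \<kappa> *\<^sub>R axis undefined 1" using True l1_norm_eq_0[of n] by (simp add: \<kappa>_def)
    ultimately show ?thesis by (rule that)
  next
    case False
    then have "\<kappa> > 0" using l1_norm_nonneg[of n] l1_norm_eq_0[of n] by (simp add: \<kappa>_def)
    then show ?thesis
      using that[of "(1 / \<kappa>) *\<^sub>R n"] by (simp add: l1_norm_scaleR) (simp add: \<kappa>_def)
  qed
  define h where "h z = c * cos ((pi * \<kappa>) * z + b)" for z
  define h1 where "h1 z = - (c * (pi * \<kappa>)) * sin ((pi * \<kappa>) * z + b)" for z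
  have h: "(h has_real_derivative h1 z) (at z)" for z
    unfolding h_def[abs_def] h1_def by (auto intro!: derivative_eq_intros)
  have lip: "\<bar>h1 y - h1 z\<bar> \<le> (\<bar>c\<bar> * (pi * \<kappa>)\<^sup>2) * \<bar>y - z\<bar>" for y z
  proof -
    have "norm (h1 y - h1 z) \<le> (\<bar>c\<bar> * (pi * \<kappa>)\<^sup>2) * norm (y - z)"
    proof (rule field_differentiable_bound[of UNIV h1 "\<lambda>z. - (c * (pi * \<kappa>)) * (cos ((pi * \<kappa>) * z + b) * (pi * \<kappa>))"])
      show "(h1 has_field_derivative - (c * (pi * \<kappa>)) * (cos ((pi * \<kappa>) * z + b) * (pi * \<kappa>))) (at z within UNIV)" for z
        unfolding h1_def[abs_def] by (auto intro!: derivative_eq_intros)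
      show "norm (- (c * (pi * \<kappa>)) * (cos ((pi * \<kappa>) * z + b) * (pi * \<kappa>))) \<le> \<bar>c\<bar> * (pi * \<kappa>)\<^sup>2" for z
      proof -
        have "norm (- (c * (pi * \<kappa>)) * (cos ((pi * \<kappa>) * z + b) * (pi * \<kappa>)))
          = (\<bar>c\<bar> * (pi * \<kappa>)\<^sup>2) * \<bar>cos ((pi * \<kappa>) * z + b)\<bar>"
          by (simp add: abs_mult power2_eq_square K0)
        also have "\<dots> \<le> (\<bar>c\<bar> * (pi * \<kappa>)\<^sup>2) * 1" by (intro mult_left_mono) auto
        finally show ?thesis by simp
      qed
    qed auto
    then show ?thesis by simp
  qed
  have h1: "\<bar>h1 (- 1)\<bar> \<le> \<bar>c\<bar> * (pi * \<kappa>)"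
  proof -
    have "\<bar>h1 (- 1)\<bar> = (\<bar>c\<bar> * (pi * \<kappa>)) * \<bar>sin ((pi * \<kappa>) * - 1 + b)\<bar>"
      unfolding h1_def by (simp add: abs_mult K0)
    also have "\<dots> \<le> (\<bar>c\<bar> * (pi * \<kappa>)) * 1"
      using a0 by (intro mult_left_mono) auto
    finally show ?thesis by simp
  qed
  obtain d :: real and ms :: "(real \<times> real \<times> real) list"
    where d: "\<bar>d\<bar> \<le> \<bar>h 0\<bar> + 2 * (\<bar>c\<bar> * (pi * \<kappa>)\<^sup>2) * (1 + 1 / \<tau>)"
    and ms: "\<And>\<gamma> \<sigma> t. (\<gamma>, \<sigma>, t) \<in> set ms \<Longrightarrow> \<bar>\<sigma>\<bar> = 1 \<and> \<bar>t\<bar> \<le> 1"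
    and mass: "(\<Sum>(\<gamma>, \<sigma>, t)\<leftarrow>ms. \<bar>\<gamma>\<bar>) \<le> 2 * (\<bar>c\<bar> * (pi * \<kappa>)) + 2 * (\<bar>c\<bar> * (pi * \<kappa>)\<^sup>2)"
    and e: "\<And>z. \<bar>z\<bar> \<le> 1 \<Longrightarrow> \<bar>h z - d - (\<Sum>(\<gamma>, \<sigma>, t)\<leftarrow>ms. \<gamma> * softplus \<tau> (\<sigma> * z - t))\<bar> \<le> 5 * (\<bar>c\<bar> * (pi * \<kappa>)\<^sup>2) / \<tau>"
    and e': "\<And>z. \<bar>z\<bar> \<le> 1 \<Longrightarrow> \<exists>D. \<bar>D\<bar> \<le> 5 * (\<bar>c\<bar> * (pi * \<kappa>)\<^sup>2) / \<tau> \<and>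
      ((\<lambda>z. h z - d - (\<Sum>(\<gamma>, \<sigma>, t)\<leftarrow>ms. \<gamma> * softplus \<tau> (\<sigma> * z - t))) has_real_derivative D) (at z)"
    using softplus_approx_1d[OF \<tau> h lip h1] by blast
  define ns where "ns = map (\<lambda>(\<gamma>, \<sigma>, t). (\<gamma>, \<sigma> *\<^sub>R w, t)) ms"
  define E where "E z = h z - d - (\<Sum>(\<gamma>, \<sigma>, t)\<leftarrow>ms. \<gamma> * softplus \<tau> (\<sigma> * z - t))" for z
  have net: "net \<tau> ns x = (\<Sum>(\<gamma>, \<sigma>, t)\<leftarrow>ms. \<gamma> * softplus \<tau> (\<sigma> * (w \<bullet> x) - t))" for x
    by (simp add: net_def ns_def comp_def split_def)
  have err: "c * cos (pi * (n \<bullet> x) + b) - d - net \<tau> ns x = E (w \<bullet> x)" for x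
    by (simp add: net E_def h_def w(2) mult.assoc)
  have \<eta>: "5 * (\<bar>c\<bar> * (pi * \<kappa>)\<^sup>2) / \<tau> \<le> \<bar>c\<bar> * (5 * a\<^sup>2 / \<tau>)"
    using mult_left_mono[OF a2, of "\<bar>c\<bar>"] \<tau> by (simp add: divide_right_mono)
  show ?thesis unfolding net_approx_def
  proof (intro exI conjI ballI)
    have "\<bar>h 0\<bar> \<le> \<bar>c\<bar>" by (simp add: h_def abs_mult mult_left_le)
    moreover have "2 * (\<bar>c\<bar> * (pi * \<kappa>)\<^sup>2) * (1 + 1 / \<tau>) \<le> 2 * (\<bar>c\<bar> * a\<^sup>2) * (1 + 1 / \<tau>)"
      using a2 \<tau> by (intro mult_right_mono mult_left_mono) auto
    ultimately show "\<bar>d\<bar> \<le> \<bar>c\<bar> * (1 + 2 * a\<^sup>2 * (1 + 1 / \<tau>))"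
      using d by (simp add: algebra_simps)
    show "admissible ns" using ms w by (auto simp: admissible_def ns_def l1_norm_scaleR)
    have "mass ns = (\<Sum>(\<gamma>, \<sigma>, t)\<leftarrow>ms. \<bar>\<gamma>\<bar>)"
      by (simp add: mass_def ns_def comp_def split_def)
    also have "\<dots> \<le> 2 * (\<bar>c\<bar> * (pi * \<kappa>)) + 2 * (\<bar>c\<bar> * (pi * \<kappa>)\<^sup>2)" by (rule mass)
    also have "\<dots> \<le> 2 * (\<bar>c\<bar> * a) + 2 * (\<bar>c\<bar> * a\<^sup>2)"
      using a0 a2 by (intro add_mono mult_left_mono) auto
    finally show "mass ns \<le> \<bar>c\<bar> * (2 * a + 2 * a\<^sup>2)" by (simp add: algebra_simps)
    fix x :: "real ^ 'n" assume x: "x \<in> unit_cube"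
    then have wx: "\<bar>w \<bullet> x\<bar> \<le> 1" using inner_le_l1_norm[of x w] w by simp
    obtain D where D: "\<bar>D\<bar> \<le> 5 * (\<bar>c\<bar> * (pi * \<kappa>)\<^sup>2) / \<tau>" "(E has_real_derivative D) (at (w \<bullet> x))"
      using e'[OF wx] unfolding E_def[abs_def] by blast
    have "((\<lambda>y. E (w \<bullet> y)) has_derivative (\<lambda>v. D * (w \<bullet> v))) (at x)"
      by (rule has_derivative_compose[of "\<lambda>y. w \<bullet> y" "\<lambda>v. w \<bullet> v" x UNIV E "\<lambda>v. D * v"])
        (use D(2) in \<open>auto simp: has_field_derivative_def intro!: derivative_eq_intros\<close>)
    moreover have "\<bar>D * (w \<bullet> v)\<bar> \<le> \<bar>c\<bar> * (5 * a\<^sup>2 / \<tau>) * norm v" for v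
    proof -
      have "\<bar>w \<bullet> v\<bar> \<le> norm w * norm v" by (rule Cauchy_Schwarz_ineq2)
      also have "\<dots> \<le> 1 * norm v"
        using norm_le_l1_norm[of w] w by (intro mult_right_mono) auto
      finally show ?thesis
        unfolding abs_mult using D(1) \<eta> by (intro mult_mono) auto
    qed
    moreover have "\<bar>E (w \<bullet> x)\<bar> \<le> \<bar>c\<bar> * (5 * a\<^sup>2 / \<tau>)"
      using e[OF wx] \<eta> unfolding E_def by linarith
    ultimately show "C1_le (\<bar>c\<bar> * (5 * a\<^sup>2 / \<tau>)) (\<lambda>x. c * cos (pi * (n \<bullet> x) + b) - d - net \<tau> ns x) x"
      unfolding err C1_le_def by blast
  qed
qed

lemma net_approx_trig_comb:
  fixes K :: real
  assumes \<tau>: "\<tau> > 0" and f: "trig_comb K M f"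
  defines "a \<equiv> pi * K"
  shows "net_approx \<tau> (M * (1 + 2 * a\<^sup>2 * (1 + 1 / \<tau>))) (M * (2 * a + 2 * a\<^sup>2)) (M * (5 * a\<^sup>2 / \<tau>)) f"
  using f
proof (induction rule: trig_comb.induct)
  case (wave n c b)
  then show ?case unfolding a_def by (rule net_approx_wave[OF \<tau>])
next
  case (add M f M' g)
  show ?case unfolding distrib_right by (rule net_approx_add[OF add.IH])
qed

lemma net_approx_mono:
  assumes "net_approx \<tau> C M \<eta> f" "C \<le> C'" "M \<le> M'" "\<eta> \<le> \<eta>'"
  shows "net_approx \<tau> C' M' \<eta>' f"
  using assms C1_le_mono[where \<eta> = \<eta> and \<eta>' = \<eta>'] unfolding net_approx_def by (meson order_trans)

lemma net_approx_zero: "net_approx \<tau> 0 0 0 (\<lambda>_. 0)"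
proof -
  have "C1_le 0 (\<lambda>y. 0 - 0 - net \<tau> [] y) x" for x :: "real ^ 'a"
    unfolding C1_le_def net_def using has_derivative_const[of 0 "at x"] by force
  then show ?thesis
    unfolding net_approx_def
    by (intro exI[of _ 0] exI[of _ "[]"]) (auto simp: admissible_def mass_def)
qed

lemma net_approx_sum:
  assumes "\<And>i. i < (N::nat) \<Longrightarrow> net_approx \<tau> (C i) (M i) (\<eta> i) (f i)"
  shows "net_approx \<tau> (\<Sum>i<N. C i) (\<Sum>i<N. M i) (\<Sum>i<N. \<eta> i) (\<lambda>x. \<Sum>i<N. f i x)"
  using assms
proof (induction N)
  case 0
  then show ?case by (simp add: net_approx_zero)
next
  case (Suc N)
  then show ?case
    using net_approx_add[of \<tau> "\<Sum>i<N. C i" "\<Sum>i<N. M i" "\<Sum>i<N. \<eta> i"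
        "\<lambda>x. \<Sum>i<N. f i x" "C N" "M N" "\<eta> N" "f N"] by simp
qed

lemma C1_le_neuron:
  fixes x w :: "real ^ 'n"
  assumes \<tau>: "\<tau> > 0" and x: "x \<in> unit_cube" and w: "l1_norm w = 1" "\<bar>t\<bar> \<le> 1"
  shows "C1_le (2 + 1 / \<tau>) (\<lambda>y. softplus \<tau> (w \<bullet> y - t)) x"
proof -
  have wx: "\<bar>w \<bullet> x - t\<bar> \<le> 2" using inner_le_l1_norm[OF x, of w] w by simp
  have "((\<lambda>y. softplus \<tau> (w \<bullet> y - t)) has_derivative (\<lambda>v. sigmoid (\<tau> * (w \<bullet> x - t)) * (w \<bullet> v))) (at x)"
    by (rule has_derivative_compose[of "\<lambda>y. w \<bullet> y - t" "\<lambda>v. w \<bullet> v" x UNIV "softplus \<tau>"])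
      (use has_real_derivative_softplus[OF \<tau>] in
        \<open>auto simp: has_field_derivative_def intro!: derivative_eq_intros\<close>)
  moreover have "\<bar>sigmoid (\<tau> * (w \<bullet> x - t)) * (w \<bullet> v)\<bar> \<le> (2 + 1 / \<tau>) * norm v" for v
  proof -
    have "\<bar>w \<bullet> v\<bar> \<le> norm w * norm v" by (rule Cauchy_Schwarz_ineq2)
    also have "\<dots> \<le> 1 * norm v"
      using norm_le_l1_norm[of w] w by (intro mult_right_mono) auto
    finally have "\<bar>sigmoid (\<tau> * (w \<bullet> x - t)) * (w \<bullet> v)\<bar> \<le> 1 * norm v"
      unfolding abs_mult using sigmoid_bounds[of "\<tau> * (w \<bullet> x - t)"] by (intro mult_mono) auto
    also have "\<dots> \<le> (2 + 1 / \<tau>) * norm v" using \<tau> by (intro mult_right_mono) auto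
    finally show ?thesis .
  qed
  ultimately show ?thesis
    using softplus_bounds[OF \<tau> wx] unfolding C1_le_def by force
qed

section \<open>The cut-off function\<close>

text \<open>
  Put \<open>p i = cutoff x / sin (\<pi> x\<^sub>i)\<close>.  These are positive and have sum 1, and \<open>cutoff x = p i sin (\<pi> x\<^sub>i)\<close>.
  The derivative of the cut-off in direction \<open>v\<close> is the sum of the \<open>p i\<^sup>2 \<pi> cos (\<pi> x\<^sub>i) v\<^sub>i\<close>, which is at most
  \<open>\<pi> norm v\<close> since \<open>p i\<^sup>2 \<le> p i\<close>.
\<close>

lemma cutoff_facts:
  fixes x :: "real ^ 'n"
  assumes x: "x \<in> unit_cube"
  shows cutoff_bounds: "0 < cutoff x" "cutoff x \<le> 1"
    and cutoff_derivative: "\<exists>\<phi>'. (cutoff has_derivative \<phi>') (at x) \<and> (\<forall>v. \<bar>\<phi>' v\<bar> \<le> pi * norm v)"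
    and cutoff_sine_quotient: "sine_basis k x = cutoff x * sine_quotient k x"
proof -
  define s where "s i = sin (pi * x $ i)" for i
  have s: "0 < s i" "s i \<le> 1" for i
    using x by (auto simp: s_def unit_cube_iff intro!: sin_gt_zero)
  define S where "S = (\<Sum>i\<in>UNIV. 1 / s i)"
  have S: "S > 0" unfolding S_def using s by (intro sum_pos) auto
  have c: "cutoff x = inverse S" using x by (simp add: cutoff_def S_def s_def)
  define p where "p i = inverse S / s i" for i
  have p0: "0 < p i" for i using S s by (simp add: p_def)
  have p1: "(\<Sum>i\<in>UNIV. p i) = 1"
    using S by (simp add: p_def divide_inverse sum_distrib_left[symmetric])
      (simp add: S_def divide_inverse)
  have ple: "p i \<le> 1" for i
    using member_le_sum[of i UNIV p] p0 p1 by (simp add: less_imp_le)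
  show "0 < cutoff x" using c S by simp
  have "cutoff x = p undefined * s undefined" using s[of undefined] by (simp add: p_def c)
  also have "\<dots> \<le> 1 * 1" using ple s p0 by (intro mult_mono) (auto intro: less_imp_le)
  finally show "cutoff x \<le> 1" by simp
  show "sine_basis k x = cutoff x * sine_quotient k x"
  proof -
    have "(\<Prod>j\<in>UNIV - {i}. sin (pi * real (k $ j) * x $ j)) *
       (\<Sum>l<k $ i. cos (pi * (real (k $ i) - 1 - 2 * real l) * x $ i)) = sine_basis k x * (1 / s i)" for i
    proof -
      have "sine_basis k x = sin (pi * real (k $ i) * x $ i) * (\<Prod>j\<in>UNIV - {i}. sin (pi * real (k $ j) * x $ j))"
        unfolding sine_basis_def by (subst prod.remove[of UNIV i]) auto
      moreover have "sin (pi * real (k $ i) * x $ i) =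
          s i * (\<Sum>l<k $ i. cos (pi * (real (k $ i) - 1 - 2 * real l) * x $ i))"
        using sin_multiple_div_sin[of "k $ i" "pi * x $ i"] by (simp add: s_def mult_ac)
      ultimately show ?thesis using s[of i] by simp
    qed
    then have "sine_quotient k x = sine_basis k x * S"
      unfolding sine_quotient_def S_def by (simp add: sum_distrib_left)
    then show ?thesis using S by (simp add: c)
  qed
  define \<phi>' where "\<phi>' v = (\<Sum>i\<in>UNIV. (p i)\<^sup>2 * (pi * cos (pi * x $ i)) * v $ i)" for v :: "real ^ 'n"
  have "((\<lambda>x. inverse (\<Sum>i\<in>UNIV. 1 / sin (pi * x $ i))) has_derivative \<phi>') (at x)"
  proof -
    have ne: "sin (pi * x $ i) \<noteq> 0" for i using s[of i] by (simp add: s_def)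
    have "((\<lambda>x. (\<Sum>i\<in>UNIV. inverse (sin (pi * x $ i)))) has_derivative
       (\<lambda>v. \<Sum>i\<in>UNIV. - (inverse (s i) * (cos (pi * x $ i) * (pi * v $ i)) * inverse (s i)))) (at x)"
      unfolding s_def
      by (rule has_derivative_sum, rule Deriv.has_derivative_inverse[where f = "\<lambda>x. sin (pi * x $ _)", OF ne])
        (auto intro!: derivative_eq_intros bounded_linear.has_derivative[OF bounded_linear_vec_nth])
    from Deriv.has_derivative_inverse[where f = "\<lambda>x. (\<Sum>i\<in>UNIV. inverse (sin (pi * x $ i)))", OF _ this] have
      "((\<lambda>x. inverse (\<Sum>i\<in>UNIV. inverse (sin (pi * x $ i)))) has_derivative
       (\<lambda>v. - (inverse S * (\<Sum>i\<in>UNIV. - (inverse (s i) * (cos (pi * x $ i) * (pi * v $ i)) * inverse (s i))) * inverse S))) (at x)"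
      using S by (simp add: S_def s_def divide_inverse)
    moreover have "- (inverse S * (\<Sum>i\<in>UNIV. - (inverse (s i) * (cos (pi * x $ i) * (pi * v $ i)) * inverse (s i))) * inverse S) = \<phi>' v" for v
      unfolding \<phi>'_def p_def
      by (simp add: sum_negf sum_distrib_left sum_distrib_right power2_eq_square divide_inverse mult_ac)
    ultimately show ?thesis by (simp add: divide_inverse)
  qed
  then have "(cutoff has_derivative \<phi>') (at x)"
    by (rule has_derivative_transform_within_open[of _ _ _ _ unit_cube])
      (use x in \<open>auto simp: cutoff_def unit_cube_def\<close>)
  moreover have "\<bar>\<phi>' v\<bar> \<le> pi * norm v" for v
  proof -
    have "\<bar>\<phi>' v\<bar> \<le> (\<Sum>i\<in>UNIV. p i * (pi * norm v))"
      unfolding \<phi>'_def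
    proof (rule order_trans[OF sum_abs], rule sum_mono)
      fix i
      have "(p i)\<^sup>2 \<le> p i"
        using ple[of i] p0[of i] by (simp add: power2_eq_square mult_left_le)
      moreover have "pi * \<bar>cos (pi * x $ i)\<bar> \<le> pi * 1" by (intro mult_left_mono) auto
      moreover have "\<bar>v $ i\<bar> \<le> norm v" by (rule component_le_norm_cart)
      ultimately have "(p i)\<^sup>2 * (pi * \<bar>cos (pi * x $ i)\<bar>) * \<bar>v $ i\<bar> \<le> p i * (pi * 1) * norm v"
        using p0[of i] by (intro mult_mono) auto
      then show "\<bar>(p i)\<^sup>2 * (pi * cos (pi * x $ i)) * v $ i\<bar> \<le> p i * (pi * norm v)"
        by (simp add: abs_mult mult.assoc)
    qed
    also have "\<dots> = pi * norm v" by (simp add: p1 flip: sum_distrib_right)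
    finally show ?thesis .
  qed
  ultimately show "\<exists>\<phi>'. (cutoff has_derivative \<phi>') (at x) \<and> (\<forall>v. \<bar>\<phi>' v\<bar> \<le> pi * norm v)" by blast
qed

lemma C1_le_cutoff_mult:
  fixes x :: "real ^ 'n"
  assumes x: "x \<in> unit_cube" and f: "C1_le \<eta> f x"
  shows "C1_le ((pi + 1) * \<eta>) (\<lambda>y. cutoff y * f y) x"
proof -
  obtain \<phi>' where \<phi>': "(cutoff has_derivative \<phi>') (at x)" "\<And>v. \<bar>\<phi>' v\<bar> \<le> pi * norm v"
    using cutoff_derivative[OF x] by blast
  obtain f' where f': "(f has_derivative f') (at x)" "\<And>v. \<bar>f' v\<bar> \<le> \<eta> * norm v" and fx: "\<bar>f x\<bar> \<le> \<eta>"
    using f unfolding C1_le_def by blast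
  have c: "0 < cutoff x" "cutoff x \<le> 1" using cutoff_bounds[OF x] by auto
  have \<eta>: "0 \<le> \<eta>" using fx by simp
  have "((\<lambda>y. cutoff y * f y) has_derivative (\<lambda>v. cutoff x * f' v + \<phi>' v * f x)) (at x)"
    by (rule has_derivative_mult[OF \<phi>'(1) f'(1)])
  moreover have "\<bar>cutoff x * f' v + \<phi>' v * f x\<bar> \<le> (pi + 1) * \<eta> * norm v" for v
  proof -
    have "\<bar>cutoff x * f' v\<bar> \<le> 1 * (\<eta> * norm v)"
      unfolding abs_mult using c f'(2)[of v] by (intro mult_mono) auto
    moreover have "\<bar>\<phi>' v * f x\<bar> \<le> (pi * norm v) * \<eta>"
      unfolding abs_mult using fx \<phi>'(2)[of v] by (intro mult_mono) auto
    ultimately show ?thesis by (simp add: algebra_simps)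
  qed
  moreover have "\<bar>cutoff x * f x\<bar> \<le> (pi + 1) * \<eta>"
  proof -
    have "\<bar>cutoff x * f x\<bar> \<le> 1 * \<eta>"
      unfolding abs_mult using c fx by (intro mult_mono) auto
    also have "\<dots> \<le> (pi + 1) * \<eta>" using \<eta> by (intro mult_right_mono) auto
    finally show ?thesis .
  qed
  ultimately show ?thesis unfolding C1_le_def by blast
qed

section \<open>Sampling in a space of square integrable fields\<close>

text \<open>
  On a finite measure space these functions form a vector space and have integrable squares, so that all integrals
  in the sampling argument exist.
\<close>

definition bdd_meas :: "'a measure \<Rightarrow> ('a \<Rightarrow> 'b::euclidean_space) \<Rightarrow> bool" where
  "bdd_meas M F \<longleftrightarrow> F \<in> borel_measurable M \<and> (\<exists>c. \<forall>x\<in>space M. norm (F x) \<le> c)"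

lemma bdd_meas_add: "bdd_meas M F \<Longrightarrow> bdd_meas M G \<Longrightarrow> bdd_meas M (\<lambda>x. F x + G x)"
  unfolding bdd_meas_def by (auto intro: borel_measurable_add) (meson add_mono norm_triangle_ineq order_trans)

lemma bdd_meas_scaleR: "bdd_meas M F \<Longrightarrow> bdd_meas M (\<lambda>x. r *\<^sub>R F x)"
  unfolding bdd_meas_def by (auto intro: borel_measurable_scaleR) (metis abs_ge_zero mult_left_mono)

lemma bdd_meas_diff: "bdd_meas M F \<Longrightarrow> bdd_meas M G \<Longrightarrow> bdd_meas M (\<lambda>x. F x - G x)"
  using bdd_meas_add[of M F "\<lambda>x. (-1) *\<^sub>R G x"] bdd_meas_scaleR[of M G "-1"] by simp

lemma bdd_meas_zero: "bdd_meas M (\<lambda>_. 0)"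
  unfolding bdd_meas_def by auto

lemma bdd_meas_sum:
  assumes "finite J" "\<And>j. j \<in> J \<Longrightarrow> bdd_meas M (G j)"
  shows "bdd_meas M (\<lambda>x. \<Sum>j\<in>J. G j x)"
  using assms by (induction J) (auto simp: bdd_meas_zero intro: bdd_meas_add)

lemma bdd_meas_integrable_square:
  assumes "finite_measure M" "bdd_meas M F"
  shows "integrable M (\<lambda>x. (norm (F x))\<^sup>2)"
proof -
  interpret finite_measure M by fact
  obtain c where c: "F \<in> borel_measurable M" "\<And>x. x \<in> space M \<Longrightarrow> norm (F x) \<le> c"
    using assms unfolding bdd_meas_def by blast
  show ?thesis
  proof (rule integrable_const_bound[of _ "c\<^sup>2"])
    show "AE x in M. norm ((norm (F x))\<^sup>2) \<le> c\<^sup>2"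
      using c by (intro AE_I2) (auto intro: power_mono)
  qed (use c in measurable)
qed

text \<open>
  The vectors \<open>f - L sgn (\<gamma> j) G j\<close> have mean zero with respect to the weights \<open>|\<gamma> j|\<close>, so the mixed term
  with \<open>S\<close> drops out of the mean of the squared norm, and their variance is bounded by the second moment
  \<open>(L b)\<^sup>2\<close>.
\<close>

lemma maurey_pointwise:
  fixes S :: "'b::real_inner" and G :: "'i \<Rightarrow> 'b" and \<gamma> :: "'i \<Rightarrow> real"
  assumes b: "\<And>j. j \<in> J \<Longrightarrow> norm (G j) \<le> b"
  defines "L \<equiv> \<Sum>j\<in>J. \<bar>\<gamma> j\<bar>"
  defines "f \<equiv> \<Sum>j\<in>J. \<gamma> j *\<^sub>R G j"
  shows "(\<Sum>j\<in>J. \<bar>\<gamma> j\<bar> * (norm (S + (f - (L * sgn (\<gamma> j)) *\<^sub>R G j)))\<^sup>2)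
    \<le> L * ((norm S)\<^sup>2 + (L * b)\<^sup>2)"
proof -
  have L0: "0 \<le> L" by (simp add: L_def sum_nonneg)
  have "\<bar>\<gamma> j\<bar> * (norm (S + (f - (L * sgn (\<gamma> j)) *\<^sub>R G j)))\<^sup>2
      \<le> \<bar>\<gamma> j\<bar> * ((norm (S + f))\<^sup>2 + (L * b)\<^sup>2) - 2 * L * ((S + f) \<bullet> (\<gamma> j *\<^sub>R G j))" if "j \<in> J" for j
  proof -
    have 1: "(norm ((S + f) - (L * sgn (\<gamma> j)) *\<^sub>R G j))\<^sup>2
       = (norm (S + f))\<^sup>2 - 2 * (L * sgn (\<gamma> j)) * ((S + f) \<bullet> G j) + (norm ((L * sgn (\<gamma> j)) *\<^sub>R G j))\<^sup>2"
      unfolding power2_norm_eq_inner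
      by (simp add: inner_diff_left inner_diff_right inner_commute algebra_simps)
    have "norm ((L * sgn (\<gamma> j)) *\<^sub>R G j) \<le> L * b"
      using b[OF that] L0 norm_ge_zero[of "G j"]
      by (auto simp: abs_mult abs_sgn_eq intro: mult_left_mono) (meson mult_nonneg_nonneg norm_ge_zero order_trans)
    then have 2: "(norm ((L * sgn (\<gamma> j)) *\<^sub>R G j))\<^sup>2 \<le> (L * b)\<^sup>2"
      by (rule power_mono) simp
    have 3: "\<bar>\<gamma> j\<bar> * sgn (\<gamma> j) = \<gamma> j" by (simp add: abs_mult_sgn)
    have "\<bar>\<gamma> j\<bar> * (norm ((S + f) - (L * sgn (\<gamma> j)) *\<^sub>R G j))\<^sup>2
      \<le> \<bar>\<gamma> j\<bar> * ((norm (S + f))\<^sup>2 - 2 * (L * sgn (\<gamma> j)) * ((S + f) \<bullet> G j) + (L * b)\<^sup>2)"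
      unfolding 1 using 2 by (intro mult_left_mono) auto
    also have "\<dots> = \<bar>\<gamma> j\<bar> * ((norm (S + f))\<^sup>2 + (L * b)\<^sup>2)
        - 2 * L * ((\<bar>\<gamma> j\<bar> * sgn (\<gamma> j)) * ((S + f) \<bullet> G j))"
      by (simp add: algebra_simps)
    finally show ?thesis unfolding 3 by (simp add: add_diff_eq)
  qed
  then have "(\<Sum>j\<in>J. \<bar>\<gamma> j\<bar> * (norm (S + (f - (L * sgn (\<gamma> j)) *\<^sub>R G j)))\<^sup>2)
    \<le> (\<Sum>j\<in>J. \<bar>\<gamma> j\<bar> * ((norm (S + f))\<^sup>2 + (L * b)\<^sup>2) - 2 * L * ((S + f) \<bullet> (\<gamma> j *\<^sub>R G j)))"
    by (rule sum_mono)
  also have "\<dots> = L * ((norm (S + f))\<^sup>2 + (L * b)\<^sup>2) - 2 * L * ((S + f) \<bullet> f)"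
    unfolding sum_subtractf L_def f_def inner_sum_right
    by (simp only: sum_distrib_left sum_distrib_right)
  also have "\<dots> = L * ((norm S)\<^sup>2 - (norm f)\<^sup>2 + (L * b)\<^sup>2)"
    by (simp add: power2_norm_eq_inner inner_add_left inner_add_right inner_commute algebra_simps)
  also have "\<dots> \<le> L * ((norm S)\<^sup>2 + (L * b)\<^sup>2)"
    using L0 by (intro mult_left_mono) auto
  finally show ?thesis .
qed

text \<open>
  Maurey's argument without probability: the sampled terms are chosen one after the other.  By
  \<open>maurey_pointwise\<close>, on average over the next term the integral of the squared norm of the accumulated deviation grows
  by at most \<open>(L b)\<^sup>2\<close> times the total measure; so some term achieves this.
\<close>

lemma maurey_sampling:
  fixes G :: "'i \<Rightarrow> 'a \<Rightarrow> 'b::euclidean_space" and \<gamma> :: "'i \<Rightarrow> real"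
  assumes M: "finite_measure M" and J: "finite J" "J \<noteq> {}"
    and G: "\<And>j. j \<in> J \<Longrightarrow> G j \<in> borel_measurable M"
    and b: "\<And>j x. j \<in> J \<Longrightarrow> x \<in> space M \<Longrightarrow> norm (G j x) \<le> b"
  defines "L \<equiv> \<Sum>j\<in>J. \<bar>\<gamma> j\<bar>"
  defines "f \<equiv> \<lambda>x. \<Sum>j\<in>J. \<gamma> j *\<^sub>R G j x"
  shows "\<exists>idx. (\<forall>l<m. idx l \<in> J) \<and>
    (\<integral>x. (norm (real m *\<^sub>R f x - (\<Sum>l<m. (L * sgn (\<gamma> (idx l))) *\<^sub>R G (idx l) x)))\<^sup>2 \<partial>M)
      \<le> real m * ((L * b)\<^sup>2 * measure M (space M))"
proof (induction m)
  case 0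
  then show ?case by simp
next
  case (Suc m)
  interpret finite_measure M by fact
  obtain idx where idx: "\<And>l. l < m \<Longrightarrow> idx l \<in> J" and
    IH: "(\<integral>x. (norm (real m *\<^sub>R f x - (\<Sum>l<m. (L * sgn (\<gamma> (idx l))) *\<^sub>R G (idx l) x)))\<^sup>2 \<partial>M)
      \<le> real m * ((L * b)\<^sup>2 * measure M (space M))"
    using Suc by blast
  define S where "S x = real m *\<^sub>R f x - (\<Sum>l<m. (L * sgn (\<gamma> (idx l))) *\<^sub>R G (idx l) x)" for x
  define T where "T j x = S x + (f x - (L * sgn (\<gamma> j)) *\<^sub>R G j x)" for j x
  have bG: "bdd_meas M (G j)" if "j \<in> J" for j
    using G b that unfolding bdd_meas_def by blast
  have bf: "bdd_meas M f" unfolding f_def by (intro bdd_meas_sum bdd_meas_scaleR bG J)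
  have bS: "bdd_meas M S" unfolding S_def
    by (intro bdd_meas_diff bdd_meas_scaleR bf bdd_meas_sum bG idx) auto
  have bT: "bdd_meas M (T j)" if "j \<in> J" for j unfolding T_def
    by (intro bdd_meas_add bdd_meas_diff bdd_meas_scaleR bf bS bG that)
  note iS = bdd_meas_integrable_square[OF M bS] and iT = bdd_meas_integrable_square[OF M bT]
  define V where "V = (\<integral>x. (norm (S x))\<^sup>2 \<partial>M) + (L * b)\<^sup>2 * measure M (space M)"
  have avg: "(\<Sum>j\<in>J. \<bar>\<gamma> j\<bar> * (\<integral>x. (norm (T j x))\<^sup>2 \<partial>M)) \<le> L * V"
  proof -
    have "(\<Sum>j\<in>J. \<bar>\<gamma> j\<bar> * (\<integral>x. (norm (T j x))\<^sup>2 \<partial>M)) = (\<integral>x. (\<Sum>j\<in>J. \<bar>\<gamma> j\<bar> * (norm (T j x))\<^sup>2) \<partial>M)"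
      using iT by (subst Bochner_Integration.integral_sum) auto
    also have "\<dots> \<le> (\<integral>x. L * ((norm (S x))\<^sup>2 + (L * b)\<^sup>2) \<partial>M)"
    proof (rule integral_mono)
      fix x assume "x \<in> space M"
      then show "(\<Sum>j\<in>J. \<bar>\<gamma> j\<bar> * (norm (T j x))\<^sup>2) \<le> L * ((norm (S x))\<^sup>2 + (L * b)\<^sup>2)"
        unfolding T_def L_def f_def by (intro maurey_pointwise b)
    qed (use iS iT in \<open>auto intro!: Bochner_Integration.integrable_sum\<close>)
    also have "\<dots> = L * V" using iS by (simp add: V_def mult.commute)
    finally show ?thesis .
  qed
  have "\<exists>j\<in>J. (\<integral>x. (norm (T j x))\<^sup>2 \<partial>M) \<le> V"
  proof (cases "L = 0")
    case True
    then have "\<gamma> j = 0" if "j \<in> J" for j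
      using that J unfolding L_def by (simp add: sum_nonneg_eq_0_iff)
    then have "f = (\<lambda>_. 0)" by (simp add: f_def)
    then have "T j = S" for j using True by (auto simp: T_def)
    then show ?thesis using J True by (auto simp: V_def)
  next
    case False
    show ?thesis
    proof (rule ccontr)
      assume "\<not> ?thesis"
      then have less: "V < (\<integral>x. (norm (T j x))\<^sup>2 \<partial>M)" if "j \<in> J" for j using that by auto
      have "\<exists>j\<in>J. \<gamma> j \<noteq> 0" using False unfolding L_def by (metis abs_zero sum.neutral)
      then obtain i where i: "i \<in> J" "\<gamma> i \<noteq> 0" by blast
      have "(\<Sum>j\<in>J. \<bar>\<gamma> j\<bar> * V) < (\<Sum>j\<in>J. \<bar>\<gamma> j\<bar> * (\<integral>x. (norm (T j x))\<^sup>2 \<partial>M))"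
      proof (rule sum_strict_mono_ex1[OF J(1)])
        show "\<forall>j\<in>J. \<bar>\<gamma> j\<bar> * V \<le> \<bar>\<gamma> j\<bar> * (\<integral>x. (norm (T j x))\<^sup>2 \<partial>M)"
          by (intro ballI mult_left_mono less_imp_le[OF less] abs_ge_zero)
        show "\<exists>j\<in>J. \<bar>\<gamma> j\<bar> * V < \<bar>\<gamma> j\<bar> * (\<integral>x. (norm (T j x))\<^sup>2 \<partial>M)"
          using less[OF i(1)] i by (intro bexI[of _ i]) auto
      qed
      then show False using avg by (simp add: L_def sum_distrib_right)
    qed
  qed
  then obtain j where j: "j \<in> J" "(\<integral>x. (norm (T j x))\<^sup>2 \<partial>M) \<le> V" by blast
  define idx' where "idx' = idx(m := j)"
  have *: "(\<Sum>l<Suc m. (L * sgn (\<gamma> (idx' l))) *\<^sub>R G (idx' l) x)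
      = (\<Sum>l<m. (L * sgn (\<gamma> (idx l))) *\<^sub>R G (idx l) x) + (L * sgn (\<gamma> j)) *\<^sub>R G j x" for x
    by (simp add: idx'_def)
  have eq: "real (Suc m) *\<^sub>R f x - (\<Sum>l<Suc m. (L * sgn (\<gamma> (idx' l))) *\<^sub>R G (idx' l) x) = T j x" for x
    unfolding T_def S_def * by (simp add: algebra_simps)
  show ?case
  proof (intro exI[of _ idx'] conjI allI impI)
    show "idx' l \<in> J" if "l < Suc m" for l using that idx j by (auto simp: idx'_def less_Suc_eq)
    have "(\<integral>x. (norm (T j x))\<^sup>2 \<partial>M) \<le> V" by (rule j)
    also have "\<dots> \<le> real (Suc m) * ((L * b)\<^sup>2 * measure M (space M))"
      using IH by (simp add: V_def S_def[symmetric] algebra_simps)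
    finally show "(\<integral>x. (norm (real (Suc m) *\<^sub>R f x - (\<Sum>l<Suc m. (L * sgn (\<gamma> (idx' l))) *\<^sub>R G (idx' l) x)))\<^sup>2 \<partial>M)
      \<le> real (Suc m) * ((L * b)\<^sup>2 * measure M (space M))" unfolding eq .
  qed
qed

section \<open>Bounded differentiable functions in the Sobolev space\<close>

definition line_quotient :: "(real ^ 'n \<Rightarrow> real) \<Rightarrow> real ^ 'n \<Rightarrow> nat \<Rightarrow> real ^ 'n \<Rightarrow> real" where
  "line_quotient H e n x = (H (inverse (real (Suc n)) *\<^sub>R e + x) - H x) * real (Suc n)"

text \<open>
  The steps \<open>1 / (n + 1)\<close> make the directional derivative a limit of a sequence, which shows that it is
  measurable and lets dominated convergence apply.
\<close>

lemma line_quotient_tendsto: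
  assumes "((\<lambda>r. H (x + r *\<^sub>R e)) has_real_derivative d) (at 0)"
  shows "(\<lambda>n. line_quotient H e n x) \<longlonglongrightarrow> d"
proof -
  have "((\<lambda>r. (H (x + r *\<^sub>R e) - H x) / r) \<longlongrightarrow> d) (at 0)"
    using assms by (simp add: DERIV_def)
  moreover have "filterlim (\<lambda>n. inverse (real (Suc n))) (at 0) sequentially"
    unfolding filterlim_at using LIMSEQ_inverse_real_of_nat by auto
  ultimately have "(\<lambda>n. (H (x + inverse (real (Suc n)) *\<^sub>R e) - H x) / inverse (real (Suc n))) \<longlonglongrightarrow> d"
    by (rule filterlim_compose)
  moreover have "(H (x + inverse (real (Suc n)) *\<^sub>R e) - H x) / inverse (real (Suc n)) = line_quotient H e n x" for n
    by (simp add: line_quotient_def add.commute divide_inverse)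
  ultimately show ?thesis by simp
qed

lemma measurable_line_quotient:
  assumes "H \<in> borel_measurable borel"
  shows "line_quotient H e n \<in> borel_measurable borel"
  unfolding line_quotient_def[abs_def] using assms by measurable

lemma integral_lborel_translation:
  fixes H :: "'a::euclidean_space \<Rightarrow> real"
  assumes "H \<in> borel_measurable borel"
  shows "(\<integral>x. H (a + x) \<partial>lborel) = (\<integral>x. H x \<partial>lborel)"
    and "integrable lborel (\<lambda>x. H (a + x)) \<longleftrightarrow> integrable lborel H"
proof -
  have "(\<integral>x. H x \<partial>lborel) = (\<integral>x. H x \<partial>distr lborel borel ((+) a))"
    by (simp add: lborel_distr_plus)
  also have "\<dots> = (\<integral>x. H (a + x) \<partial>lborel)"
    using assms by (intro integral_distr) auto
  finally show "(\<integral>x. H (a + x) \<partial>lborel) = (\<integral>x. H x \<partial>lborel)" by simp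
  have "integrable lborel H \<longleftrightarrow> integrable (distr lborel borel ((+) a)) H"
    by (simp add: lborel_distr_plus)
  also have "\<dots> \<longleftrightarrow> integrable lborel (\<lambda>x. H (a + x))"
    using assms by (intro integrable_distr_eq) auto
  finally show "integrable lborel (\<lambda>x. H (a + x)) \<longleftrightarrow> integrable lborel H" by simp
qed

lemma integrable_bounded_support:
  fixes H :: "'a::euclidean_space \<Rightarrow> real"
  assumes "H \<in> borel_measurable borel" "\<And>x. \<bar>H x\<bar> \<le> C" "\<And>x. x \<notin> cball 0 R \<Longrightarrow> H x = 0"
  shows "integrable lborel H"
proof (rule Bochner_Integration.integrable_bound[of _ "\<lambda>x. C * indicator (cball 0 R) x"])
  have "emeasure lborel (cball (0::'a) R) < \<infinity>"
    by (rule emeasure_lborel_cball_finite)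
  then show "integrable lborel (\<lambda>x. C * indicator (cball (0::'a) R) x :: real)"
    by (intro integrable_mult_right integrable_real_indicator) auto
  have "0 \<le> C" using assms(2)[of 0] by simp
  then show "AE x in lborel. norm (H x) \<le> norm (C * indicator (cball 0 R) x :: real)"
    using assms(2,3) by (intro AE_I2) (auto simp: indicator_def)
qed (use assms in auto)

text \<open>
  Integration by parts without iterated integrals: by translation invariance the difference quotients of a compactly
  supported function have integral zero, and they converge boundedly to the directional derivative.
\<close>

lemma integral_line_derivative_eq_0:
  fixes H h :: "real ^ 'n \<Rightarrow> real"
  assumes H: "H \<in> borel_measurable borel" "\<And>x. \<bar>H x\<bar> \<le> C" "\<And>x. x \<notin> cball 0 R \<Longrightarrow> H x = 0"
    and h: "\<And>x. ((\<lambda>r. H (x + r *\<^sub>R e)) has_real_derivative h x) (at 0)" "\<And>x. \<bar>h x\<bar> \<le> C"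
  shows "(\<integral>x. h x \<partial>lebesgue) = 0"
proof -
  have mh: "h \<in> borel_measurable borel"
    by (rule borel_measurable_LIMSEQ_real[OF line_quotient_tendsto[OF h(1)] measurable_line_quotient[OF H(1)]])
  have mvt: "\<bar>H (x + t *\<^sub>R e) - H x\<bar> \<le> C * \<bar>t\<bar>" for x t
  proof -
    have d: "((\<lambda>r. H (x + r *\<^sub>R e)) has_real_derivative h (x + r *\<^sub>R e)) (at r)" for r
    proof -
      have "(\<lambda>s. H (x + r *\<^sub>R e + s *\<^sub>R e)) = (\<lambda>s. H (x + (s + r) *\<^sub>R e))"
        by (simp add: algebra_simps)
      then show ?thesis
        using h(1)[of "x + r *\<^sub>R e"] DERIV_shift[of "\<lambda>r. H (x + r *\<^sub>R e)" "h (x + r *\<^sub>R e)" 0 r]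
        by (simp only: add_0_left)
    qed
    have "norm (H (x + t *\<^sub>R e) - H (x + 0 *\<^sub>R e)) \<le> C * norm (t - 0)"
      by (rule field_differentiable_bound[of UNIV "\<lambda>r. H (x + r *\<^sub>R e)" "\<lambda>r. h (x + r *\<^sub>R e)"])
        (use d h(2) in auto)
    then show ?thesis by simp
  qed
  have bound: "\<bar>line_quotient H e n x\<bar> \<le> C * indicator (cball 0 (R + norm e)) x" for n x
  proof -
    have "\<bar>line_quotient H e n x\<bar> \<le> C * \<bar>inverse (real (Suc n))\<bar> * real (Suc n)"
      unfolding line_quotient_def abs_mult using mvt[of x "inverse (real (Suc n))"]
      by (simp add: add.commute mult_right_mono)
    also have "\<dots> = C" by (simp del: of_nat_Suc)
    finally have 1: "\<bar>line_quotient H e n x\<bar> \<le> C" .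
    have 2: "line_quotient H e n x = 0" if "x \<notin> cball 0 (R + norm e)"
    proof -
      have x: "norm x > R + norm e" using that by simp
      have le: "norm (inverse (real (Suc n)) *\<^sub>R e) \<le> 1 * norm e"
        unfolding norm_scaleR by (intro mult_right_mono) (auto simp: field_simps)
      have "norm x \<le> norm (inverse (real (Suc n)) *\<^sub>R e + x) + norm (inverse (real (Suc n)) *\<^sub>R e)"
        by (metis add.commute add_diff_cancel_right' norm_triangle_ineq4)
      then have "norm (inverse (real (Suc n)) *\<^sub>R e + x) > R" "norm x > R"
        using x le norm_ge_zero[of e] by linarith+
      then have "H (inverse (real (Suc n)) *\<^sub>R e + x) = 0" "H x = 0" by (auto intro!: H(3))
      then show ?thesis by (simp add: line_quotient_def)
    qed
    show ?thesis using 1 2 by (auto simp: indicator_def)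
  qed
  have int: "integrable lborel H" by (rule integrable_bounded_support[OF H])
  have "(\<lambda>n. \<integral>x. line_quotient H e n x \<partial>lborel) \<longlonglongrightarrow> (\<integral>x. h x \<partial>lborel)"
  proof (rule integral_dominated_convergence[where w = "\<lambda>x. C * indicator (cball 0 (R + norm e)) x"])
    have "emeasure lborel (cball (0::real^'n) (R + norm e)) < \<infinity>"
      by (rule emeasure_lborel_cball_finite)
    then show "integrable lborel (\<lambda>x. C * indicator (cball (0::real^'n) (R + norm e)) x :: real)"
      by (intro integrable_mult_right integrable_real_indicator) auto
  qed (use mh measurable_line_quotient[OF H(1)] bound line_quotient_tendsto[OF h(1)] in auto)
  moreover have "(\<integral>x. line_quotient H e n x \<partial>lborel) = 0" for n
  proof -
    define a where "a = inverse (real (Suc n)) *\<^sub>R e"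
    have i2: "integrable lborel (\<lambda>x. H (a + x))"
      using int integral_lborel_translation(2)[OF H(1)] by simp
    have "(\<integral>x. line_quotient H e n x \<partial>lborel) = (\<integral>x. H (a + x) - H x \<partial>lborel) * real (Suc n)"
      unfolding line_quotient_def a_def by (rule Bochner_Integration.integral_mult_left_zero)
    also have "\<dots> = ((\<integral>x. H (a + x) \<partial>lborel) - (\<integral>x. H x \<partial>lborel)) * real (Suc n)"
      by (simp only: Bochner_Integration.integral_diff[OF i2 int])
    finally have "(\<integral>x. line_quotient H e n x \<partial>lborel)
      = ((\<integral>x. H (a + x) \<partial>lborel) - (\<integral>x. H x \<partial>lborel)) * real (Suc n)" .
    then show ?thesis by (simp add: integral_lborel_translation(1)[OF H(1)])
  qed
  ultimately have "(\<integral>x. h x \<partial>lborel) = 0" by (simp add: LIMSEQ_const_iff)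
  then show ?thesis using mh by (simp add: integral_completion)
qed

lemma test_function_derivative:
  assumes "test_function S \<psi>"
  shows "(\<psi> has_derivative frechet_derivative \<psi> (at x)) (at x)"
    and "continuous_on UNIV (partial_deriv i \<psi>)"
proof -
  have C: "C_k k \<psi>" for k using assms by (simp add: test_function_def)
  have "\<psi> differentiable at x" using C[of "Suc 0"] by simp
  then show "(\<psi> has_derivative frechet_derivative \<psi> (at x)) (at x)"
    by (simp add: frechet_derivative_works)
  show "continuous_on UNIV (partial_deriv i \<psi>)" using C[of "Suc 0"] by simp
qed

lemma test_function_bounded:
  assumes t: "test_function S \<psi>"
  obtains K C where "compact K" "K \<subseteq> S" "\<And>x. x \<notin> K \<Longrightarrow> \<psi> x = 0" "\<And>x. x \<notin> K \<Longrightarrow> partial_deriv i \<psi> x = 0"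
    "\<And>x. \<bar>\<psi> x\<bar> \<le> C" "\<And>x. \<bar>partial_deriv i \<psi> x\<bar> \<le> C"
proof -
  define K where "K = closure {x. \<psi> x \<noteq> 0}"
  have K: "compact K" "K \<subseteq> S" using t by (auto simp: test_function_def K_def)
  have 0: "\<psi> x = 0" if "x \<notin> K" for x using that closure_subset[of "{x. \<psi> x \<noteq> 0}"] by (auto simp: K_def)
  have p0: "partial_deriv i \<psi> x = 0" if "x \<notin> K" for x
  proof -
    have "open (- K)" by (simp add: K_def open_Compl)
    have "(\<psi> has_derivative (\<lambda>_. 0)) (at x)"
      by (rule has_derivative_transform_within_open[of "\<lambda>_. 0" "\<lambda>_. 0" x UNIV "- K"])
        (use 0 that \<open>open (- K)\<close> in auto)
    then show ?thesis by (simp add: partial_deriv_def frechet_derivative_at[symmetric])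
  qed
  have "continuous_on UNIV \<psi>"
    by (intro continuous_at_imp_continuous_on ballI has_derivative_continuous[OF test_function_derivative(1)[OF t]])
  then have "bounded (\<psi> ` K)" "bounded (partial_deriv i \<psi> ` K)"
    using K(1) test_function_derivative(2)[OF t]
    by (auto intro!: compact_imp_bounded compact_continuous_image intro: continuous_on_subset)
  then obtain a b where ab: "\<And>x. x \<in> K \<Longrightarrow> \<bar>\<psi> x\<bar> \<le> a" "\<And>x. x \<in> K \<Longrightarrow> \<bar>partial_deriv i \<psi> x\<bar> \<le> b"
    by (auto simp: bounded_iff)
  have "\<bar>\<psi> x\<bar> \<le> max 0 (max a b)" "\<bar>partial_deriv i \<psi> x\<bar> \<le> max 0 (max a b)" for x
    using ab[of x] 0[of x] p0[of x] by (cases "x \<in> K"; auto simp: le_max_iff_disj)+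
  then show ?thesis using that[OF K 0 p0] by blast
qed

text \<open>
  The gradient need not be continuous, but on the open set \<open>S\<close> its components are limits of difference quotients
  of the extension of \<open>F\<close> by zero.
\<close>

lemma gradient_measurable:
  fixes F :: "real ^ 'n \<Rightarrow> real"
  assumes S: "open S" and der: "\<And>x. x \<in> S \<Longrightarrow> (F has_derivative (\<lambda>v. g x \<bullet> v)) (at x)"
  shows "(\<lambda>x. indicator S x *\<^sub>R F x) \<in> borel_measurable borel"
    and "(\<lambda>x. indicator S x *\<^sub>R g x) \<in> borel_measurable borel"
proof -
  have [measurable]: "S \<in> sets borel" using S by simp
  have cont: "continuous_on S F"
    using has_derivative_continuous[OF der] by (auto intro!: continuous_at_imp_continuous_on)
  define H where "H x = indicator S x * F x" for x
  have mH: "H \<in> borel_measurable borel"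
    using borel_measurable_continuous_on_indicator[OF _ cont] S by (simp add: H_def[abs_def])
  show "(\<lambda>x. indicator S x *\<^sub>R F x) \<in> borel_measurable borel"
    using mH by (simp add: H_def[abs_def])
  show "(\<lambda>x. indicator S x *\<^sub>R g x) \<in> borel_measurable borel"
  proof (rule borel_measurable_euclidean_space[THEN iffD2], rule ballI)
    fix e :: "real ^ 'n"
    show "(\<lambda>x. (indicator S x *\<^sub>R g x) \<bullet> e) \<in> borel_measurable borel"
    proof (rule borel_measurable_LIMSEQ_real)
      show "(\<lambda>x. indicator S x * line_quotient H e n x) \<in> borel_measurable borel" for n
        using measurable_line_quotient[OF mH] by measurable
      fix x
      show "(\<lambda>n. indicator S x * line_quotient H e n x) \<longlonglongrightarrow> (indicator S x *\<^sub>R g x) \<bullet> e"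
      proof (cases "x \<in> S")
        case True
        have "(H has_derivative (\<lambda>v. g x \<bullet> v)) (at x)"
          by (rule has_derivative_transform_within_open[OF der[OF True] S True]) (simp add: H_def)
        then have "((\<lambda>r. H (x + r *\<^sub>R e)) has_derivative (\<lambda>r. g x \<bullet> (r *\<^sub>R e))) (at 0)"
          by (intro has_derivative_compose[of "\<lambda>r. x + r *\<^sub>R e" "\<lambda>r. r *\<^sub>R e" 0 UNIV H])
            (auto intro!: derivative_eq_intros)
        then have "((\<lambda>r. H (x + r *\<^sub>R e)) has_real_derivative g x \<bullet> e) (at 0)"
          by (simp add: has_field_derivative_def mult.commute[of _ "g x \<bullet> e"])
        from line_quotient_tendsto[OF this] show ?thesis using True by simp
      qed simp
    qed
  qed
qed

lemma set_integral_cong_AE_restrict: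
  fixes f g :: "'a \<Rightarrow> real"
  assumes "AE x\<in>A in M. f x = g x" "set_borel_measurable M A f" "set_borel_measurable M A g"
  shows "(LINT x:A|M. f x) = (LINT x:A|M. g x)"
  unfolding set_lebesgue_integral_def
  using assms by (intro integral_cong_AE) (auto simp: set_borel_measurable_def)

text \<open>
  The product of \<open>F\<close> with a test function, extended by zero, is differentiable on the whole space, so
  \<open>integral_line_derivative_eq_0\<close> is the integration by parts that identifies \<open>g\<close> as a weak gradient.  The
  function \<open>f\<close> is allowed to differ from \<open>F\<close> on a null set since elements of Barron spaces are only determined
  almost everywhere.
\<close>

lemma H1_classical:
  fixes F f :: "real ^ 'n \<Rightarrow> real"
  assumes S: "open S" "bounded S"
    and der: "\<And>x. x \<in> S \<Longrightarrow> (F has_derivative (\<lambda>v. g x \<bullet> v)) (at x)"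
    and bF: "\<And>x. x \<in> S \<Longrightarrow> \<bar>F x\<bar> \<le> C" and bg: "\<And>x. x \<in> S \<Longrightarrow> norm (g x) \<le> C"
    and mf: "set_borel_measurable lebesgue S f"
    and ae: "AE x in lebesgue. x \<in> S \<longrightarrow> f x = F x"
  shows "f \<in> H1_space S"
    and "H1_norm S f \<le> sqrt ((LINT x:S|lebesgue. (F x)\<^sup>2) + (LINT x:S|lebesgue. (norm (g x))\<^sup>2))"
proof -
  have Sm[measurable]: "S \<in> sets borel" using S by simp
  have Sl: "S \<in> sets lebesgue" using S by (simp add: borel_open)
  have fin: "emeasure lebesgue S < \<infinity>"
    using S emeasure_bounded_finite[OF S(2)] by simp
  have mFb: "(\<lambda>x. indicator S x *\<^sub>R F x) \<in> borel_measurable borel"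
    and mgb: "(\<lambda>x. indicator S x *\<^sub>R g x) \<in> borel_measurable borel"
    using gradient_measurable[OF S(1) der] by auto
  have mF: "set_borel_measurable lebesgue S F" and mg: "set_borel_measurable lebesgue S g"
    using mFb mgb by (auto simp: set_borel_measurable_def intro!: measurable_completion)
  have bdd_int: "set_integrable lebesgue S q"
    if "set_borel_measurable lebesgue S q" "AE x in lebesgue. x \<in> S \<longrightarrow> norm (q x) \<le> c"
    for q :: "real ^ 'n \<Rightarrow> 'b::euclidean_space" and c
    unfolding set_integrable_def
  proof (rule Bochner_Integration.integrable_bound[of _ "\<lambda>x. c * indicator S x"])
    show "integrable lebesgue (\<lambda>x. c * indicator S x :: real)"
      using fin Sl by (intro integrable_mult_right integrable_real_indicator) auto
    show "(\<lambda>x. indicator S x *\<^sub>R q x) \<in> borel_measurable lebesgue"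
      using that(1) by (simp add: set_borel_measurable_def)
    show "AE x in lebesgue. norm (indicator S x *\<^sub>R q x) \<le> norm (c * indicator S x :: real)"
      using that(2) by eventually_elim (auto simp: indicator_def)
  qed
  have aebf: "AE x in lebesgue. x \<in> S \<longrightarrow> norm (f x) \<le> C"
    using ae by eventually_elim (use bF in auto)
  have if1: "set_integrable lebesgue S f" by (rule bdd_int[OF mf aebf])
  have ig1: "set_integrable lebesgue S g" by (rule bdd_int[OF mg]) (use bg in auto)
  have msq: "set_borel_measurable lebesgue S (\<lambda>x. (norm (q x))\<^sup>2)"
    if "set_borel_measurable lebesgue S q" for q :: "real ^ 'n \<Rightarrow> 'b::euclidean_space"
  proof -
    have "(\<lambda>x. (norm (indicator S x *\<^sub>R q x))\<^sup>2) \<in> borel_measurable lebesgue"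
      using that unfolding set_borel_measurable_def by measurable
    moreover have "(\<lambda>x. (norm (indicator S x *\<^sub>R q x))\<^sup>2) = (\<lambda>x. indicator S x *\<^sub>R (norm (q x))\<^sup>2)"
      by (auto simp: indicator_def)
    ultimately show ?thesis by (simp add: set_borel_measurable_def)
  qed
  have sf: "square_integrable S f"
    unfolding square_integrable_def
  proof
    have "AE x in lebesgue. x \<in> S \<longrightarrow> norm ((norm (f x))\<^sup>2) \<le> C\<^sup>2"
      using aebf
    proof eventually_elim
      case (elim x)
      then show ?case unfolding norm_power by (intro impI power_mono) auto
    qed
    then show "set_integrable lebesgue S (\<lambda>x. (norm (f x))\<^sup>2)"
      by (rule bdd_int[OF msq[OF mf]])
  qed (rule mf)
  have sg: "square_integrable S g"
    unfolding square_integrable_def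
    by (intro conjI mg bdd_int[OF msq[OF mg], of "C\<^sup>2"]) (use bg in \<open>auto intro!: AE_I2 power_mono\<close>)
  have wg: "weak_gradient S f g"
    unfolding weak_gradient_def locally_integrable_def
  proof (intro conjI allI impI)
    fix K :: "(real ^ 'n) set" assume K: "compact K \<and> K \<subseteq> S"
    then have "K \<in> sets lebesgue" by (simp add: borel_compact)
    then show "set_integrable lebesgue K f" "set_integrable lebesgue K g"
      using K if1 ig1 by (auto intro: set_integrable_subset)
  next
    fix \<psi> :: "real ^ 'n \<Rightarrow> real" and i
    assume t: "test_function S \<psi>"
    obtain K D where K: "compact K" "K \<subseteq> S" and z: "\<And>x. x \<notin> K \<Longrightarrow> \<psi> x = 0" "\<And>x. x \<notin> K \<Longrightarrow> partial_deriv i \<psi> x = 0"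
      and D: "\<And>x. \<bar>\<psi> x\<bar> \<le> D" "\<And>x. \<bar>partial_deriv i \<psi> x\<bar> \<le> D"
      using test_function_bounded[OF t, of i] by metis
    have D0: "0 \<le> D" using D(1)[of 0] by simp
    then have CD: "0 \<le> \<bar>C\<bar> * D" by simp
    have cont\<psi>: "continuous_on UNIV \<psi>"
      by (intro continuous_at_imp_continuous_on ballI has_derivative_continuous[OF test_function_derivative(1)[OF t]])
    have m\<psi>[measurable]: "\<psi> \<in> borel_measurable borel" "partial_deriv i \<psi> \<in> borel_measurable borel"
      using cont\<psi> test_function_derivative(2)[OF t] by (auto intro: borel_measurable_continuous_onI)
    define H where "H x = indicator S x * F x * \<psi> x" for x
    define h where "h x = indicator S x * (F x * partial_deriv i \<psi> x + g x $ i * \<psi> x)" for x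
    obtain R where R: "S \<subseteq> cball 0 R" using S(2) by (auto simp: bounded_iff subset_iff)
    have "(\<integral>x. h x \<partial>lebesgue) = 0"
    proof (rule integral_line_derivative_eq_0[where H = H and e = "axis i 1" and R = R and C = "\<bar>C\<bar> * D + \<bar>C\<bar> * D"])
      show "H \<in> borel_measurable borel"
        using mFb m\<psi>(1) unfolding H_def[abs_def] real_scaleR_def by measurable
      fix x
      show "\<bar>H x\<bar> \<le> \<bar>C\<bar> * D + \<bar>C\<bar> * D"
      proof (cases "x \<in> S")
        case True
        have "\<bar>F x * \<psi> x\<bar> \<le> \<bar>C\<bar> * D" unfolding abs_mult
          using bF[OF True] D[of x] by (intro mult_mono) auto
        moreover have "H x = F x * \<psi> x" using True by (simp add: H_def)
        ultimately show ?thesis using CD by linarith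
      qed (use D0 in \<open>simp add: H_def\<close>)
      show "\<bar>h x\<bar> \<le> \<bar>C\<bar> * D + \<bar>C\<bar> * D"
      proof (cases "x \<in> S")
        case True
        have "\<bar>F x * partial_deriv i \<psi> x\<bar> \<le> \<bar>C\<bar> * D" unfolding abs_mult
          using bF[OF True] D[of x] by (intro mult_mono) auto
        moreover have "\<bar>g x $ i * \<psi> x\<bar> \<le> \<bar>C\<bar> * D" unfolding abs_mult
          using order_trans[OF component_le_norm_cart bg[OF True], of i] D[of x] by (intro mult_mono) auto
        moreover have "h x = F x * partial_deriv i \<psi> x + g x $ i * \<psi> x"
          using True by (simp add: h_def)
        ultimately show ?thesis by linarith
      qed (use D0 in \<open>simp add: h_def\<close>)
      show "H x = 0" if "x \<notin> cball 0 R"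
        using that R by (auto simp: H_def indicator_def)
      show "((\<lambda>r. H (x + r *\<^sub>R axis i 1)) has_real_derivative h x) (at 0)"
      proof (cases "x \<in> S")
        case True
        have "((\<lambda>y. F y * \<psi> y) has_derivative (\<lambda>v. F x * frechet_derivative \<psi> (at x) v + (g x \<bullet> v) * \<psi> x)) (at x)"
          by (rule has_derivative_mult[OF der[OF True] test_function_derivative(1)[OF t]])
        then have "(H has_derivative (\<lambda>v. F x * frechet_derivative \<psi> (at x) v + (g x \<bullet> v) * \<psi> x)) (at x)"
          by (rule has_derivative_transform_within_open[OF _ S(1) True]) (simp add: H_def)
        then have "((\<lambda>r. H (x + r *\<^sub>R axis i 1)) has_derivative
           (\<lambda>r. F x * frechet_derivative \<psi> (at x) (r *\<^sub>R axis i 1) + (g x \<bullet> (r *\<^sub>R axis i 1)) * \<psi> x)) (at 0)"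
          by (intro has_derivative_compose[of "\<lambda>r. x + r *\<^sub>R axis i 1" "\<lambda>r. r *\<^sub>R axis i 1" 0 UNIV H])
            (auto intro!: derivative_eq_intros)
        moreover have fr: "frechet_derivative \<psi> (at x) (r *\<^sub>R axis i 1) = r * partial_deriv i \<psi> x" for r
          using linear_frechet_derivative[of \<psi> "at x"] test_function_derivative(1)[OF t, of x]
          by (simp add: partial_deriv_def linear_scale differentiable_def) (metis linear_scale real_scaleR_def)
        moreover have "F x * frechet_derivative \<psi> (at x) (r *\<^sub>R axis i 1) + (g x \<bullet> (r *\<^sub>R axis i 1)) * \<psi> x
          = h x * r" for r
          using True by (simp add: fr h_def inner_axis algebra_simps)
        ultimately show ?thesis
          unfolding has_field_derivative_def by (simp only:)
      next
        case False
        then have xK: "x \<in> - K" "open (- K)" using K by (auto simp: compact_imp_closed)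
        have "(H has_derivative (\<lambda>_. 0)) (at x)"
          by (rule has_derivative_transform_within_open[of "\<lambda>_. 0" "\<lambda>_. 0" x UNIV "- K"])
            (use z xK in \<open>auto simp: H_def\<close>)
        then have "((\<lambda>r. H (x + r *\<^sub>R axis i 1)) has_derivative (\<lambda>r. 0)) (at 0)"
          by (intro has_derivative_compose[of "\<lambda>r. x + r *\<^sub>R axis i 1" "\<lambda>r. r *\<^sub>R axis i 1" 0 UNIV H])
            (auto intro!: derivative_eq_intros)
        moreover have "h x = 0" using False by (simp add: h_def)
        ultimately show ?thesis by (simp add: has_field_derivative_def flip: lambda_zero)
      qed
    qed
    moreover have i1: "set_integrable lebesgue S (\<lambda>x. F x * partial_deriv i \<psi> x)"
    proof (rule bdd_int[of _ "\<bar>C\<bar> * D"])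
      have "(\<lambda>x. (indicator S x *\<^sub>R F x) * partial_deriv i \<psi> x) \<in> borel_measurable borel"
        using mFb m\<psi>(2) by measurable
      then show "set_borel_measurable lebesgue S (\<lambda>x. F x * partial_deriv i \<psi> x)"
        unfolding set_borel_measurable_def by (auto intro!: measurable_completion simp: mult.assoc)
      show "AE x in lebesgue. x \<in> S \<longrightarrow> norm (F x * partial_deriv i \<psi> x) \<le> \<bar>C\<bar> * D"
      proof (intro AE_I2 impI)
        fix x assume "x \<in> S"
        then show "norm (F x * partial_deriv i \<psi> x) \<le> \<bar>C\<bar> * D"
          unfolding real_norm_def abs_mult using bF[of x] D[of x] by (intro mult_mono) auto
      qed
    qed
    moreover have i2: "set_integrable lebesgue S (\<lambda>x. g x $ i * \<psi> x)"
    proof (rule bdd_int[of _ "\<bar>C\<bar> * D"])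
      have "(\<lambda>x. ((indicator S x *\<^sub>R g x) \<bullet> axis i 1) * \<psi> x) \<in> borel_measurable borel"
        using mgb m\<psi>(1) by measurable
      then show "set_borel_measurable lebesgue S (\<lambda>x. g x $ i * \<psi> x)"
        unfolding set_borel_measurable_def
        by (auto intro!: measurable_completion simp: mult.assoc inner_axis)
      show "AE x in lebesgue. x \<in> S \<longrightarrow> norm (g x $ i * \<psi> x) \<le> \<bar>C\<bar> * D"
      proof (intro AE_I2 impI)
        fix x assume x: "x \<in> S"
        then show "norm (g x $ i * \<psi> x) \<le> \<bar>C\<bar> * D"
          unfolding real_norm_def abs_mult
          using order_trans[OF component_le_norm_cart bg[OF x], of i] D[of x] by (intro mult_mono) auto
      qed
    qed
    ultimately have "(LINT x:S|lebesgue. F x * partial_deriv i \<psi> x) + (LINT x:S|lebesgue. g x $ i * \<psi> x) = 0"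
      using set_integral_add(2)[OF i1 i2] by (simp add: h_def[abs_def] set_lebesgue_integral_def)
    moreover have "(LINT x:S|lebesgue. f x * partial_deriv i \<psi> x) = (LINT x:S|lebesgue. F x * partial_deriv i \<psi> x)"
    proof (rule set_integral_cong_AE_restrict)
      show "AE x\<in>S in lebesgue. f x * partial_deriv i \<psi> x = F x * partial_deriv i \<psi> x"
        using ae by eventually_elim auto
      have "partial_deriv i \<psi> \<in> borel_measurable lebesgue"
        by (rule measurable_completion) simp
      then have "(\<lambda>x. (indicator S x *\<^sub>R f x) * partial_deriv i \<psi> x) \<in> borel_measurable lebesgue"
        using mf unfolding set_borel_measurable_def by measurable
      then show "set_borel_measurable lebesgue S (\<lambda>x. f x * partial_deriv i \<psi> x)"
        unfolding set_borel_measurable_def by (simp add: mult.assoc)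
      show "set_borel_measurable lebesgue S (\<lambda>x. F x * partial_deriv i \<psi> x)"
        using i1 unfolding set_borel_measurable_def set_integrable_def by auto
    qed
    ultimately show "(LINT x:S|lebesgue. f x * partial_deriv i \<psi> x) = - (LINT x:S|lebesgue. g x $ i * \<psi> x)"
      by simp
  qed
  show "f \<in> H1_space S" using sf sg wg by (auto simp: H1_space_def)
  have "H1_norm S f \<le> sqrt ((L2_norm S f)\<^sup>2 + (L2_norm S g)\<^sup>2)"
    unfolding H1_norm_def
    by (rule cINF_lower) (use wg sg in \<open>auto intro!: bdd_belowI[of _ 0]\<close>)
  also have "(L2_norm S f)\<^sup>2 = (LINT x:S|lebesgue. (norm (f x))\<^sup>2)"
    unfolding L2_norm_def by (intro real_sqrt_pow2) (simp add: set_lebesgue_integral_def)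
  also have "\<dots> = (LINT x:S|lebesgue. (norm (F x))\<^sup>2)"
    by (rule set_integral_cong_AE_restrict[OF _ msq[OF mf] msq[OF mF]])
      (use ae in eventually_elim, auto)
  also have "(L2_norm S g)\<^sup>2 = (LINT x:S|lebesgue. (norm (g x))\<^sup>2)"
    unfolding L2_norm_def by (intro real_sqrt_pow2) (simp add: set_lebesgue_integral_def)
  finally show "H1_norm S f \<le> sqrt ((LINT x:S|lebesgue. (F x)\<^sup>2) + (LINT x:S|lebesgue. (norm (g x))\<^sup>2))"
    by simp
qed

section \<open>Sine series\<close>

text \<open>
  Lebesgue measure on the space is the image of a product measure indexed by the standard basis.
\<close>

lemma integral_prod_components:
  fixes f :: "'n::finite \<Rightarrow> real \<Rightarrow> real"
  assumes f: "\<And>i. integrable lborel (f i)"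
  shows "(\<integral>x. (\<Prod>i\<in>UNIV. f i ((x::real^'n) $ i)) \<partial>lborel) = (\<Prod>i\<in>UNIV. \<integral>t. f i t \<partial>lborel)"
proof -
  interpret product_sigma_finite "\<lambda>_::real^'n. lborel :: real measure" ..
  have [measurable]: "f i \<in> borel_measurable borel" for i using f[of i] by auto
  let ?B = "Basis :: (real ^ 'n) set"
  let ?P = "Pi\<^sub>M ?B (\<lambda>_. lborel :: real measure)"
  let ?c = "\<lambda>g. \<Sum>b\<in>?B. g b *\<^sub>R b"
  have B: "?B = (\<lambda>i. axis i 1) ` UNIV" by (auto simp: Basis_vec_def)
  have inj: "inj (\<lambda>i::'n. axis i (1::real))" by (auto simp: inj_on_def axis_eq_axis)
  have comp: "(?c g) $ i = g (axis i 1)" for g :: "real^'n \<Rightarrow> real" and i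
    by (simp add: cart_eq_inner_axis inner_sum_left_Basis)
  have "(\<integral>x. (\<Prod>i\<in>UNIV. f i ((x::real^'n) $ i)) \<partial>lborel)
      = (\<integral>x. (\<Prod>i\<in>UNIV. f i ((x::real^'n) $ i)) \<partial>distr ?P borel ?c)"
    by (subst lborel_eq) simp
  also have "\<dots> = (\<integral>g. (\<Prod>i\<in>UNIV. f i ((?c g) $ i)) \<partial>?P)"
    by (intro integral_distr) measurable
  also have "\<dots> = (\<integral>g. (\<Prod>b\<in>?B. f (axis_index b) (g b)) \<partial>?P)"
    unfolding comp unfolding B by (subst prod.reindex[OF inj]) simp
  also have "\<dots> = (\<Prod>b\<in>?B. \<integral>t. f (axis_index b) t \<partial>lborel)"
    by (rule product_integral_prod) (auto intro: f)
  also have "\<dots> = (\<Prod>i\<in>UNIV. \<integral>t. f i t \<partial>lborel)"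
    unfolding B by (subst prod.reindex[OF inj]) simp
  finally show ?thesis .
qed

lemma integral_cos_multiple_pi:
  "(\<integral>t. indicator {0<..<1} t * cos (pi * of_int n * t) \<partial>lborel) = (if n = 0 then 1 else 0)"
proof -
  have "(\<integral>t. indicator {0<..<1} t * cos (pi * of_int n * t) \<partial>lborel)
      = (\<integral>t. cos (pi * of_int n * t) * indicator {0..1} t \<partial>lborel)"
  proof (rule integral_cong_AE)
    show "AE t in lborel. indicator {0<..<1} t * cos (pi * of_int n * t) = cos (pi * of_int n * t) * indicator {0..1} t"
      using AE_lborel_singleton[of 0] AE_lborel_singleton[of 1]
      by eventually_elim (auto simp: indicator_def)
  qed measurable
  also have "\<dots> = (if n = 0 then 1 else 0)"
  proof (cases "n = 0")
    case False
    have "(\<integral>t. cos (pi * of_int n * t) * indicator {0..1} t \<partial>lborel)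
        = sin (pi * of_int n * 1) / (pi * of_int n) - sin (pi * of_int n * 0) / (pi * of_int n)"
      by (rule integral_FTC_Icc_real)
        (use False in \<open>auto intro!: derivative_eq_intros continuous_intros\<close>)
    then show ?thesis using False by simp
  qed simp
  finally show ?thesis .
qed

lemma integrable_indicator_mult_continuous:
  fixes f :: "real \<Rightarrow> real"
  assumes "continuous_on UNIV f" "\<And>t. \<bar>f t\<bar> \<le> C"
  shows "integrable lborel (\<lambda>t. indicator {0<..<1} t * f t)"
proof (rule Bochner_Integration.integrable_bound[of _ "\<lambda>t. C * indicator {0<..<1} t"])
  show "integrable lborel (\<lambda>t. C * indicator {0<..<1::real} t :: real)"
    by (intro integrable_mult_right integrable_real_indicator) auto
  have [measurable]: "f \<in> borel_measurable borel" using assms(1) by (rule borel_measurable_continuous_onI)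
  show "(\<lambda>t. indicator {0<..<1} t * f t) \<in> borel_measurable lborel" by measurable
  have "0 \<le> C" using assms(2)[of 0] by linarith
  then show "AE t in lborel. norm (indicator {0<..<1} t * f t) \<le> norm (C * indicator {0<..<1} t :: real)"
    using assms(2) by (auto simp: indicator_def)
qed

lemma integral_sin_sin:
  assumes "k > 0" "l > 0"
  shows "(\<integral>t. indicator {0<..<1} t * (sin (pi * real k * t) * sin (pi * real l * t)) \<partial>lborel) =
    (if k = l then 1 / 2 else 0)"
proof -
  have i: "integrable lborel (\<lambda>t. indicator {0<..<1} t * cos (pi * of_int n * t))" for n :: int
    by (rule integrable_indicator_mult_continuous[where C = 1]) (auto intro!: continuous_intros)
  have "indicator {0<..<1} t * (sin (pi * real k * t) * sin (pi * real l * t))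
     = (indicator {0<..<1} t * cos (pi * of_int (int k - int l) * t)) / 2
       - (indicator {0<..<1} t * cos (pi * of_int (int k + int l) * t)) / 2" for t
  proof -
    have 1: "pi * of_int (int k - int l) * t = pi * real k * t - pi * real l * t"
      "pi * of_int (int k + int l) * t = pi * real k * t + pi * real l * t"
      by (simp_all add: left_diff_distrib right_diff_distrib distrib_left distrib_right)
    show ?thesis unfolding 1 cos_add cos_diff by (simp add: indicator_def add_divide_distrib diff_divide_distrib)
  qed
  then have "(\<integral>t. indicator {0<..<1} t * (sin (pi * real k * t) * sin (pi * real l * t)) \<partial>lborel)
     = (\<integral>t. (indicator {0<..<1} t * cos (pi * of_int (int k - int l) * t)) / 2
       - (indicator {0<..<1} t * cos (pi * of_int (int k + int l) * t)) / 2 \<partial>lborel)"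
    by (simp only:)
  also have "\<dots> = (\<integral>t. indicator {0<..<1} t * cos (pi * of_int (int k - int l) * t) \<partial>lborel) / 2
       - (\<integral>t. indicator {0<..<1} t * cos (pi * of_int (int k + int l) * t) \<partial>lborel) / 2"
    using i[of "int k - int l"] i[of "int k + int l"]
    by (subst Bochner_Integration.integral_diff) (intro integrable_divide_zero | simp only: integral_divide_zero)+
  also have "\<dots> = (if k = l then 1 / 2 else 0)"
    unfolding integral_cos_multiple_pi using assms by auto
  finally show ?thesis .
qed

lemma continuous_sine_basis: "continuous_on UNIV (sine_basis k)"
  unfolding sine_basis_def[abs_def] by (intro continuous_intros)

lemma measurable_sine_basis [measurable]: "sine_basis k \<in> borel_measurable borel"
  by (rule borel_measurable_continuous_onI[OF continuous_sine_basis])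

lemma abs_sine_basis_le_1: "\<bar>sine_basis k x\<bar> \<le> 1"
  unfolding sine_basis_def abs_prod by (intro prod_le_1) auto

lemma sine_basis_eq_0:
  assumes "k $ i = 0"
  shows "sine_basis k x = 0"
  unfolding sine_basis_def using assms by (intro prod_zero) (auto intro!: exI[of _ i])

lemma sine_basis_orthogonal:
  fixes k l :: "nat ^ 'n"
  assumes "\<And>i. k $ i > 0" "\<And>i. l $ i > 0"
  shows "sine_coeff (sine_basis k) l = (if k = l then 1 else 0)"
proof -
  define f where "f i t = indicator {0<..<1} t * (sin (pi * real (k $ i) * t) * sin (pi * real (l $ i) * t))"
    for i :: 'n and t :: real
  have f: "integrable lborel (f i)" for i
    unfolding f_def
    by (rule integrable_indicator_mult_continuous[where C = 1])
      (auto intro!: continuous_intros simp: abs_mult mult_le_one)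
  have ind: "indicator unit_cube x = (\<Prod>i\<in>UNIV. indicator {0<..<1} (x $ i) :: real)" for x :: "real ^ 'n"
  proof (cases "x \<in> unit_cube")
    case True
    then show ?thesis by (simp add: unit_cube_def mem_box_cart)
  next
    case False
    then obtain i where "\<not> (0 < x $ i \<and> x $ i < 1)" by (auto simp: unit_cube_def mem_box_cart)
    then have "(\<Prod>i\<in>UNIV. indicator {0<..<1} (x $ i) :: real) = 0"
      by (intro prod_zero) (auto intro!: exI[of _ i])
    then show ?thesis using False by simp
  qed
  have m: "(\<lambda>x. indicator unit_cube x * (sine_basis k x * sine_basis l x)) \<in> borel_measurable borel"
    by (intro borel_measurable_times borel_measurable_indicator measurable_sine_basis)
      (simp add: unit_cube_def)
  have "(LINT x:unit_cube|lebesgue. sine_basis k x * sine_basis l x)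
      = (\<integral>x. indicator unit_cube x * (sine_basis k x * sine_basis l x) \<partial>lborel)"
    unfolding set_lebesgue_integral_def real_scaleR_def using m by (intro integral_completion) simp
  also have "\<dots> = (\<integral>x. (\<Prod>i\<in>UNIV. f i (x $ i)) \<partial>lborel)"
    unfolding f_def ind sine_basis_def by (simp add: prod.distrib)
  also have "\<dots> = (\<Prod>i\<in>UNIV. \<integral>t. f i t \<partial>lborel)" by (rule integral_prod_components[OF f])
  also have "\<dots> = (\<Prod>i\<in>UNIV. (if k $ i = l $ i then 1 / 2 else 0))"
    unfolding f_def using assms by (simp add: integral_sin_sin)
  also have "\<dots> = (if k = l then (1 / 2) ^ CARD('n) else 0)"
  proof (cases "k = l")
    case False
    then obtain i where "k $ i \<noteq> l $ i" by (auto simp: vec_eq_iff)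
    then have "(\<Prod>i\<in>UNIV. (if k $ i = l $ i then 1 / 2 else 0 :: real)) = 0"
      by (intro prod_zero) auto
    then show ?thesis using False by simp
  qed simp
  finally show ?thesis by (simp add: sine_coeff_def power_one_over)
qed

text \<open>
  The linear span of the sine basis.  All multi-indices are allowed: those with a zero entry give the zero
  function and make the span closed under multiplication by cosines.
\<close>

inductive sine_poly :: "(real ^ 'n \<Rightarrow> real) \<Rightarrow> bool" where
  basis: "sine_poly (sine_basis k)"
| add: "sine_poly f \<Longrightarrow> sine_poly g \<Longrightarrow> sine_poly (\<lambda>x. f x + g x)"
| scale: "sine_poly f \<Longrightarrow> sine_poly (\<lambda>x. r * f x)"

lemma sine_poly_sum:
  assumes "finite A" "\<And>i. i \<in> A \<Longrightarrow> sine_poly (f i)"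
  shows "sine_poly (\<lambda>x. \<Sum>i\<in>A. f i x)"
  using assms
proof (induction A)
  case empty
  then show ?case using sine_poly.scale[OF sine_poly.basis, of 0] by simp
next
  case (insert i A)
  then show ?case using sine_poly.add[of "f i" "\<lambda>x. \<Sum>i\<in>A. f i x"] by simp
qed

lemma sine_poly_mult_cos:
  assumes "sine_poly f"
  shows "sine_poly (\<lambda>x. cos (pi * x $ i) * f x)"
  using assms
proof (induction rule: sine_poly.induct)
  case (basis k)
  show ?case
  proof (cases "k $ i = 0")
    case True
    then have "(\<lambda>x. cos (pi * x $ i) * sine_basis k x) = sine_basis k"
      by (simp add: sine_basis_eq_0[OF True] fun_eq_iff)
    then show ?thesis by (simp add: sine_poly.basis)
  next
    case False
    define p where "p = (\<chi> j. if j = i then k $ i + 1 else k $ j)"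
    define q where "q = (\<chi> j. if j = i then k $ i - 1 else k $ j)"
    have "sine_poly (\<lambda>x. (1 / 2) * sine_basis p x + (1 / 2) * sine_basis q x)"
      by (intro sine_poly.intros)
    moreover have "(1 / 2) * sine_basis p x + (1 / 2) * sine_basis q x = cos (pi * x $ i) * sine_basis k x" for x
    proof -
      define R where "R = (\<Prod>j\<in>UNIV - {i}. sin (pi * real (k $ j) * x $ j))"
      have b: "sine_basis r x = sin (pi * real (r $ i) * x $ i) * R" if "\<And>j. j \<noteq> i \<Longrightarrow> r $ j = k $ j" for r
        unfolding sine_basis_def R_def using that by (subst prod.remove[of UNIV i]) auto
      have 1: "pi * real (p $ i) * x $ i = pi * real (k $ i) * x $ i + pi * x $ i"
        "pi * real (q $ i) * x $ i = pi * real (k $ i) * x $ i - pi * x $ i"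
        using False
        by (simp_all add: p_def q_def of_nat_diff left_diff_distrib right_diff_distrib distrib_left distrib_right)
      have "sine_basis p x = sin (pi * real (k $ i) * x $ i + pi * x $ i) * R"
        "sine_basis q x = sin (pi * real (k $ i) * x $ i - pi * x $ i) * R"
        "sine_basis k x = sin (pi * real (k $ i) * x $ i) * R"
        using b[of p] b[of q] b[of k] unfolding 1 by (auto simp: p_def q_def)
      moreover have "(1 / 2) * ((A * c + B * s) * R) + (1 / 2) * ((A * c - B * s) * R) = c * (A * R)"
        for A B c s R :: real by (simp add: field_simps)
      ultimately show ?thesis by (simp only: sin_add sin_diff)
    qed
    ultimately show ?thesis by simp
  qed
next
  case (add f g)
  then show ?case using sine_poly.add by (simp add: distrib_left)
next
  case (scale f r)
  then show ?case using sine_poly.scale[of "\<lambda>x. cos (pi * x $ i) * f x" r] by (simp add: mult.left_commute)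
qed

text \<open>
  \<open>cos (\<pi> x\<^sub>i)\<close> times a sine basis function is the mean of the two basis functions with \<open>k $ i\<close> shifted by one,
  so the polynomials in these cosines act on the span.
\<close>

lemma sine_poly_mult_polynomial:
  fixes p :: "real ^ 'n \<Rightarrow> real"
  assumes "real_polynomial_function p" "sine_poly f"
  shows "sine_poly (\<lambda>x. p (\<chi> i. cos (pi * x $ i)) * f x)"
  using assms
proof (induction arbitrary: f rule: real_polynomial_function.induct)
  case (linear p)
  have p: "p y = (\<Sum>i\<in>UNIV. p (axis i 1) * y $ i)" for y :: "real ^ 'n"
  proof -
    interpret bounded_linear p by fact
    have "y = (\<Sum>i\<in>UNIV. y $ i *\<^sub>R axis i 1)"
      using basis_expansion[of y] by (simp add: scalar_mult_eq_scaleR)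
    then have "p y = p (\<Sum>i\<in>UNIV. y $ i *\<^sub>R axis i 1)" by (rule arg_cong)
    then show ?thesis by (simp add: sum scaleR mult.commute)
  qed
  have "(\<lambda>x. p (\<chi> i. cos (pi * x $ i)) * f x)
      = (\<lambda>x. \<Sum>i\<in>UNIV. p (axis i 1) * (cos (pi * x $ i) * f x))"
    by (subst p) (simp add: sum_distrib_right mult.assoc)
  moreover have "sine_poly (\<lambda>x. \<Sum>i\<in>UNIV. p (axis i 1) * (cos (pi * x $ i) * f x))"
    by (intro sine_poly_sum sine_poly.scale sine_poly_mult_cos linear.prems) simp
  ultimately show ?case by simp
next
  case (const c)
  then show ?case by (rule sine_poly.scale)
next
  case (add p q)
  show ?case unfolding distrib_right by (intro sine_poly.add add.IH add.prems)
next
  case (mult p q)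
  then show ?case by (simp add: mult.assoc)
qed

text \<open>
  The sign of \<open>G\<close> is almost everywhere a limit of continuous functions with values in \<open>[-1, 1]\<close>; by dominated
  convergence the integral of \<open>|G|\<close> vanishes.
\<close>

lemma integral_zero_continuous_imp_AE_zero:
  fixes G :: "real ^ 'n \<Rightarrow> real"
  assumes G: "integrable lebesgue G"
    and zero: "\<And>h. continuous_on UNIV h \<Longrightarrow> (\<And>x. \<bar>h x\<bar> \<le> 1) \<Longrightarrow> (\<integral>x. G x * h x \<partial>lebesgue) = 0"
  shows "AE x in lebesgue. G x = 0"
proof -
  have mG: "G \<in> borel_measurable lebesgue" using G by auto
  have "(\<lambda>x. sgn (G x)) \<in> borel_measurable lebesgue"
    using mG by measurable
  then have "(\<lambda>x. sgn (G x)) measurable_on UNIV"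
    by (intro lebesgue_measurable_imp_measurable_on) auto
  then obtain N g where N: "negligible N" and g: "\<And>n. continuous_on UNIV (g n)"
      and lim: "\<And>x. x \<notin> N \<Longrightarrow> (\<lambda>n. g n x) \<longlonglongrightarrow> sgn (G x)"
    unfolding measurable_on_def by (auto simp: if_distrib cong: if_cong)
  \<comment> \<open>Truncation provides the dominating function \<open>|G|\<close>.\<close>
  define c where "c n x = max (- 1) (min 1 (g n x))" for n x
  have c: "continuous_on UNIV (c n)" "\<bar>c n x\<bar> \<le> 1" for n x
    unfolding c_def[abs_def] using g[of n] by (auto intro!: continuous_intros)
  have mc: "c n \<in> borel_measurable lebesgue" for n
    using c(1) by (auto intro!: measurable_completion borel_measurable_continuous_onI)
  have climit: "(\<lambda>n. G x * c n x) \<longlonglongrightarrow> \<bar>G x\<bar>" if "x \<notin> N" for x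
  proof -
    have "(\<lambda>n. c n x) \<longlonglongrightarrow> max (- 1) (min 1 (sgn (G x)))"
      unfolding c_def by (intro tendsto_intros lim that)
    also have "max (- 1) (min 1 (sgn (G x))) = sgn (G x)" by (auto simp: sgn_if)
    finally have "(\<lambda>n. G x * c n x) \<longlonglongrightarrow> G x * sgn (G x)" by (intro tendsto_intros)
    then show ?thesis by (simp add: abs_sgn)
  qed
  have aeN: "AE x in lebesgue. x \<notin> N"
    using N by (simp add: negligible_iff_null_sets AE_not_in)
  have "(\<lambda>n. \<integral>x. G x * c n x \<partial>lebesgue) \<longlonglongrightarrow> (\<integral>x. \<bar>G x\<bar> \<partial>lebesgue)"
  proof (rule integral_dominated_convergence[where w = "\<lambda>x. \<bar>G x\<bar>"])
    show "AE x in lebesgue. (\<lambda>n. G x * c n x) \<longlonglongrightarrow> \<bar>G x\<bar>"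
      using aeN by eventually_elim (rule climit)
    show "AE x in lebesgue. norm (G x * c n x) \<le> \<bar>G x\<bar>" for n
      using c(2) by (intro AE_I2) (simp add: abs_mult mult_left_le)
  qed (use G mG mc in auto)
  moreover have "(\<integral>x. G x * c n x \<partial>lebesgue) = 0" for n by (rule zero[OF c])
  ultimately have "(\<integral>x. \<bar>G x\<bar> \<partial>lebesgue) = 0" by (simp add: LIMSEQ_const_iff)
  then have "AE x in lebesgue. \<bar>G x\<bar> = 0"
    using G by (subst (asm) integral_nonneg_eq_0_iff_AE) auto
  then show ?thesis by simp
qed

text \<open>
  Multiply \<open>D\<close> by the first sine basis function, which is positive on the cube.  By
  \<open>sine_poly_mult_polynomial\<close> the product is orthogonal to all polynomials in the \<open>cos (\<pi> x\<^sub>i)\<close>.  These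
  functions are coordinates on the closed cube, so by the theorem of Stone and Weierstrass the product is orthogonal to all
  bounded continuous functions.
\<close>

lemma sine_series_unique:
  fixes D :: "real ^ 'n \<Rightarrow> real"
  assumes D: "set_integrable lebesgue unit_cube D"
    and zero: "\<And>k. (\<And>i. k $ i > 0) \<Longrightarrow> sine_coeff D k = 0"
  shows "AE x in lebesgue. x \<in> unit_cube \<longrightarrow> D x = 0"
proof -
  define E where "E x = indicator unit_cube x * D x" for x
  have E: "integrable lebesgue E" using D by (simp add: E_def[abs_def] set_integrable_def)
  have mE: "E \<in> borel_measurable lebesgue" using E by auto
  have intE: "integrable lebesgue (\<lambda>x. E x * f x)"
    if "f \<in> borel_measurable borel" "\<And>x. \<bar>f x\<bar> \<le> c" for f c
  proof (rule Bochner_Integration.integrable_bound[of _ "\<lambda>x. c * E x"])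
    show "integrable lebesgue (\<lambda>x. c * E x)" using E by simp
    have "f \<in> borel_measurable lebesgue" using that(1) by (auto intro: measurable_completion)
    then show "(\<lambda>x. E x * f x) \<in> borel_measurable lebesgue" using mE by measurable
    show "AE x in lebesgue. norm (E x * f x) \<le> norm (c * E x)"
      using that(2) by (intro AE_I2)
        (auto simp: abs_mult mult.commute[of "\<bar>E _\<bar>"] intro!: mult_right_mono order_trans[OF that(2)])
  qed
  have orth: "(\<integral>x. E x * sine_basis k x \<partial>lebesgue) = 0" for k
  proof (cases "\<forall>i. k $ i > 0")
    case True
    then show ?thesis
      using zero[of k] by (simp add: sine_coeff_def set_lebesgue_integral_def E_def mult.assoc)
  next
    case False
    then obtain i where "k $ i = 0" by auto
    then show ?thesis by (simp add: sine_basis_eq_0)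
  qed
  have poly: "(\<exists>c. \<forall>x. \<bar>f x\<bar> \<le> c) \<and> f \<in> borel_measurable borel \<and> (\<integral>x. E x * f x \<partial>lebesgue) = 0"
    if "sine_poly f" for f
    using that
  proof (induction rule: sine_poly.induct)
    case (basis k)
    then show ?case using abs_sine_basis_le_1[of k] orth[of k] by auto
  next
    case (add f g)
    then obtain c d where cd: "\<And>x. \<bar>f x\<bar> \<le> c" "\<And>x. \<bar>g x\<bar> \<le> d" by blast
    have "\<bar>f x + g x\<bar> \<le> c + d" for x using cd[of x] by linarith
    moreover have "(\<integral>x. E x * (f x + g x) \<partial>lebesgue) = 0"
      unfolding distrib_left using add.IH intE[OF _ cd(1)] intE[OF _ cd(2)]
      by (subst Bochner_Integration.integral_add) auto
    ultimately show ?case using add.IH by auto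
  next
    case (scale f r)
    then obtain c where c: "\<And>x. \<bar>f x\<bar> \<le> c" by blast
    have "\<bar>r * f x\<bar> \<le> \<bar>r\<bar> * c" for x unfolding abs_mult using c by (intro mult_left_mono) auto
    moreover have "(\<integral>x. E x * (r * f x) \<partial>lebesgue) = 0"
      using scale.IH by (simp add: mult.left_commute)
    ultimately show ?case using scale.IH by auto
  qed
  define \<Phi> where "\<Phi> = (sine_basis (\<chi> i. 1) :: real ^ 'n \<Rightarrow> real)"
  define G where "G x = E x * \<Phi> x" for x
  have G: "integrable lebesgue G"
    unfolding G_def[abs_def] \<Phi>_def by (rule intE[OF measurable_sine_basis abs_sine_basis_le_1])
  have mG: "G \<in> borel_measurable lebesgue" using G by auto
  have "(\<integral>x. G x * h x \<partial>lebesgue) = 0" if h: "continuous_on UNIV h" "\<And>x. \<bar>h x\<bar> \<le> 1" for h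
  proof -
    define I where "I = (\<integral>x. \<bar>G x\<bar> \<partial>lebesgue)"
    \<comment> \<open>\<open>F\<close> is \<open>h\<close> in the coordinates \<open>y\<^sub>i = cos (\<pi> x\<^sub>i)\<close>.\<close>
    define F where "F y = h (\<chi> i. arccos (y $ i) / pi)" for y :: "real ^ 'n"
    have mh: "h \<in> borel_measurable lebesgue"
      using h(1) by (auto intro!: measurable_completion borel_measurable_continuous_onI)
    have iGh: "integrable lebesgue (\<lambda>x. G x * h x)"
      by (rule Bochner_Integration.integrable_bound[OF G])
        (use mh mG h(2) in \<open>auto intro!: AE_I2 simp: abs_mult mult_left_le\<close>)
    have contF: "continuous_on (cbox (- 1) 1) F"
      unfolding F_def
    proof (rule continuous_on_compose2[OF h(1)])
      show "continuous_on (cbox (- 1) 1) (\<lambda>y::real^'n. \<chi> i. arccos (y $ i) / pi)"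
        by (intro continuous_intros) (auto simp: mem_box_cart)
    qed auto
    have "\<bar>\<integral>x. G x * h x \<partial>lebesgue\<bar> \<le> e" if e: "e > 0" for e
    proof -
      have I0: "0 \<le> I" by (simp add: I_def)
      define d where "d = e / (I + 1)"
      have d: "d > 0" using e I0 by (simp add: d_def)
      obtain p where p: "real_polynomial_function p" "\<And>y. y \<in> cbox (- 1) 1 \<Longrightarrow> \<bar>F y - p y\<bar> < d"
        using Stone_Weierstrass_real_polynomial_function[OF compact_cbox contF d] by blast
      define q where "q x = p (\<chi> i. cos (pi * x $ i))" for x :: "real ^ 'n"
      have "sine_poly (\<lambda>x. q x * \<Phi> x)"
        unfolding q_def \<Phi>_def by (intro sine_poly_mult_polynomial p sine_poly.basis)
      from poly[OF this] obtain c where c: "\<And>x. \<bar>q x * \<Phi> x\<bar> \<le> c" "(\<lambda>x. q x * \<Phi> x) \<in> borel_measurable borel"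
        "(\<integral>x. E x * (q x * \<Phi> x) \<partial>lebesgue) = 0" by blast
      have Gq: "G x * q x = E x * (q x * \<Phi> x)" for x by (simp add: G_def)
      have iGq: "integrable lebesgue (\<lambda>x. G x * q x)" unfolding Gq by (rule intE[OF c(2,1)])
      have "(\<integral>x. G x * h x \<partial>lebesgue) = (\<integral>x. G x * h x - G x * q x \<partial>lebesgue)"
        using Bochner_Integration.integral_diff[OF iGh iGq] c(3) by (simp add: Gq)
      also have "\<bar>\<dots>\<bar> \<le> (\<integral>x. \<bar>G x * h x - G x * q x\<bar> \<partial>lebesgue)"
        by (rule integral_abs_bound)
      also have "\<dots> \<le> (\<integral>x. d * \<bar>G x\<bar> \<partial>lebesgue)"
      proof (rule integral_mono)
        fix x :: "real ^ 'n"
        show "\<bar>G x * h x - G x * q x\<bar> \<le> d * \<bar>G x\<bar>"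
        proof (cases "x \<in> unit_cube")
          case True
          then have x: "0 < x $ i" "x $ i < 1" for i by (auto simp: unit_cube_def mem_box_cart)
          have "arccos (cos (pi * x $ i)) = pi * x $ i" for i
            using x[of i] by (intro arccos_cos) (auto simp: mult_left_le)
          then have "F (\<chi> i. cos (pi * x $ i)) = h x" by (simp add: F_def)
          moreover have "(\<chi> i. cos (pi * x $ i)) \<in> cbox (- 1) 1" by (simp add: mem_box_cart)
          ultimately have "\<bar>h x - q x\<bar> \<le> d" using p(2)[of "\<chi> i. cos (pi * x $ i)"] by (simp add: q_def)
          then have "\<bar>G x\<bar> * \<bar>h x - q x\<bar> \<le> \<bar>G x\<bar> * d" by (intro mult_left_mono) auto
          then show ?thesis by (simp add: abs_mult mult.commute flip: right_diff_distrib)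
        next
          case False
          then show ?thesis by (simp add: G_def E_def)
        qed
      qed (use iGh iGq G in auto)
      also have "\<dots> = d * I" by (simp add: I_def)
      also have "\<dots> \<le> e" using e I0 by (simp add: d_def field_simps)
      finally show ?thesis .
    qed
    then show ?thesis using dense_ge[of 0 "\<bar>\<integral>x. G x * h x \<partial>lebesgue\<bar>"] by auto
  qed
  from integral_zero_continuous_imp_AE_zero[OF G this] have "AE x in lebesgue. G x = 0" .
  then show ?thesis
  proof eventually_elim
    case (elim x)
    show ?case
    proof
      assume "x \<in> unit_cube"
      then have "\<Phi> x > 0" unfolding \<Phi>_def sine_basis_def
        by (intro prod_pos) (auto simp: unit_cube_def mem_box_cart intro!: sin_gt_zero)
      then show "D x = 0" using elim \<open>x \<in> unit_cube\<close> by (simp add: G_def E_def)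
    qed
  qed
qed

definition sine_basis_deriv :: "nat ^ 'n \<Rightarrow> real ^ 'n \<Rightarrow> real ^ 'n \<Rightarrow> real" where
  "sine_basis_deriv k x v = (\<Sum>i\<in>UNIV. cos (pi * real (k $ i) * x $ i) * (pi * real (k $ i) * v $ i) *
     (\<Prod>j\<in>UNIV - {i}. sin (pi * real (k $ j) * x $ j)))"

lemma sine_basis_has_derivative:
  "(sine_basis k has_derivative sine_basis_deriv k x) (at x)"
  unfolding sine_basis_def[abs_def] sine_basis_deriv_def[abs_def]
  by (rule has_derivative_prod)
    (auto intro!: derivative_eq_intros bounded_linear.has_derivative[OF bounded_linear_vec_nth])

lemma sine_basis_deriv_bound: "\<bar>sine_basis_deriv k x v\<bar> \<le> pi * sine_freq k * norm v"
proof -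
  have "\<bar>sine_basis_deriv k x v\<bar> \<le> (\<Sum>i\<in>UNIV. pi * real (k $ i) * norm v)"
    unfolding sine_basis_deriv_def
  proof (rule order_trans[OF sum_abs], rule sum_mono)
    fix i
    have P: "\<bar>\<Prod>j\<in>UNIV - {i}. sin (pi * real (k $ j) * x $ j)\<bar> \<le> 1"
      unfolding abs_prod by (intro prod_le_1) auto
    have A: "pi * real (k $ i) * \<bar>v $ i\<bar> \<le> pi * real (k $ i) * norm v"
      by (intro mult_left_mono component_le_norm_cart) auto
    have "\<bar>cos (pi * real (k $ i) * x $ i)\<bar> * (pi * real (k $ i) * \<bar>v $ i\<bar>) *
       \<bar>\<Prod>j\<in>UNIV - {i}. sin (pi * real (k $ j) * x $ j)\<bar> \<le> 1 * (pi * real (k $ i) * norm v) * 1"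
      by (rule mult_mono[OF mult_mono[OF abs_cos_le_one A] P]) auto
    then show "\<bar>cos (pi * real (k $ i) * x $ i) * (pi * real (k $ i) * v $ i) *
     (\<Prod>j\<in>UNIV - {i}. sin (pi * real (k $ j) * x $ j))\<bar> \<le> pi * real (k $ i) * norm v"
      by (simp add: abs_mult)
  qed
  also have "\<dots> = pi * sine_freq k * norm v"
    by (simp add: sine_freq_eq sum_distrib_left sum_distrib_right)
  finally show ?thesis .
qed

lemma suminf_tail_eventually:
  fixes a :: "nat \<Rightarrow> real"
  assumes "summable a" "e > 0"
  shows "\<forall>\<^sub>F n in sequentially. (\<Sum>i. a (i + n)) < e"
  using suminf_exist_split2[OF assms(1)] assms(2) by (auto dest: order_tendstoD(2))

text \<open>
  The derivative of a basis function has norm at most \<open>\<pi> |k|\<^sub>1\<close>, so the series may be differentiated term by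
  term.
\<close>

lemma sine_series_C1:
  fixes c :: "nat \<Rightarrow> real" and k :: "nat \<Rightarrow> nat ^ 'n"
  assumes sum: "summable (\<lambda>n. \<bar>c n\<bar> * (1 + pi * sine_freq (k n)))"
  obtains U where "\<And>x. (\<lambda>n. c n * sine_basis (k n) x) sums U x"
    and "\<And>x. C1_le (\<Sum>n. \<bar>c n\<bar> * (1 + pi * sine_freq (k n))) U x"
proof -
  define a where "a n = \<bar>c n\<bar> * (1 + pi * sine_freq (k n))" for n
  have a: "summable a" "\<And>n. 0 \<le> a n"
    using sum by (auto simp: a_def[abs_def] sine_freq_nonneg)
  define g where "g n x v = c n * sine_basis_deriv (k n) x v" for n x v
  have gb: "\<bar>g n x v\<bar> \<le> a n * norm v" for n x v
  proof -
    have "\<bar>g n x v\<bar> \<le> \<bar>c n\<bar> * (pi * sine_freq (k n) * norm v)"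
      unfolding g_def abs_mult by (intro mult_left_mono sine_basis_deriv_bound) auto
    also have "\<dots> \<le> a n * norm v"
      by (simp add: a_def algebra_simps)
    finally show ?thesis .
  qed
  have fb: "\<bar>c n * sine_basis (k n) x\<bar> \<le> a n" for n x
  proof -
    have "\<bar>c n * sine_basis (k n) x\<bar> \<le> \<bar>c n\<bar> * (1 + pi * sine_freq (k n))"
      unfolding abs_mult using abs_sine_basis_le_1[of "k n" x] sine_freq_nonneg[of "k n"]
      by (intro mult_left_mono) (auto intro: order_trans)
    then show ?thesis by (simp add: a_def)
  qed
  have sf: "summable (\<lambda>n. c n * sine_basis (k n) x)" for x
    by (rule summable_comparison_test'[OF a(1), of 0]) (use fb in auto)
  have sa: "summable (\<lambda>n. a n * norm v)" for v :: "real ^ 'n" using a(1) by (rule summable_mult2)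
  have sg: "summable (\<lambda>n. g n x v)" for x v
    by (rule summable_comparison_test'[OF sa[of v], of 0]) (use gb in auto)
  define U where "U x = (\<Sum>n. c n * sine_basis (k n) x)" for x
  have tail: "norm ((\<Sum>i<n. g i x v) - (\<Sum>i. g i x v)) \<le> (\<Sum>i. a (i + n)) * norm v" for n x v
  proof -
    have "(\<Sum>i. g i x v) = (\<Sum>i. g (i + n) x v) + (\<Sum>i<n. g i x v)"
      by (rule suminf_split_initial_segment[OF sg])
    then have "norm ((\<Sum>i<n. g i x v) - (\<Sum>i. g i x v)) = norm (\<Sum>i. g (i + n) x v)" by simp
    also have "\<dots> \<le> (\<Sum>i. a (i + n) * norm v)"
      by (rule norm_suminf_le) (use gb sa[of v] in \<open>auto intro: summable_ignore_initial_segment\<close>)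
    also have "\<dots> = (\<Sum>i. a (i + n)) * norm v"
      using a(1) by (intro suminf_mult2[symmetric] summable_ignore_initial_segment)
    finally show ?thesis .
  qed
  have "\<exists>V. \<forall>x\<in>UNIV. (\<lambda>n. c n * sine_basis (k n) x) sums V x \<and> (V has_derivative (\<lambda>v. \<Sum>n. g n x v)) (at x within UNIV)"
  proof (rule has_derivative_series[where f' = g])
    show "((\<lambda>x. c n * sine_basis (k n) x) has_derivative g n x) (at x within UNIV)" for n x
      unfolding g_def by (intro has_derivative_mult_right sine_basis_has_derivative)
    show "\<forall>\<^sub>F n in sequentially. \<forall>x\<in>UNIV. \<forall>h. norm ((\<Sum>i<n. g i x h) - (\<Sum>n. g n x h)) \<le> e * norm h"
      if "e > 0" for e
      using suminf_tail_eventually[OF a(1) that]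
    proof eventually_elim
      case (elim n)
      then show ?case using tail[where n = n] by (meson less_imp_le mult_right_mono norm_ge_zero order_trans)
    qed
    show "(\<lambda>n. c n * sine_basis (k n) 0) sums U 0" unfolding U_def by (rule summable_sums[OF sf])
  qed auto
  then obtain V where V: "\<And>x. (\<lambda>n. c n * sine_basis (k n) x) sums V x"
    "\<And>x. (V has_derivative (\<lambda>v. \<Sum>n. g n x v)) (at x)" by auto
  have "C1_le (\<Sum>n. a n) V x" for x
    unfolding C1_le_def
  proof (intro conjI exI allI)
    show "(V has_derivative (\<lambda>v. \<Sum>n. g n x v)) (at x)" by (rule V)
    have "V x = (\<Sum>n. c n * sine_basis (k n) x)" using V(1) by (simp add: sums_iff)
    then show "\<bar>V x\<bar> \<le> (\<Sum>n. a n)"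
      using norm_suminf_le[OF _ a(1), of "\<lambda>n. c n * sine_basis (k n) x"] fb by auto
    show "\<bar>\<Sum>n. g n x v\<bar> \<le> (\<Sum>n. a n) * norm v" for v
      using tail[where n = 0 and x = x and v = v] by simp
  qed
  then show ?thesis using that[OF V(1)] by (simp add: a_def)
qed

lemma sum_le_infsum_ennreal:
  fixes f :: "'a \<Rightarrow> real"
  assumes "finite F" "F \<subseteq> A" "\<And>x. x \<in> A \<Longrightarrow> 0 \<le> f x"
    and fin: "(\<Sum>\<^sub>\<infinity>x\<in>A. ennreal (f x)) < \<infinity>"
  shows "(\<Sum>x\<in>F. f x) \<le> enn2real (\<Sum>\<^sub>\<infinity>x\<in>A. ennreal (f x))"
proof -
  have "ennreal (\<Sum>x\<in>F. f x) = (\<Sum>x\<in>F. ennreal (f x))"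
    using assms by (subst sum_ennreal) auto
  also have "\<dots> = (\<Sum>\<^sub>\<infinity>x\<in>F. ennreal (f x))" using assms by (simp add: infsum_finite)
  also have "\<dots> \<le> (\<Sum>\<^sub>\<infinity>x\<in>A. ennreal (f x))"
    using assms by (intro infsum_mono_neutral) (auto intro: nonneg_summable_on_complete)
  finally have le: "ennreal (\<Sum>x\<in>F. f x) \<le> (\<Sum>\<^sub>\<infinity>x\<in>A. ennreal (f x))" .
  have "enn2real (ennreal (\<Sum>x\<in>F. f x)) \<le> enn2real (\<Sum>\<^sub>\<infinity>x\<in>A. ennreal (f x))"
    using le fin by (intro enn2real_mono) auto
  then show ?thesis using assms by (simp add: sum_nonneg subset_iff)
qed

text \<open>
  Since \<open>\<pi> |k|\<^sub>1 \<ge> 1\<close> and \<open>s \<ge> 3\<close>, the Barron norm dominates the sum with exponent 3.  The sine series therefore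
  converges uniformly; by orthogonality its sum has the same coefficients as \<open>u\<close>, and by
  \<open>sine_series_unique\<close> it equals \<open>u\<close> almost everywhere.  The multi-indices are enumerated by \<open>\<kappa>\<close> so that
  the theory of series indexed by natural numbers applies.
\<close>

lemma barron_sine_expansion:
  fixes u :: "real ^ 'n \<Rightarrow> real"
  assumes u: "u \<in> barron_space s" and s: "s \<ge> 3"
  obtains \<kappa> :: "nat \<Rightarrow> nat ^ 'n"
  where "\<And>n i. \<kappa> n $ i > 0"
    and "summable (\<lambda>n. \<bar>sine_coeff u (\<kappa> n)\<bar> * (1 + (pi * sine_freq (\<kappa> n)) ^ 3))"
    and "(\<Sum>n. \<bar>sine_coeff u (\<kappa> n)\<bar> * (1 + (pi * sine_freq (\<kappa> n)) ^ 3)) \<le> enn2real (barron_norm s u)"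
    and "AE x in lebesgue. x \<in> unit_cube \<longrightarrow> (\<lambda>n. sine_coeff u (\<kappa> n) * sine_basis (\<kappa> n) x) sums u x"
proof -
  define A where "A = {k :: nat ^ 'n. \<forall>i. k $ i > 0}"
  have "infinite A"
  proof
    assume "finite A"
    moreover have "range (\<lambda>n. \<chi> i. Suc n) \<subseteq> A" by (auto simp: A_def)
    ultimately have "finite (range (\<lambda>n. \<chi> i::'n. Suc n))" by (rule finite_subset[rotated])
    then show False by (simp add: finite_image_iff inj_on_def vec_eq_iff)
  qed
  then have bij: "bij_betw (from_nat_into A) UNIV A" by (intro bij_betw_from_nat_into) auto
  define \<kappa> where "\<kappa> = from_nat_into A"
  have \<kappa>A: "\<kappa> n \<in> A" for n using bij by (auto simp: \<kappa>_def bij_betw_def)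
  have inj\<kappa>: "inj \<kappa>" using bij by (auto simp: \<kappa>_def bij_betw_def)
  have pos: "\<kappa> n $ i > 0" for n i using \<kappa>A[of n] by (simp add: A_def)
  define c where "c n = sine_coeff u (\<kappa> n)" for n
  define K where "K n = pi * sine_freq (\<kappa> n)" for n
  have K1: "1 \<le> K n" for n
    unfolding K_def by (rule one_le_pi_sine_freq[OF pos])
  define f where "f k = (1 + pi powr s * l1_norm (\<chi> i. real (k $ i)) powr s) * \<bar>sine_coeff u k\<bar>" for k :: "nat ^ 'n"
  have fin: "(\<Sum>\<^sub>\<infinity>k\<in>A. ennreal (f k)) < \<infinity>"
    and norm: "barron_norm s u = (\<Sum>\<^sub>\<infinity>k\<in>A. ennreal (f k))"
    using u by (auto simp: barron_space_def barron_norm_def A_def f_def)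
  have f0: "0 \<le> f k" for k by (simp add: f_def)
  define b where "b n = \<bar>c n\<bar> * (1 + K n ^ 3)" for n
  have b0: "0 \<le> b n" for n using K1[of n] by (simp add: b_def)
  have bf: "b n \<le> f (\<kappa> n)" for n
  proof -
    have "K n ^ 3 = K n powr 3" using K1[of n] by simp
    also have "\<dots> \<le> K n powr s" using K1[of n] s by (intro powr_mono) auto
    also have "\<dots> = pi powr s * l1_norm (\<chi> i. real (\<kappa> n $ i)) powr s"
      unfolding K_def sine_freq_def by (simp add: powr_mult l1_norm_nonneg)
    finally show ?thesis unfolding b_def f_def c_def by (simp add: mult.commute mult_left_mono)
  qed
  have partial: "(\<Sum>n<N. b n) \<le> enn2real (barron_norm s u)" for N
  proof -
    have "(\<Sum>n<N. b n) \<le> (\<Sum>n<N. f (\<kappa> n))" by (intro sum_mono bf)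
    also have "\<dots> = (\<Sum>k\<in>\<kappa> ` {..<N}. f k)"
      using inj\<kappa> by (subst sum.reindex) (auto intro: inj_on_subset)
    also have "\<dots> \<le> enn2real (barron_norm s u)"
      unfolding norm by (rule sum_le_infsum_ennreal) (use \<kappa>A f0 fin in auto)
    finally show ?thesis .
  qed
  have sb: "summable b" using b0 partial by (rule summableI_nonneg_bounded)
  have sumb: "(\<Sum>n. b n) \<le> enn2real (barron_norm s u)" using sb partial by (rule suminf_le_const)
  have sc: "summable (\<lambda>n. \<bar>c n\<bar> * (1 + pi * sine_freq (\<kappa> n)))"
  proof (rule summable_comparison_test'[OF sb, of 0])
    fix n
    have "K n \<le> K n ^ 3" using K1[of n] by (intro self_le_power) auto
    then show "norm (\<bar>c n\<bar> * (1 + pi * sine_freq (\<kappa> n))) \<le> b n"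
      using K1[of n] unfolding b_def K_def[symmetric] by (simp add: abs_mult mult_left_mono)
  qed
  obtain U where U: "\<And>x. (\<lambda>n. c n * sine_basis (\<kappa> n) x) sums U x"
    and U1: "\<And>x. C1_le (\<Sum>n. \<bar>c n\<bar> * (1 + pi * sine_freq (\<kappa> n))) U x"
    using sine_series_C1[OF sc] by blast
  have contU: "continuous_on UNIV U"
  proof (rule continuous_at_imp_continuous_on, rule ballI)
    fix x
    obtain U' where "(U has_derivative U') (at x)" using U1[of x] unfolding C1_le_def by blast
    then show "isCont U x" by (rule has_derivative_continuous)
  qed
  have mU: "U \<in> borel_measurable lebesgue"
    using contU by (auto intro!: measurable_completion borel_measurable_continuous_onI)
  have cube: "unit_cube \<in> sets (lebesgue :: (real ^ 'n) measure)"
    "emeasure lebesgue (unit_cube :: (real ^ 'n) set) < \<infinity>"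
    using emeasure_lborel_box_finite[of "0 :: real ^ 'n" 1] by (auto simp: unit_cube_def)
  have ic: "integrable lebesgue (\<lambda>x. C * indicator (unit_cube :: (real ^ 'n) set) x :: real)" for C
    using cube by (intro integrable_mult_right integrable_real_indicator) auto
  have ib: "set_integrable lebesgue unit_cube q"
    if "q \<in> borel_measurable lebesgue" "\<And>x. \<bar>q x\<bar> \<le> C" for q :: "real ^ 'n \<Rightarrow> real" and C
    unfolding set_integrable_def
  proof (rule Bochner_Integration.integrable_bound[OF ic])
    show "(\<lambda>x. indicator unit_cube x *\<^sub>R q x) \<in> borel_measurable lebesgue"
      using that(1) cube by measurable
    have "0 \<le> C" using that(2)[of 0] by linarith
    then show "AE x in lebesgue. norm (indicator unit_cube x *\<^sub>R q x) \<le> norm (C * indicator unit_cube x :: real)"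
      using that(2) by (auto simp: indicator_def)
  qed
  have iU: "set_integrable lebesgue unit_cube U"
    by (rule ib[OF mU, of "\<Sum>n. \<bar>c n\<bar> * (1 + pi * sine_freq (\<kappa> n))"]) (use U1 in \<open>auto simp: C1_le_def\<close>)
  have iu: "set_integrable lebesgue unit_cube u" using u by (simp add: barron_space_def)
  have mS: "sine_basis l \<in> borel_measurable lebesgue" for l :: "nat ^ 'n"
    by (rule measurable_completion) simp
  have mult_int: "set_integrable lebesgue unit_cube (\<lambda>x. q x * sine_basis l x)"
    if "set_integrable lebesgue unit_cube q" for q and l :: "nat ^ 'n"
    unfolding set_integrable_def
  proof (rule Bochner_Integration.integrable_bound[OF that[unfolded set_integrable_def]])
    have "(\<lambda>x. indicator unit_cube x *\<^sub>R q x) \<in> borel_measurable lebesgue"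
      using that unfolding set_integrable_def by auto
    then have "(\<lambda>x. (indicator unit_cube x *\<^sub>R q x) * sine_basis l x) \<in> borel_measurable lebesgue"
      using mS[of l] by measurable
    then show "(\<lambda>x. indicator unit_cube x *\<^sub>R (q x * sine_basis l x)) \<in> borel_measurable lebesgue"
      by (simp add: mult.assoc)
    show "AE x in lebesgue. norm (indicator unit_cube x *\<^sub>R (q x * sine_basis l x)) \<le> norm (indicator unit_cube x *\<^sub>R q x)"
      using abs_sine_basis_le_1[of l] by (intro AE_I2) (auto simp: abs_mult mult_left_le indicator_def)
  qed
  have coeffU: "sine_coeff U l = sine_coeff u l" if l: "\<And>i. l $ i > 0" for l
  proof -
    \<comment> \<open>Integrating the series term by term against \<open>sine_basis l\<close>, only the term \<open>m\<close> with \<open>\<kappa> m = l\<close> survives.\<close>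
    have "range \<kappa> = A" using bij by (simp add: \<kappa>_def bij_betw_def)
    moreover have "l \<in> A" using l by (simp add: A_def)
    ultimately obtain m where m: "\<kappa> m = l" by (auto simp: image_iff)
    define h where "h n x = indicator unit_cube x *\<^sub>R ((c n * sine_basis (\<kappa> n) x) * sine_basis l x)" for n x
    have hb: "norm (h n x) \<le> \<bar>c n\<bar> * indicator unit_cube x" for n x
      using mult_mono[OF abs_sine_basis_le_1[of "\<kappa> n" x] abs_sine_basis_le_1[of l x]]
      by (auto simp: h_def indicator_def abs_mult mult.assoc intro!: mult_left_le)
    have ih: "integrable lebesgue (h n)" for n
    proof -
      have "set_integrable lebesgue unit_cube (\<lambda>x. c n * sine_basis (\<kappa> n) x)"
        by (rule ib[where C = "\<bar>c n\<bar>"])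
          (use mS[of "\<kappa> n"] abs_sine_basis_le_1[of "\<kappa> n"] in \<open>auto simp: abs_mult mult_left_le\<close>)
      from mult_int[OF this] show ?thesis by (simp add: h_def[abs_def] set_integrable_def)
    qed
    have sabs: "summable (\<lambda>n. \<bar>c n\<bar>)"
      by (rule summable_comparison_test'[OF sc, of 0]) (auto simp: distrib_left sine_freq_nonneg)
    have "(\<lambda>n. \<integral>x. h n x \<partial>lebesgue) sums (\<integral>x. (\<Sum>n. h n x) \<partial>lebesgue)"
    proof (rule sums_integral[OF ih])
      show "AE x in lebesgue. summable (\<lambda>n. norm (h n x))"
      proof (rule AE_I2)
        fix x
        show "summable (\<lambda>n. norm (h n x))"
        proof (rule summable_comparison_test'[OF sabs, of 0])
          fix n
          show "norm (norm (h n x)) \<le> \<bar>c n\<bar>"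
            using hb[of n x] by (cases "x \<in> unit_cube") auto
        qed
      qed
      show "summable (\<lambda>n. \<integral>x. norm (h n x) \<partial>lebesgue)"
      proof (rule summable_comparison_test'[OF summable_mult2[OF sabs, of "measure lebesgue (unit_cube :: (real^'n) set)"], of 0])
        fix n
        have "(\<integral>x. norm (h n x) \<partial>lebesgue) \<le> (\<integral>x. \<bar>c n\<bar> * indicator (unit_cube :: (real^'n) set) x \<partial>lebesgue)"
          by (intro integral_mono integrable_norm ih ic hb)
        also have "\<dots> = \<bar>c n\<bar> * measure lebesgue (unit_cube :: (real^'n) set)" using cube by simp
        finally show "norm (\<integral>x. norm (h n x) \<partial>lebesgue) \<le> \<bar>c n\<bar> * measure lebesgue (unit_cube :: (real^'n) set)"
          by simp
      qed
    qed
    moreover have "(\<Sum>n. h n x) = indicator unit_cube x *\<^sub>R (U x * sine_basis l x)" for x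
    proof -
      have "(\<lambda>n. indicator unit_cube x * ((c n * sine_basis (\<kappa> n) x) * sine_basis l x)) sums
        (indicator unit_cube x * (U x * sine_basis l x))"
        by (intro sums_mult sums_mult2 U)
      then show ?thesis by (simp add: h_def sums_iff)
    qed
    ultimately have 1: "(\<lambda>n. 2 ^ CARD('n) * (\<integral>x. h n x \<partial>lebesgue)) sums sine_coeff U l"
      unfolding sine_coeff_def set_lebesgue_integral_def by (intro sums_mult) simp
    have "2 ^ CARD('n) * (\<integral>x. h n x \<partial>lebesgue) = (if n = m then c m else 0)" for n
    proof -
      have "2 ^ CARD('n) * (\<integral>x. h n x \<partial>lebesgue) = c n * sine_coeff (sine_basis (\<kappa> n)) l"
        unfolding sine_coeff_def set_lebesgue_integral_def h_def
        by (simp add: mult.assoc mult.left_commute[of _ "c n"])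
      also have "\<dots> = (if n = m then c m else 0)"
        using sine_basis_orthogonal[of "\<kappa> n" l] pos l m inj\<kappa> by (auto dest: injD)
      finally show ?thesis .
    qed
    with 1 have "(\<lambda>n. if n = m then c m else 0) sums sine_coeff U l" by simp
    moreover have "(\<lambda>n. if n = m then c m else 0) sums c m" by (rule sums_single)
    ultimately have "sine_coeff U l = c m" by (rule sums_unique2)
    then show ?thesis by (simp add: c_def m)
  qed
  have "AE x in lebesgue. x \<in> unit_cube \<longrightarrow> u x - U x = 0"
  proof (rule sine_series_unique)
    show "set_integrable lebesgue unit_cube (\<lambda>x. u x - U x)" by (rule set_integral_diff(1)[OF iu iU])
    fix l :: "nat ^ 'n" assume l: "\<And>i. l $ i > 0"
    have "sine_coeff (\<lambda>x. u x - U x) l = sine_coeff u l - sine_coeff U l"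
      unfolding sine_coeff_def left_diff_distrib
      by (subst set_integral_diff(2)[OF mult_int[OF iu] mult_int[OF iU]]) (simp add: right_diff_distrib)
    then show "sine_coeff (\<lambda>x. u x - U x) l = 0" using coeffU[OF l] by simp
  qed
  then have "AE x in lebesgue. x \<in> unit_cube \<longrightarrow> (\<lambda>n. c n * sine_basis (\<kappa> n) x) sums u x"
    by eventually_elim (use U in auto)
  then show ?thesis using that[of \<kappa>] pos sb sumb by (simp add: b_def[abs_def] c_def K_def)
qed

section \<open>The approximation theorem\<close>

definition grad :: "(real ^ 'n \<Rightarrow> real) \<Rightarrow> real ^ 'n \<Rightarrow> real ^ 'n" where
  "grad f x = (\<chi> i. partial_deriv i f x)"

lemma has_derivative_grad:
  assumes "(f has_derivative f') (at x)"
  shows "(f has_derivative (\<lambda>v. grad f x \<bullet> v)) (at x)" and "f' v = grad f x \<bullet> v"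
proof -
  have f': "frechet_derivative f (at x) = f'" using assms by (rule frechet_derivative_at[symmetric])
  interpret bounded_linear f' using assms by (rule has_derivative_bounded_linear)
  have eq: "f' v = grad f x \<bullet> v" for v
  proof -
    have "v = (\<Sum>i\<in>UNIV. v $ i *\<^sub>R axis i 1)"
      using basis_expansion[of v] by (simp add: scalar_mult_eq_scaleR)
    then have "f' v = f' (\<Sum>i\<in>UNIV. v $ i *\<^sub>R axis i 1)" by (rule arg_cong)
    also have "\<dots> = (\<Sum>i\<in>UNIV. v $ i * f' (axis i 1))" by (simp add: sum scaleR)
    finally show ?thesis by (simp add: grad_def partial_deriv_def f' inner_vec_def mult.commute)
  qed
  then show "f' v = grad f x \<bullet> v" .
  show "(f has_derivative (\<lambda>v. grad f x \<bullet> v)) (at x)" using assms eq by (metis (no_types, lifting) ext)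
qed

lemma C1_le_grad:
  assumes "C1_le \<eta> f x"
  shows "(f has_derivative (\<lambda>v. grad f x \<bullet> v)) (at x)" and "norm (grad f x) \<le> \<eta>"
proof -
  obtain f' where f': "(f has_derivative f') (at x)" "\<And>v. \<bar>f' v\<bar> \<le> \<eta> * norm v"
    and "\<bar>f x\<bar> \<le> \<eta>" using assms unfolding C1_le_def by blast
  then have \<eta>: "0 \<le> \<eta>" by linarith
  show "(f has_derivative (\<lambda>v. grad f x \<bullet> v)) (at x)" by (rule has_derivative_grad[OF f'(1)])
  have "norm (grad f x) * norm (grad f x) = \<bar>f' (grad f x)\<bar>"
    using has_derivative_grad(2)[OF f'(1), of "grad f x"]
    by (simp add: power2_norm_eq_inner[symmetric] power2_eq_square)
  also have "\<dots> \<le> \<eta> * norm (grad f x)" by (rule f'(2))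
  finally show "norm (grad f x) \<le> \<eta>"
    using \<eta> by (cases "grad f x = 0") auto
qed

abbreviation cube_measure :: "(real ^ 'n) measure" where
  "cube_measure \<equiv> restrict_space lebesgue unit_cube"

lemma unit_cube_lebesgue [simp]: "unit_cube \<in> sets lebesgue"
  by (simp add: unit_cube_def)

lemma space_cube_measure [simp]: "space cube_measure = unit_cube"
  by (simp add: space_restrict_space)

lemma emeasure_unit_cube: "emeasure lebesgue (unit_cube :: (real ^ 'n) set) = 1"
proof -
  have "(1 :: real ^ 'n) \<bullet> b = 1" if "b \<in> Basis" for b
    using that by (auto simp: Basis_vec_def inner_axis)
  then show ?thesis
    by (simp add: unit_cube_def emeasure_lborel_box_eq)
qed

lemma measure_cube_measure: "measure cube_measure (unit_cube :: (real ^ 'n) set) = 1"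
  by (simp add: measure_def emeasure_restrict_space emeasure_unit_cube)

lemma finite_cube_measure: "finite_measure (cube_measure :: (real ^ 'n) measure)"
  by (rule finite_measureI) (simp add: emeasure_restrict_space emeasure_unit_cube)

lemma set_integral_cube:
  fixes f :: "real ^ 'n \<Rightarrow> real"
  shows "(LINT x:unit_cube|lebesgue. f x) = (\<integral>x. f x \<partial>cube_measure)"
  by (simp add: set_lebesgue_integral_def integral_restrict_space)

lemma cube_measurableI:
  fixes f :: "real ^ 'n \<Rightarrow> 'b::real_normed_vector"
  assumes "(\<lambda>x. indicator unit_cube x *\<^sub>R f x) \<in> borel_measurable borel"
  shows "f \<in> borel_measurable cube_measure"
  using assms
  by (subst borel_measurable_restrict_space_iff) (auto intro!: measurable_completion)

lemma open_unit_cube: "open unit_cube" and bounded_unit_cube: "bounded unit_cube"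
  by (auto simp: unit_cube_def)

lemma gradient_cube_measurable:
  assumes "\<And>x. x \<in> unit_cube \<Longrightarrow> (F has_derivative (\<lambda>v. g x \<bullet> v)) (at x)"
  shows "F \<in> borel_measurable cube_measure" "g \<in> borel_measurable cube_measure"
  using gradient_measurable[OF open_unit_cube assms] by (auto intro: cube_measurableI)

text \<open>
  Maurey's argument applied to the fields \<open>(cutoff f, \<nabla> (cutoff f))\<close>, where \<open>f\<close> ranges over the neurons of a given
  network.  Such a field has norm at most \<open>\<beta>\<close> on the cube, and the squared norm of a field integrates
  to the squared Sobolev norm.
\<close>

lemma cutoff_net_sampling:
  fixes ns :: "'n::finite neuron list"
  assumes \<tau>: "\<tau> > 0" and m: "m > 0" and ns: "admissible ns"
  defines "\<beta> \<equiv> 2 * ((pi + 1) * (2 + 1 / \<tau>))"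
  obtains \<gamma> w t R r where "\<And>i. l1_norm (w i) = 1 \<and> \<bar>t i\<bar> \<le> 1"
    and "(\<Sum>i=1..m. \<bar>\<gamma> i\<bar>) \<le> mass ns"
    and "\<And>x. R x = cutoff x * (net \<tau> ns x - (\<Sum>i=1..m. \<gamma> i * softplus \<tau> (w i \<bullet> x - t i)))"
    and "\<And>x. x \<in> unit_cube \<Longrightarrow> (R has_derivative (\<lambda>v. r x \<bullet> v)) (at x)"
    and "bdd_meas cube_measure (\<lambda>x. (R x, r x))"
    and "(\<integral>x. (norm (R x, r x))\<^sup>2 \<partial>cube_measure) \<le> (mass ns * \<beta>)\<^sup>2 / real m"
proof -
  \<comment> \<open>A neuron of weight zero is added so that there is something to sample from.\<close>
  define ms :: "'n neuron list" where "ms = (0, axis undefined 1, 0) # ns"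
  have ms: "admissible ms" using ns by (auto simp: admissible_def ms_def l1_norm_axis)
  have net_ms: "net \<tau> ms = net \<tau> ns" and mass_ms: "mass ms = mass ns"
    by (auto simp: net_def mass_def ms_def)
  define J where "J = {..<length ms}"
  have J: "finite J" "J \<noteq> {}" by (auto simp: J_def ms_def)
  define a where "a j = fst (ms ! j)" for j
  define w where "w j = fst (snd (ms ! j))" for j
  define t where "t j = snd (snd (ms ! j))" for j
  have wt: "l1_norm (w j) = 1 \<and> \<bar>t j\<bar> \<le> 1" if "j \<in> J" for j
    using ms nth_mem[of j ms] that
    by (auto simp: admissible_def J_def w_def t_def split_def)
  define Q where "Q j y = cutoff y * softplus \<tau> (w j \<bullet> y - t j)" for j y
  have Q: "C1_le ((pi + 1) * (2 + 1 / \<tau>)) (Q j) x" if "j \<in> J" "x \<in> unit_cube" for j x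
    unfolding Q_def[abs_def] using wt[OF that(1)] by (intro C1_le_cutoff_mult C1_le_neuron \<tau> that) auto
  have Qd: "(Q j has_derivative (\<lambda>v. grad (Q j) x \<bullet> v)) (at x)" if "j \<in> J" "x \<in> unit_cube" for j x
    by (rule C1_le_grad(1)[OF Q[OF that]])
  define G where "G j x = (Q j x, grad (Q j) x)" for j x
  have mG: "G j \<in> borel_measurable cube_measure" if "j \<in> J" for j
    unfolding G_def[abs_def]
    by (intro borel_measurable_Pair gradient_cube_measurable[OF Qd[OF that]])
  have bG: "norm (G j x) \<le> \<beta>" if "j \<in> J" "x \<in> space cube_measure" for j x
  proof -
    have x: "x \<in> unit_cube" using that by simp
    have "norm (G j x) \<le> norm (Q j x) + norm (grad (Q j) x)" unfolding G_def by (rule norm_Pair_le)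
    moreover have "norm (Q j x) \<le> (pi + 1) * (2 + 1 / \<tau>)" using Q[OF that(1) x] by (simp add: C1_le_def)
    ultimately show ?thesis using C1_le_grad(2)[OF Q[OF that(1) x]] by (simp add: \<beta>_def)
  qed
  define L where "L = (\<Sum>j\<in>J. \<bar>a j\<bar>)"
  have L0: "0 \<le> L" by (simp add: L_def sum_nonneg)
  have L: "L = mass ns"
    unfolding mass_ms[symmetric] by (simp add: L_def mass_def J_def a_def sum_list_sum_nth split_def atLeast0LessThan)
  have netJ: "net \<tau> ns x = (\<Sum>j\<in>J. a j * softplus \<tau> (w j \<bullet> x - t j))" for x
    unfolding net_ms[symmetric]
    by (simp add: net_def J_def a_def w_def t_def sum_list_sum_nth split_def atLeast0LessThan)
  obtain idx where idx: "\<And>l. l < m \<Longrightarrow> idx l \<in> J" and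
    int: "(\<integral>x. (norm (real m *\<^sub>R (\<Sum>j\<in>J. a j *\<^sub>R G j x) - (\<Sum>l<m. (L * sgn (a (idx l))) *\<^sub>R G (idx l) x)))\<^sup>2 \<partial>cube_measure)
      \<le> real m * ((L * \<beta>)\<^sup>2 * measure cube_measure (space (cube_measure :: (real ^ 'n) measure)))"
    using maurey_sampling[where \<gamma> = a and m = m and G = G, OF finite_cube_measure J mG bG] unfolding L_def by blast
  define b where "b l = L * sgn (a (idx l)) / real m" for l
  define H where "H x = (\<Sum>j\<in>J. a j *\<^sub>R G j x) - (\<Sum>l<m. b l *\<^sub>R G (idx l) x)" for x
  have mH: "real m *\<^sub>R (\<Sum>j\<in>J. a j *\<^sub>R G j x) - (\<Sum>l<m. (L * sgn (a (idx l))) *\<^sub>R G (idx l) x) = real m *\<^sub>R H x" for x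
    using m by (simp add: H_def b_def scaleR_diff_right scaleR_sum_right)
  have bH: "bdd_meas cube_measure H"
  proof -
    have "bdd_meas cube_measure (G j)" if "j \<in> J" for j
      using mG[OF that] bG[OF that] unfolding bdd_meas_def by blast
    then show ?thesis unfolding H_def[abs_def]
      by (intro bdd_meas_diff bdd_meas_sum bdd_meas_scaleR J) (auto intro: idx)
  qed
  have intH: "(\<integral>x. (norm (H x))\<^sup>2 \<partial>cube_measure) \<le> (mass ns * \<beta>)\<^sup>2 / real m"
  proof -
    have "(real m)\<^sup>2 * (\<integral>x. (norm (H x))\<^sup>2 \<partial>cube_measure) \<le> real m * (L * \<beta>)\<^sup>2"
      using int unfolding mH by (simp add: measure_cube_measure power_mult_distrib)
    then have "real m * (\<integral>x. (norm (H x))\<^sup>2 \<partial>cube_measure) \<le> (L * \<beta>)\<^sup>2"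
      using m by (simp add: power2_eq_square mult.assoc)
    then show ?thesis using m by (simp add: L field_simps)
  qed
  define R where "R x = cutoff x * (net \<tau> ns x - (\<Sum>l<m. b l * softplus \<tau> (w (idx l) \<bullet> x - t (idx l))))" for x
  define r where "r x = (\<Sum>j\<in>J. a j *\<^sub>R grad (Q j) x) - (\<Sum>l<m. b l *\<^sub>R grad (Q (idx l)) x)" for x
  have RQ: "R x = (\<Sum>j\<in>J. a j * Q j x) - (\<Sum>l<m. b l * Q (idx l) x)" for x
    unfolding R_def netJ by (simp add: Q_def right_diff_distrib sum_distrib_left mult.left_commute)
  have HR: "H x = (R x, r x)" for x
    by (simp add: H_def G_def RQ r_def prod_eq_iff fst_sum snd_sum)
  have der: "(R has_derivative (\<lambda>v. r x \<bullet> v)) (at x)" if x: "x \<in> unit_cube" for x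
  proof -
    have "((\<lambda>x. (\<Sum>j\<in>J. a j * Q j x) - (\<Sum>l<m. b l * Q (idx l) x)) has_derivative
       (\<lambda>v. (\<Sum>j\<in>J. a j * (grad (Q j) x \<bullet> v)) - (\<Sum>l<m. b l * (grad (Q (idx l)) x \<bullet> v)))) (at x)"
      by (intro has_derivative_diff has_derivative_sum has_derivative_mult_right Qd x) (auto intro: idx)
    then show ?thesis
      unfolding RQ[abs_def] by (simp add: r_def inner_diff_left inner_sum_left)
  qed
  have sum1: "(\<Sum>i=1..m. q (i - 1)) = (\<Sum>l<m. q l)" for q :: "nat \<Rightarrow> real"
    by (rule sum.reindex_bij_witness[of _ Suc "\<lambda>i. i - 1"]) auto
  have masb: "(\<Sum>l<m. \<bar>b l\<bar>) \<le> mass ns"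
  proof -
    have "(\<Sum>l<m. \<bar>b l\<bar>) \<le> (\<Sum>l<m. L / real m)"
      using L0 by (intro sum_mono) (auto simp: b_def abs_mult abs_sgn_eq)
    then show ?thesis using m by (simp add: L)
  qed
  \<comment> \<open>The indices run from 1 to \<open>m\<close> in the network class and from 0 in the sample; outside the range any unit vector will do.\<close>
  define w' where "w' i = (if i - 1 < m then w (idx (i - 1)) else axis undefined 1)" for i
  define t' where "t' i = (if i - 1 < m then t (idx (i - 1)) else 0)" for i
  show ?thesis
  proof (rule that[of w' t' "\<lambda>i. b (i - 1)" R r])
    show "l1_norm (w' i) = 1 \<and> \<bar>t' i\<bar> \<le> 1" for i
      using wt idx by (auto simp: w'_def t'_def l1_norm_axis)
    show "(\<Sum>i=1..m. \<bar>b (i - 1)\<bar>) \<le> mass ns" using masb sum1[of "\<lambda>l. \<bar>b l\<bar>"] by simp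
    have "(\<Sum>i=1..m. b (i - 1) * softplus \<tau> (w' i \<bullet> x - t' i))
        = (\<Sum>i=1..m. b (i - 1) * softplus \<tau> (w (idx (i - 1)) \<bullet> x - t (idx (i - 1))))" for x
      by (intro sum.cong) (auto simp: w'_def t'_def)
    then show "R x = cutoff x * (net \<tau> ns x - (\<Sum>i=1..m. b (i - 1) * softplus \<tau> (w' i \<bullet> x - t' i)))" for x
      using sum1[of "\<lambda>l. b l * softplus \<tau> (w (idx l) \<bullet> x - t (idx l))"] by (simp add: R_def)
    show "(\<integral>x. (norm (R x, r x))\<^sup>2 \<partial>cube_measure) \<le> (mass ns * \<beta>)\<^sup>2 / real m"
      using intH by (simp only: HR)
    show "bdd_meas cube_measure (\<lambda>x. (R x, r x))" using bH by (simp only: HR[abs_def])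
  qed (rule der)
qed

text \<open>
  The weight \<open>|k|\<^sub>1\<close> of the quotient times the bounds for a wave of frequency \<open>|k|\<^sub>1\<close>, which are quadratic in
  \<open>y = \<pi> |k|\<^sub>1\<close>.  All of them are absorbed in \<open>1 + y\<^sup>3\<close> by means of \<open>|k|\<^sub>1 \<le> y / 3\<close> and \<open>y \<ge> 3\<close>.
\<close>

lemma net_approx_sine_quotient:
  fixes k :: "nat ^ 'n" and c :: real
  assumes \<tau>: "\<tau> \<ge> 9" and k: "\<And>i. k $ i > 0"
  defines "b \<equiv> \<bar>c\<bar> * (1 + (pi * sine_freq k) ^ 3)"
  shows "net_approx \<tau> b (2 * b) (9 * b / \<tau>) (\<lambda>x. c * sine_quotient k x)"
proof -
  define K where "K = sine_freq k"
  define y where "y = pi * K"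
  have K1: "1 \<le> K" unfolding K_def by (rule sine_freq_ge_1[OF k])
  have K: "0 \<le> K" "3 * K \<le> y" using K1 pi_gt3 by (auto simp: y_def)
  have y: "3 \<le> y" using K K1 by linarith
  have y2: "3 * y \<le> y\<^sup>2" "3 * y\<^sup>2 \<le> y ^ 3"
    using y by (auto simp: power2_eq_square power3_eq_cube)
  have "trig_comb K (\<bar>c\<bar> * K) (\<lambda>x. c * sine_quotient k x)"
    using trig_comb_scale[OF trig_comb_sine_quotient] by (simp add: K_def)
  then have "net_approx \<tau> ((\<bar>c\<bar> * K) * (1 + 2 * y\<^sup>2 * (1 + 1 / \<tau>))) ((\<bar>c\<bar> * K) * (2 * y + 2 * y\<^sup>2)) ((\<bar>c\<bar> * K) * (5 * y\<^sup>2 / \<tau>))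
      (\<lambda>x. c * sine_quotient k x)"
    unfolding y_def using \<tau> by (intro net_approx_trig_comb) auto
  then show ?thesis
  proof (rule net_approx_mono)
    have Ky: "K * y\<^sup>2 \<le> y ^ 3 / 3"
      using mult_right_mono[OF K(2), of "y\<^sup>2"] by (simp add: power2_eq_square power3_eq_cube)
    have \<tau>9: "1 + 1 / \<tau> \<le> 10 / 9" using \<tau> by (simp add: field_simps)
    have "K * (1 + 2 * y\<^sup>2 * (1 + 1 / \<tau>)) \<le> K * (1 + 2 * y\<^sup>2 * (10 / 9))"
      using K \<tau>9 by (intro mult_left_mono add_left_mono) auto
    also have "\<dots> = K + (20 / 9) * (K * y\<^sup>2)" by (simp add: algebra_simps)
    also have "\<dots> \<le> 1 + y ^ 3" using Ky K y2 y by linarith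
    finally have "\<bar>c\<bar> * (K * (1 + 2 * y\<^sup>2 * (1 + 1 / \<tau>))) \<le> \<bar>c\<bar> * (1 + y ^ 3)"
      by (rule mult_left_mono) simp
    then show "\<bar>c\<bar> * K * (1 + 2 * y\<^sup>2 * (1 + 1 / \<tau>)) \<le> b"
      unfolding b_def y_def K_def by (simp only: mult.assoc)
    have Ky1: "K * y \<le> K * y\<^sup>2" using y K by (intro mult_left_mono) (auto simp: power2_eq_square)
    have "K * (2 * y + 2 * y\<^sup>2) = 2 * (K * y) + 2 * (K * y\<^sup>2)" by (simp add: algebra_simps)
    also have "\<dots> \<le> 2 * (1 + y ^ 3)"
      unfolding distrib_left using Ky Ky1 y2 y by linarith
    finally have "\<bar>c\<bar> * (K * (2 * y + 2 * y\<^sup>2)) \<le> \<bar>c\<bar> * (2 * (1 + y ^ 3))"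
      by (rule mult_left_mono) simp
    then show "\<bar>c\<bar> * K * (2 * y + 2 * y\<^sup>2) \<le> 2 * b"
      unfolding b_def y_def K_def by (simp only: mult.assoc mult.left_commute[of 2])
    have "K * (5 * y\<^sup>2) = 5 * (K * y\<^sup>2)" by simp
    also have "\<dots> \<le> 9 * (1 + y ^ 3)" unfolding distrib_left using Ky y2 y by linarith
    finally have "\<bar>c\<bar> * (K * (5 * y\<^sup>2)) \<le> \<bar>c\<bar> * (9 * (1 + y ^ 3))"
      by (rule mult_left_mono) simp
    then have "\<bar>c\<bar> * (K * (5 * y\<^sup>2)) / \<tau> \<le> \<bar>c\<bar> * (9 * (1 + y ^ 3)) / \<tau>"
      using \<tau> by (intro divide_right_mono) auto
    then show "\<bar>c\<bar> * K * (5 * y\<^sup>2 / \<tau>) \<le> 9 * b / \<tau>"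
      unfolding b_def y_def K_def by (simp add: mult.assoc mult.left_commute)
  qed
qed

theorem theorem4:
  fixes u :: "real ^ 'n \<Rightarrow> real" and s B :: real and m :: nat
  assumes "s \<ge> 3"
    and "u \<in> barron_space s"
    and "B = (1 + 2 * real CARD('n) / (pi * s)) * enn2real (barron_norm s u)"
    and "m > 0"
  shows "\<exists>v \<in> network_class (softplus (9 * sqrt (real m))) m B.
           (\<lambda>x. u x - cutoff x * v x) \<in> H1_space unit_cube \<and>
           H1_norm unit_cube (\<lambda>x. u x - cutoff x * v x) \<le> 64 * B / sqrt (real m)"
proof -
  define X where "X = enn2real (barron_norm s u)"
  have X0: "0 \<le> X" by (simp add: X_def)
  have XB: "X \<le> B"
  proof -
    have "1 * X \<le> (1 + 2 * real CARD('n) / (pi * s)) * X"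
      using assms(1) X0 by (intro mult_right_mono) auto
    then show ?thesis by (simp add: assms(3) X_def)
  qed
  define \<tau> where "\<tau> = 9 * sqrt (real m)"
  have m1: "1 \<le> sqrt (real m)" using assms(4) by simp
  then have \<tau>: "\<tau> \<ge> 9" by (simp add: \<tau>_def)
  define e where "e = X / sqrt (real m)"
  have e0: "0 \<le> e" using X0 by (simp add: e_def)
  have e2: "e\<^sup>2 = X\<^sup>2 / real m" by (simp add: e_def power_divide)
  obtain \<kappa> :: "nat \<Rightarrow> nat ^ 'n" where pos: "\<And>n i. \<kappa> n $ i > 0"
    and sb: "summable (\<lambda>n. \<bar>sine_coeff u (\<kappa> n)\<bar> * (1 + (pi * sine_freq (\<kappa> n)) ^ 3))"
    and sumb: "(\<Sum>n. \<bar>sine_coeff u (\<kappa> n)\<bar> * (1 + (pi * sine_freq (\<kappa> n)) ^ 3)) \<le> X"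
    and ae: "AE x in lebesgue. x \<in> unit_cube \<longrightarrow> (\<lambda>n. sine_coeff u (\<kappa> n) * sine_basis (\<kappa> n) x) sums u x"
    using barron_sine_expansion[OF assms(2,1)] unfolding X_def by blast
  define c where "c n = sine_coeff u (\<kappa> n)" for n
  define b where "b n = \<bar>c n\<bar> * (1 + (pi * sine_freq (\<kappa> n)) ^ 3)" for n
  note sb = sb[folded c_def, folded b_def] and sumb = sumb[folded c_def, folded b_def] and ae = ae[folded c_def]
  have b0: "0 \<le> b n" for n using sine_freq_nonneg[of "\<kappa> n"] by (simp add: b_def)
  \<comment> \<open>If \<open>X = 0\<close> then \<open>e = 0\<close>, and all coefficients vanish.\<close>
  obtain N where N: "(\<Sum>n. b (n + N)) \<le> e"
  proof (cases "e > 0")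
    case True
    then have "\<exists>N. (\<Sum>n. b (n + N)) < e"
      using suminf_tail_eventually[OF sb, of e] by (auto simp: eventually_sequentially)
    then show ?thesis using that less_imp_le by blast
  next
    case False
    then have "X = 0" using e0 m1 by (auto simp: e_def)
    then show ?thesis using sumb e0 by (intro that[of 0]) simp
  qed
  have b1: "\<bar>c n\<bar> * (1 + pi * sine_freq (\<kappa> n)) \<le> b n" for n
  proof -
    have "1 \<le> pi * sine_freq (\<kappa> n)" by (rule one_le_pi_sine_freq[OF pos])
    then have "pi * sine_freq (\<kappa> n) \<le> (pi * sine_freq (\<kappa> n)) ^ 3" by (intro self_le_power) auto
    then show ?thesis unfolding b_def by (intro mult_left_mono) auto
  qed
  have sN: "summable (\<lambda>n. b (n + N))" using sb by (rule summable_ignore_initial_segment)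
  have sa: "summable (\<lambda>n. \<bar>c (n + N)\<bar> * (1 + pi * sine_freq (\<kappa> (n + N))))"
  proof (rule summable_comparison_test'[OF sN, of 0])
    fix n
    have "0 \<le> \<bar>c (n + N)\<bar> * (1 + pi * sine_freq (\<kappa> (n + N)))"
      by (simp add: sine_freq_nonneg)
    then show "norm (\<bar>c (n + N)\<bar> * (1 + pi * sine_freq (\<kappa> (n + N)))) \<le> b (n + N)"
      using b1[of "n + N"] by (simp only: real_norm_def abs_of_nonneg)
  qed
  have "(\<Sum>n. \<bar>c (n + N)\<bar> * (1 + pi * sine_freq (\<kappa> (n + N)))) \<le> (\<Sum>n. b (n + N))"
    by (rule suminf_le[OF b1 sa sN])
  then have tail_le: "(\<Sum>n. \<bar>c (n + N)\<bar> * (1 + pi * sine_freq (\<kappa> (n + N)))) \<le> e" using N by linarith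
  obtain W where W: "\<And>x. (\<lambda>n. c (n + N) * sine_basis (\<kappa> (n + N)) x) sums W x"
    and "\<And>x. C1_le (\<Sum>n. \<bar>c (n + N)\<bar> * (1 + pi * sine_freq (\<kappa> (n + N)))) W x"
    using sine_series_C1[OF sa] by blast
  then have W1: "C1_le e W x" for x using C1_le_mono[OF _ tail_le] by blast
  define P where "P x = (\<Sum>n<N. c n * sine_basis (\<kappa> n) x) + W x" for x
  have uP: "AE x in lebesgue. x \<in> unit_cube \<longrightarrow> u x = P x"
    using ae
  proof eventually_elim
    case (elim x)
    show ?case
    proof
      assume "x \<in> unit_cube"
      then have "(\<lambda>n. c n * sine_basis (\<kappa> n) x) sums u x" using elim by blast
      then have "(\<lambda>n. c (n + N) * sine_basis (\<kappa> (n + N)) x) sums (u x - (\<Sum>n<N. c n * sine_basis (\<kappa> n) x))"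
        by (rule sums_split_initial_segment)
      then have "u x - (\<Sum>n<N. c n * sine_basis (\<kappa> n) x) = W x" using W sums_unique2 by blast
      then show "u x = P x" by (simp add: P_def)
    qed
  qed
  define f where "f x = (\<Sum>n<N. c n * sine_quotient (\<kappa> n) x)" for x
  have Pf: "P x = cutoff x * f x + W x" if "x \<in> unit_cube" for x
    using cutoff_sine_quotient[OF that]
    by (simp add: P_def f_def sum_distrib_left mult.left_commute)
  have "net_approx \<tau> (\<Sum>n<N. b n) (\<Sum>n<N. 2 * b n) (\<Sum>n<N. 9 * b n / \<tau>) f"
    unfolding f_def[abs_def] b_def by (intro net_approx_sum net_approx_sine_quotient \<tau> pos)
  moreover have sbN: "(\<Sum>n<N. b n) \<le> X"
    using sum_le_suminf[OF sb, of "{..<N}"] b0 sumb by auto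
  moreover have "(\<Sum>n<N. 2 * b n) \<le> 2 * X" using sbN by (simp flip: sum_distrib_left)
  moreover have "(\<Sum>n<N. 9 * b n / \<tau>) \<le> e"
  proof -
    have "(\<Sum>n<N. 9 * b n / \<tau>) = (\<Sum>n<N. b n) / sqrt (real m)"
      by (simp add: \<tau>_def sum_divide_distrib)
    also have "\<dots> \<le> e" unfolding e_def using sbN by (intro divide_right_mono) auto
    finally show ?thesis .
  qed
  ultimately have "net_approx \<tau> X (2 * X) e f" by (rule net_approx_mono)
  then obtain c0 ns where c0: "\<bar>c0\<bar> \<le> X" and ns: "admissible ns" and mass: "mass ns \<le> 2 * X"
    and err: "\<And>x. x \<in> unit_cube \<Longrightarrow> C1_le e (\<lambda>y. f y - c0 - net \<tau> ns y) x"
    unfolding net_approx_def by blast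
  have \<tau>0: "\<tau> > 0" using \<tau> by simp
  obtain \<gamma> w t R r where wt: "\<And>i. l1_norm (w i) = 1 \<and> \<bar>t i\<bar> \<le> 1"
    and \<gamma>: "(\<Sum>i=1..m. \<bar>\<gamma> i\<bar>) \<le> mass ns"
    and R: "\<And>x. R x = cutoff x * (net \<tau> ns x - (\<Sum>i=1..m. \<gamma> i * softplus \<tau> (w i \<bullet> x - t i)))"
    and Rd: "\<And>x. x \<in> unit_cube \<Longrightarrow> (R has_derivative (\<lambda>v. r x \<bullet> v)) (at x)"
    and Rb: "bdd_meas cube_measure (\<lambda>x. (R x, r x))"
    and Rint: "(\<integral>x. (norm (R x, r x))\<^sup>2 \<partial>cube_measure) \<le> (mass ns * (2 * ((pi + 1) * (2 + 1 / \<tau>))))\<^sup>2 / real m"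
    by (rule cutoff_net_sampling[OF \<tau>0 assms(4) ns]) (rule that)
  define v where "v x = c0 + (\<Sum>i=1..m. \<gamma> i * softplus \<tau> (w i \<bullet> x - t i))" for x
  have v: "v \<in> network_class (softplus \<tau>) m B"
  proof -
    have "\<bar>c0\<bar> \<le> B" "(\<Sum>i=1..m. \<bar>\<gamma> i\<bar>) \<le> 4 * B" using c0 XB \<gamma> mass X0 by linarith+
    then show ?thesis unfolding network_class_def v_def[abs_def] using wt by blast
  qed
  \<comment> \<open>The error splits into \<open>E\<close>, which is small together with its gradient at every point of the cube, and the sampling error \<open>R\<close>, which is small in the mean.\<close>
  define E where "E x = W x + cutoff x * (f x - c0 - net \<tau> ns x)" for x
  have "C1_le (e + (pi + 1) * e) E x" if "x \<in> unit_cube" for x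
    unfolding E_def[abs_def] by (intro C1_le_add W1 C1_le_cutoff_mult that err)
  moreover have "e + (pi + 1) * e \<le> 6 * e"
    using mult_right_mono[OF less_imp_le[OF pi_less_4] e0] by (simp add: distrib_right)
  ultimately have E: "C1_le (6 * e) E x" if "x \<in> unit_cube" for x using that C1_le_mono by blast
  have Ed: "(E has_derivative (\<lambda>v. grad E x \<bullet> v)) (at x)" "norm (grad E x) \<le> 6 * e" "\<bar>E x\<bar> \<le> 6 * e"
    if "x \<in> unit_cube" for x
    using C1_le_grad[OF E[OF that]] E[OF that] by (auto simp: C1_le_def)
  define F where "F x = E x + R x" for x
  define g where "g x = grad E x + r x" for x
  have FP: "F x = P x - cutoff x * v x" if "x \<in> unit_cube" for x
    unfolding F_def E_def R Pf[OF that] v_def by (simp add: algebra_simps)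
  have Fd: "(F has_derivative (\<lambda>v. g x \<bullet> v)) (at x)" if "x \<in> unit_cube" for x
    unfolding F_def[abs_def] g_def inner_add_left by (intro has_derivative_add Ed Rd that)
  obtain C where C: "\<And>x. x \<in> unit_cube \<Longrightarrow> norm (R x, r x) \<le> C"
    using Rb unfolding bdd_meas_def space_cube_measure by blast
  have F_le: "\<bar>F x\<bar> \<le> 6 * e + C" and g_le: "norm (g x) \<le> 6 * e + C" if "x \<in> unit_cube" for x
  proof -
    have "norm (R x) \<le> C" "norm (r x) \<le> C"
      using C[OF that] norm_fst_le[of "R x" "r x"] norm_snd_le[of "r x" "R x"] by linarith+
    then show "\<bar>F x\<bar> \<le> 6 * e + C" "norm (g x) \<le> 6 * e + C"
      using Ed(2,3)[OF that] norm_triangle_ineq[of "grad E x" "r x"] by (auto simp: F_def g_def)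
  qed
  have mf: "set_borel_measurable lebesgue unit_cube (\<lambda>x. u x - cutoff x * v x)"
  proof -
    have "continuous_on UNIV W"
      using W1 C1_le_grad(1) by (intro continuous_at_imp_continuous_on) (blast intro: has_derivative_continuous)
    then have "continuous_on UNIV P"
      unfolding P_def[abs_def] by (intro continuous_intros continuous_on_subset[OF continuous_sine_basis]) auto
    then have "P \<in> borel_measurable borel" by (rule borel_measurable_continuous_onI)
    then have "P \<in> borel_measurable lebesgue" by (auto intro: measurable_completion)
    moreover have "(\<lambda>x. indicator unit_cube x *\<^sub>R F x) \<in> borel_measurable lebesgue"
      using gradient_measurable(1)[OF open_unit_cube Fd] by (auto intro: measurable_completion)
    moreover have "(\<lambda>x. indicator unit_cube x *\<^sub>R u x) \<in> borel_measurable lebesgue"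
      using assms(2) by (auto simp: barron_space_def set_integrable_def)
    ultimately have "(\<lambda>x. indicator unit_cube x *\<^sub>R u x - (indicator unit_cube x * P x - indicator unit_cube x *\<^sub>R F x))
        \<in> borel_measurable lebesgue"
      by (intro borel_measurable_diff borel_measurable_times borel_measurable_indicator unit_cube_lebesgue)
    moreover have "indicator unit_cube x *\<^sub>R u x - (indicator unit_cube x * P x - indicator unit_cube x *\<^sub>R F x)
      = indicator unit_cube x *\<^sub>R (u x - cutoff x * v x)" for x
      by (cases "x \<in> unit_cube") (auto simp: FP)
    ultimately show ?thesis by (simp add: set_borel_measurable_def)
  qed
  have ae': "AE x in lebesgue. x \<in> unit_cube \<longrightarrow> u x - cutoff x * v x = F x"
    using uP by eventually_elim (simp add: FP)
  note H1 = H1_classical[OF open_unit_cube bounded_unit_cube Fd F_le g_le mf ae']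
  interpret finite_measure "cube_measure :: (real ^ 'n) measure" by (rule finite_cube_measure)
  have "bdd_meas cube_measure F" "bdd_meas cube_measure g"
    using gradient_cube_measurable[OF Fd] F_le g_le unfolding bdd_meas_def by auto
  then have iF: "integrable cube_measure (\<lambda>x. (F x)\<^sup>2)" and ig: "integrable cube_measure (\<lambda>x. (norm (g x))\<^sup>2)"
    using bdd_meas_integrable_square[OF finite_cube_measure, of F] bdd_meas_integrable_square[OF finite_cube_measure, of g]
    by auto
  have iH: "integrable cube_measure (\<lambda>x. (norm (R x, r x))\<^sup>2)"
    by (rule bdd_meas_integrable_square[OF finite_cube_measure Rb])
  have "(LINT x:unit_cube|lebesgue. (F x)\<^sup>2) + (LINT x:unit_cube|lebesgue. (norm (g x))\<^sup>2)
     = (\<integral>x. (F x)\<^sup>2 + (norm (g x))\<^sup>2 \<partial>cube_measure)"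
    unfolding set_integral_cube using iF ig by simp
  also have "\<dots> \<le> (\<integral>x. 144 * e\<^sup>2 + 2 * (norm (R x, r x))\<^sup>2 \<partial>cube_measure)"
  proof (rule integral_mono)
    fix x :: "real ^ 'n" assume "x \<in> space cube_measure"
    then have x: "x \<in> unit_cube" by simp
    \<comment> \<open>This replaces the triangle inequality for the Sobolev norm, at the price of a factor 2.\<close>
    have sq: "(p + q)\<^sup>2 \<le> 2 * p\<^sup>2 + 2 * q\<^sup>2" for p q :: real
      using sum_squares_ge_zero[of "p - q" 0] by (simp add: power2_eq_square algebra_simps)
    have "(F x)\<^sup>2 \<le> 2 * (E x)\<^sup>2 + 2 * (R x)\<^sup>2" unfolding F_def by (rule sq)
    moreover have "(norm (g x))\<^sup>2 \<le> (norm (grad E x) + norm (r x))\<^sup>2"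
      unfolding g_def by (intro power_mono norm_triangle_ineq) auto
    moreover have "\<dots> \<le> 2 * (norm (grad E x))\<^sup>2 + 2 * (norm (r x))\<^sup>2" by (rule sq)
    moreover have "(E x)\<^sup>2 \<le> (6 * e)\<^sup>2" using power_mono[OF Ed(3)[OF x], of 2] by simp
    moreover have "(norm (grad E x))\<^sup>2 \<le> (6 * e)\<^sup>2" using Ed(2)[OF x] by (intro power_mono) auto
    moreover have "(norm (R x, r x))\<^sup>2 = (R x)\<^sup>2 + (norm (r x))\<^sup>2" by (simp add: norm_Pair)
    moreover have "(6 * e)\<^sup>2 = 36 * e\<^sup>2" by (simp add: power_mult_distrib)
    ultimately show "(F x)\<^sup>2 + (norm (g x))\<^sup>2 \<le> 144 * e\<^sup>2 + 2 * (norm (R x, r x))\<^sup>2" by linarith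
  qed (use iF ig iH in auto)
  also have "\<dots> = 144 * e\<^sup>2 + 2 * (\<integral>x. (norm (R x, r x))\<^sup>2 \<partial>cube_measure)"
    using iH by (simp add: measure_cube_measure)
  also have "\<dots> \<le> 144 * e\<^sup>2 + 2 * ((36 * X)\<^sup>2 / real m)"
  proof -
    have "(pi + 1) * (2 + 1 / \<tau>) \<le> 9"
    proof -
      have "1 / \<tau> \<le> 1 / 9" using \<tau> by (simp add: field_simps)
      then have "(pi + 1) * (2 + 1 / \<tau>) \<le> (pi + 1) * (2 + 1 / 9)" by (intro mult_left_mono) auto
      also have "\<dots> \<le> 9" using pi_approx by simp
      finally show ?thesis .
    qed
    then have "mass ns * (2 * ((pi + 1) * (2 + 1 / \<tau>))) \<le> (2 * X) * (2 * 9)"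
      using mass X0 \<tau>0 by (intro mult_mono) auto
    moreover have "0 \<le> mass ns" unfolding mass_def by (rule sum_list_nonneg) auto
    then have "0 \<le> mass ns * (2 * ((pi + 1) * (2 + 1 / \<tau>)))" using \<tau>0 by auto
    ultimately have "(mass ns * (2 * ((pi + 1) * (2 + 1 / \<tau>))))\<^sup>2 \<le> (36 * X)\<^sup>2"
      by (intro power_mono) auto
    from order_trans[OF Rint divide_right_mono[OF this, of "real m"]]
    have "(\<integral>x. (norm (R x, r x))\<^sup>2 \<partial>cube_measure) \<le> (36 * X)\<^sup>2 / real m" by simp
    then show ?thesis by (intro add_left_mono mult_left_mono) auto
  qed
  also have "\<dots> = 2736 * X\<^sup>2 / real m" unfolding e2 by (simp add: power_mult_distrib)
  also have "\<dots> \<le> (64 * B / sqrt (real m))\<^sup>2"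
  proof -
    have "X\<^sup>2 \<le> B\<^sup>2" using XB X0 by (rule power_mono)
    then have "2736 * X\<^sup>2 \<le> 4096 * B\<^sup>2" using zero_le_power2[of B] by linarith
    then have "2736 * X\<^sup>2 / real m \<le> 4096 * B\<^sup>2 / real m" by (intro divide_right_mono) auto
    then show ?thesis by (simp add: power_divide power_mult_distrib)
  qed
  finally have "sqrt ((LINT x:unit_cube|lebesgue. (F x)\<^sup>2) + (LINT x:unit_cube|lebesgue. (norm (g x))\<^sup>2))
      \<le> 64 * B / sqrt (real m)"
    using XB X0 by (intro real_le_lsqrt) auto
  then have "H1_norm unit_cube (\<lambda>x. u x - cutoff x * v x) \<le> 64 * B / sqrt (real m)"
    using H1(2) by linarith
  then show ?thesis using v H1(1) unfolding \<tau>_def by blast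
qed

end
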